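(* Let $f:S^n\to S^m$ be an LOMSE with nonzero singular value $\lambda$ of multiplicity $p$. Then there exists an integer $k\ge 2$ such that: 1. Writing $f(x)=(f_1(x),\dots,f_{m+1}(x))$ in $\mathbb R^{m+1}$ (i.e. composing $f$ with the inclusion $S^m\subset\mathbb R^{m+1}$), each component $f_i$ is a spherical harmonic function of degree $k$ on $S^n$. 2. $\lambda=\sqrt{\dfrac{k(k+n-1)}{p}}$. 3. For $\theta\in(0,\pi/2)$, $M_{f,\theta}$ is an LOS (i.e. is minimal in $S^{n+m+1}$) if and only if $$\theta=\arccos\sqrt{\frac{1-\frac pn}{1-\frac{p}{k(k+n-1)}}}.$$
   Context: $S^d\subset\mathbb R^{d+1}$ is the unit sphere and $g_d$ its canonical (round) metric. The singular values of $(f_* )_x:(T_xS^n,g_n)\to(T_{f(x)}S^m,g_m)$ are the critical values of $v\mapsto |f_*v|/|v|$, i.e. the usual singular values, counted with multiplicity. For smooth $f:S^n\to S^m$ and $\theta\in(0,\pi/2)$ put $M_{f,\theta}:=\{(\cos\theta\cdot x,\sin\theta\cdot f(x)):x\in S^n\}\subset S^{n+m+1}$. The map $f$ is a Lawson-Osserman map (LOM) if there is $\theta\in(0,\pi/2)$ such that $M_{f,\theta}$ is a minimal submanifold of $S^{n+m+1}$; then $M_{f,\theta}$ is called a Lawson-Osserman sphere (LOS). An LOMSE is an LOM that is not totally geodesic (as a map $(S^n,g_n)\to(S^m,g_m)$) and such that, for each $x\in S^n$, all nonzero singular values of $(f_* )_x$ are equal. For an LOMSE the nonzero singular value $\lambda$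 and its multiplicity $p$ are constant on $S^n$. *)

theory Defs
  imports "HOL-Analysis.Analysis"
begin

section \<open>Smooth maps and submanifolds of Euclidean spaces\<close>

primrec Ck_on :: "nat \<Rightarrow> ('a::real_normed_vector \<Rightarrow> 'b::real_normed_vector) \<Rightarrow> 'a set \<Rightarrow> bool" where
  "Ck_on 0 f U \<longleftrightarrow> continuous_on U f"
| "Ck_on (Suc k) f U \<longleftrightarrow> (\<forall>x\<in>U. f differentiable (at x)) \<and>
     (\<forall>v. Ck_on k (\<lambda>x. frechet_derivative f (at x) v) U)"

text \<open>Smoothness on an arbitrary subset means local existence of smooth extensions.\<close>

definition smooth_on :: "'a::real_normed_vector set \<Rightarrow> ('a \<Rightarrow> 'b::real_normed_vector) \<Rightarrow> bool" where
  "smooth_on M f \<longleftrightarrow> (\<forall>x\<in>M. \<exists>U F. open U \<and> x \<in> U \<and> (\<forall>k. Ck_on k F U) \<and> (\<forall>y\<in>M \<inter> U. F y = f y))"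

text \<open>A subset that is locally the zero set of a submersion onto a vector space
  \<open>W\<close> of dimension \<open>DIM('a) - d\<close>.\<close>

definition embedded_submanifold :: "nat \<Rightarrow> 'a::euclidean_space set \<Rightarrow> bool" where
  "embedded_submanifold d M \<longleftrightarrow>
     (\<forall>p\<in>M. \<exists>U W (G :: 'a \<Rightarrow> 'a). open U \<and> p \<in> U \<and> subspace W \<and> dim W + d = DIM('a) \<and>
        smooth_on U G \<and> G ` U \<subseteq> W \<and> M \<inter> U = {q\<in>U. G q = 0} \<and>
        (\<forall>q\<in>M \<inter> U. range (frechet_derivative G (at q)) = W))"

definition tangent_space :: "'a::euclidean_space set \<Rightarrow> 'a \<Rightarrow> 'a set" where
  "tangent_space M p =
     {v. \<exists>(\<gamma> :: real \<Rightarrow> 'a) \<epsilon>. \<epsilon> > 0 \<and> smooth_on {-\<epsilon><..<\<epsilon>} \<gamma> \<and> \<gamma> ` {-\<epsilon><..<\<epsilon>} \<subseteq> M \<and>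
        \<gamma> 0 = p \<and> (\<gamma> has_vector_derivative v) (at 0)}"

text \<open>The derivative at \<open>p \<in> M\<close> of a smooth vector-valued map on \<open>M\<close>. Derivatives
  within \<open>M\<close> are not unique as linear maps on the ambient space, but any two of them agree
  on \<open>tangent_space M p\<close>; only the values there are ever used.\<close>

definition differential ::
  "'a::euclidean_space set \<Rightarrow> ('a \<Rightarrow> 'b::euclidean_space) \<Rightarrow> 'a \<Rightarrow> 'a \<Rightarrow> 'b" where
  "differential M f p = frechet_derivative f (at p within M)"

definition orth_proj :: "'a::euclidean_space set \<Rightarrow> 'a \<Rightarrow> 'a" where
  "orth_proj V u = (THE y. y \<in> V \<and> (\<forall>z\<in>V. (u - y) \<bullet> z = 0))"

definition tangent_field :: "'a::euclidean_space set \<Rightarrow> ('a \<Rightarrow> 'a) \<Rightarrow> bool" where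
  "tangent_field M X \<longleftrightarrow> smooth_on M X \<and> (\<forall>p\<in>M. X p \<in> tangent_space M p)"

text \<open>For a section \<open>Z\<close> of the pullback of the tangent bundle of \<open>N\<close> along
  \<open>f : M \<rightarrow> N\<close>, the covariant derivative \<open>\<nabla>\<^sub>v Z\<close> at \<open>p\<close>, where \<open>N\<close>
  carries the Levi-Civita connection of the induced metric, i.e. the tangential part of the
  Euclidean derivative. With \<open>f = id\<close> it is the Levi-Civita connection of \<open>M\<close>.\<close>

definition cov_deriv :: "'a::euclidean_space set \<Rightarrow> 'b::euclidean_space set \<Rightarrow> ('a \<Rightarrow> 'b) \<Rightarrow>
    ('a \<Rightarrow> 'b) \<Rightarrow> 'a \<Rightarrow> 'a \<Rightarrow> 'b" where
  "cov_deriv M N f Z p v = orth_proj (tangent_space N (f p)) (differential M Z p v)"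

text \<open>Vanishing of the second fundamental form
  \<open>(\<nabla>df)(v, X) = \<nabla>\<^sub>v (f\<^sub>* X) - f\<^sub>* (\<nabla>\<^sub>v X)\<close> of the map \<open>f : M \<rightarrow> N\<close>.\<close>

definition totally_geodesic_map ::
  "'a::euclidean_space set \<Rightarrow> 'b::euclidean_space set \<Rightarrow> ('a \<Rightarrow> 'b) \<Rightarrow> bool" where
  "totally_geodesic_map M N f \<longleftrightarrow>
     (\<forall>X p v. tangent_field M X \<and> p \<in> M \<and> v \<in> tangent_space M p \<longrightarrow>
        cov_deriv M N f (\<lambda>q. differential M f q (X q)) p v =
        differential M f p (cov_deriv M M id X p v))"


section \<open>Minimal submanifolds\<close>

text \<open>The second fundamental form of \<open>M\<close> in \<open>N\<close>: the component of \<open>D\<^sub>v X\<close> tangent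
  to \<open>N\<close> and normal to \<open>M\<close>, for any tangent field \<open>X\<close> on \<open>M\<close> extending \<open>w\<close>.\<close>

definition normal_space :: "'a::euclidean_space set \<Rightarrow> 'a set \<Rightarrow> 'a \<Rightarrow> 'a set" where
  "normal_space M N p = {\<nu> \<in> tangent_space N p. \<forall>v\<in>tangent_space M p. \<nu> \<bullet> v = 0}"

definition second_fundamental_form ::
  "'a::euclidean_space set \<Rightarrow> 'a set \<Rightarrow> 'a \<Rightarrow> 'a \<Rightarrow> 'a \<Rightarrow> 'a" where
  "second_fundamental_form M N p v w =
     (THE u. \<exists>X. tangent_field M X \<and> X p = w \<and>
        u = orth_proj (normal_space M N p) (differential M X p v))"

definition orthonormal_basis_of :: "'a::euclidean_space set \<Rightarrow> 'a set \<Rightarrow> bool" where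
  "orthonormal_basis_of V E \<longleftrightarrow> pairwise orthogonal E \<and> (\<forall>e\<in>E. norm e = 1) \<and> span E = V"

text \<open>Vanishing mean curvature; the trace does not depend on the orthonormal basis.\<close>

definition minimal_submanifold :: "'a::euclidean_space set \<Rightarrow> 'a set \<Rightarrow> bool" where
  "minimal_submanifold M N \<longleftrightarrow> (\<exists>d. embedded_submanifold d M) \<and> M \<subseteq> N \<and>
     (\<forall>p\<in>M. \<forall>E. orthonormal_basis_of (tangent_space M p) E \<longrightarrow>
        (\<Sum>e\<in>E. second_fundamental_form M N p e e) = 0)"


section \<open>Singular values and Lawson-Osserman maps\<close>

text \<open>The solutions \<open>v\<close> of \<open>(f\<^sub>*)\<^sup>T f\<^sub>* v = s\<^sup>2 v\<close> in \<open>tangent_space M x\<close>, the adjoint being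
  written out in terms of the inner products.\<close>

definition singular_space ::
  "'a::euclidean_space set \<Rightarrow> ('a \<Rightarrow> 'b::euclidean_space) \<Rightarrow> 'a \<Rightarrow> real \<Rightarrow> 'a set" where
  "singular_space M f x s = {v \<in> tangent_space M x. \<forall>w\<in>tangent_space M x.
     differential M f x v \<bullet> differential M f x w = s\<^sup>2 * (v \<bullet> w)}"

definition singular_value ::
  "'a::euclidean_space set \<Rightarrow> ('a \<Rightarrow> 'b::euclidean_space) \<Rightarrow> 'a \<Rightarrow> real \<Rightarrow> bool" where
  "singular_value M f x s \<longleftrightarrow> s \<ge> 0 \<and> (\<exists>v\<in>singular_space M f x s. v \<noteq> 0)"

definition singular_multiplicity ::
  "'a::euclidean_space set \<Rightarrow> ('a \<Rightarrow> 'b::euclidean_space) \<Rightarrow> 'a \<Rightarrow> real \<Rightarrow> nat" where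
  "singular_multiplicity M f x s = dim (singular_space M f x s)"

text \<open>Below, the sphere of dimension \<open>n\<close> is \<open>sphere 0 1\<close> in a space of dimension
  \<open>n + 1\<close>, and the product space carries the product inner product.\<close>

definition LO_set ::
  "('a::euclidean_space \<Rightarrow> 'b::euclidean_space) \<Rightarrow> real \<Rightarrow> ('a \<times> 'b) set" where
  "LO_set f \<theta> = (\<lambda>x. (cos \<theta> *\<^sub>R x, sin \<theta> *\<^sub>R f x)) ` sphere 0 1"

definition is_LOS :: "('a::euclidean_space \<Rightarrow> 'b::euclidean_space) \<Rightarrow> real \<Rightarrow> bool" where
  "is_LOS f \<theta> \<longleftrightarrow> minimal_submanifold (LO_set f \<theta>) (sphere 0 1)"

definition LOM :: "('a::euclidean_space \<Rightarrow> 'b::euclidean_space) \<Rightarrow> bool" where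
  "LOM f \<longleftrightarrow> smooth_on (sphere 0 1) f \<and> f ` sphere 0 1 \<subseteq> sphere 0 1 \<and>
     (\<exists>\<theta>. 0 < \<theta> \<and> \<theta> < pi / 2 \<and> is_LOS f \<theta>)"

definition LOMSE :: "('a::euclidean_space \<Rightarrow> 'b::euclidean_space) \<Rightarrow> bool" where
  "LOMSE f \<longleftrightarrow> LOM f \<and> \<not> totally_geodesic_map (sphere 0 1) (sphere 0 1) f \<and>
     (\<forall>x\<in>sphere 0 1. \<forall>s t. singular_value (sphere 0 1) f x s \<and> s \<noteq> 0 \<and>
        singular_value (sphere 0 1) f x t \<and> t \<noteq> 0 \<longrightarrow> s = t)"


section \<open>Spherical harmonics\<close>

definition laplacian :: "('a::euclidean_space \<Rightarrow> real) \<Rightarrow> 'a \<Rightarrow> real" where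
  "laplacian P x =
     (\<Sum>b\<in>Basis. frechet_derivative (\<lambda>y. frechet_derivative P (at y) b) (at x) b)"

text \<open>Restrictions to the unit sphere of harmonic homogeneous polynomials of degree \<open>k\<close>;
  as usual, the zero function is included.\<close>

definition spherical_harmonic :: "nat \<Rightarrow> ('a::euclidean_space \<Rightarrow> real) \<Rightarrow> bool" where
  "spherical_harmonic k Y \<longleftrightarrow> (\<exists>P. real_polynomial_function P \<and>
     (\<forall>c x. P (c *\<^sub>R x) = c ^ k * P x) \<and> (\<forall>x. laplacian P x = 0) \<and> (\<forall>x\<in>sphere 0 1. Y x = P x))"

end

theory Submission
  imports Defs
begin

text \<open>
  Let \<open>B\<close> be the differential of the degree-0 homogeneous extension of \<open>f\<close>. Equality of the
  nonzero singular values says \<open>B B\<^sup>T B = lam\<^sup>2 B\<close>, and the divergence of this identity expresses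
  the trace of the Hessian of \<open>f\<close> over the nonzero singular space by \<open>\<Delta> f\<close> and
  \<open>B B\<^sup>T \<Delta> f\<close>. Hence the mean curvature vector of \<open>M\<^bsub>f,\<theta>\<^esub>\<close> is explicit modulo tangent
  vectors, and it vanishes iff \<open>\<Delta> f = - p lam\<^sup>2 f\<close> and one scalar equation in \<open>\<theta>\<close> holds.

  If \<open>\<Delta> f = - p lam\<^sup>2 f\<close> then \<open>F = r\<^sup>a f\<close> with \<open>a (a + n - 1) = p lam\<^sup>2\<close> is harmonic and
  \<open>|F| = r\<^sup>a\<close>. The squared length of the \<open>j\<close>-th derivative of a harmonic map is half the Laplacian
  of that of the \<open>(j-1)\<close>-st, so all these lengths are explicit multiples of powers of \<open>r\<close>; comparing
  consecutive ones through Euler's identity forces \<open>a = k\<close> to be an integer, and then the \<open>(k+1)\<close>-st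
  derivative vanishes, so that \<open>F\<close> is polynomial. This replaces the spectral theory of the sphere.
\<close>

subsection \<open>Smooth functions and directional derivatives\<close>

text \<open>Spheres have in general no global frames, and frames of the singular spaces would need a
  construction of their own. Extensions of degree 0 to the punctured Euclidean space avoid both:
  every trace is taken over the fixed \<open>Basis\<close>, and homogeneity supplies the radial
  derivatives. The price is that an identity known on the unit sphere has to be restored off it,
  with the right power of the norm, before it can be differentiated.

  Integrality of a: let E_j be the squared length of the j-th derivative of F. Euler's identity and
  Cauchy-Schwarz give (a - j)^2 E_j <= r^2 E_(j+1), while harmonicity gives r^2 E_(j+1) = (a -
  j)(2(a - j) + n - 1) E_j. If a is not an integer, let j be the first integer above it and g = a -
  j; then E_j > 0 and the two facts yield g (g + n - 1) >= 0, which is false for -1 < g < 0 and n >=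
  2. For n = 1 they only say g^2 >= 0, so there a = 1 has to come from the angle equation.\<close>

definition dir_deriv ::
  "('a::real_normed_vector \<Rightarrow> 'b::real_normed_vector) \<Rightarrow> 'a \<Rightarrow> 'a \<Rightarrow> 'b" where
  "dir_deriv f v x = frechet_derivative f (at x) v"

definition Cinf_on ::
  "('a::real_normed_vector \<Rightarrow> 'b::real_normed_vector) \<Rightarrow> 'a set \<Rightarrow> bool" where
  "Cinf_on f U \<longleftrightarrow> (\<forall>k. Ck_on k f U)"

lemma dir_deriv_eqI: "(f has_derivative f') (at x) \<Longrightarrow> dir_deriv f v x = f' v"
  using frechet_derivative_at unfolding dir_deriv_def by metis

lemma has_derivative_dir_deriv:
  "f differentiable (at x) \<Longrightarrow> (f has_derivative (\<lambda>v. dir_deriv f v x)) (at x)"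
  unfolding dir_deriv_def frechet_derivative_works by simp

lemma linear_dir_deriv: "f differentiable (at x) \<Longrightarrow> linear (\<lambda>v. dir_deriv f v x)"
  using has_derivative_dir_deriv has_derivative_linear by blast

section \<open>Locality and closure properties of maps of class C^k\<close>

lemma Ck_on_Suc_iff:
  "Ck_on (Suc k) f U \<longleftrightarrow> (\<forall>x\<in>U. f differentiable (at x)) \<and> (\<forall>v. Ck_on k (dir_deriv f v) U)"
  by (simp add: dir_deriv_def[abs_def])

declare Ck_on.simps(2)[simp del]

text \<open>Differentiability is not assumed: \<open>frechet_derivative\<close> is a choice, and
  functions that agree near x have the same candidates for the derivative there, so even the default
  values coincide.\<close>

lemma dir_deriv_cong:
  assumes "open U" "x \<in> U" "\<And>y. y \<in> U \<Longrightarrow> f y = g y"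
  shows "dir_deriv f v x = dir_deriv g v x"
proof (cases "f differentiable (at x)")
  case True
  from has_derivative_dir_deriv[OF this]
  have "(g has_derivative (\<lambda>v. dir_deriv f v x)) (at x)"
    by (rule has_derivative_transform_within_open) (use assms in auto)
  then show ?thesis by (simp add: dir_deriv_eqI)
next
  case False
  have "(f has_derivative D) (at x) \<longleftrightarrow> (g has_derivative D) (at x)" for D
    using assms has_derivative_transform_within_open[of _ D x UNIV U] by (metis)
  then show ?thesis by (simp add: dir_deriv_def frechet_derivative_def)
qed

lemma Ck_on_cong:
  assumes "open U" "\<And>y. y \<in> U \<Longrightarrow> f y = g y" "Ck_on k f U"
  shows "Ck_on k g U"
  using assms(2,3)
proof (induction k arbitrary: f g)
  case 0
  then show ?case using continuous_on_cong by (metis Ck_on.simps(1))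
next
  case (Suc k)
  have "g differentiable (at x)" if "x \<in> U" for x
  proof -
    have "f differentiable (at x)" using Suc.prems that by (simp add: Ck_on_Suc_iff)
    then obtain D where "(f has_derivative D) (at x)" by (auto simp: differentiable_def)
    then have "(g has_derivative D) (at x)"
      by (rule has_derivative_transform_within_open) (use assms(1) Suc.prems that in auto)
    then show ?thesis by (auto simp: differentiable_def)
  qed
  moreover have "Ck_on k (dir_deriv g v) U" for v
  proof (rule Suc.IH)
    show "Ck_on k (dir_deriv f v) U" using Suc.prems by (simp add: Ck_on_Suc_iff)
    show "dir_deriv f v y = dir_deriv g v y" if "y \<in> U" for y
      using dir_deriv_cong[OF assms(1) that Suc.prems(1)] .
  qed
  ultimately show ?case by (simp add: Ck_on_Suc_iff)
qed

lemma Ck_on_lessD: "Ck_on (Suc k) f U \<Longrightarrow> Ck_on k f U"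
proof (induction k arbitrary: f)
  case 0
  then show ?case
    by (simp add: Ck_on_Suc_iff continuous_at_imp_continuous_on differentiable_imp_continuous_within)
next
  case (Suc k)
  then show ?case using Ck_on_Suc_iff by blast
qed

lemma Ck_on_subset: "Ck_on k f U \<Longrightarrow> V \<subseteq> U \<Longrightarrow> Ck_on k f V"
proof (induction k arbitrary: f)
  case 0
  then show ?case using continuous_on_subset by auto
next
  case (Suc k)
  then show ?case unfolding Ck_on_Suc_iff by blast
qed

lemma Ck_on_local:
  "(\<And>x. x \<in> U \<Longrightarrow> \<exists>V. open V \<and> x \<in> V \<and> Ck_on k f V) \<Longrightarrow> Ck_on k f U"
proof (induction k arbitrary: f)
  case 0
  have "continuous (at x within U) f" if "x \<in> U" for x
  proof -
    obtain V where "open V" "x \<in> V" "continuous_on V f" using 0 \<open>x \<in> U\<close> by (metis Ck_on.simps(1))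
    then show ?thesis
      by (metis continuous_on_eq_continuous_at continuous_at_imp_continuous_at_within)
  qed
  then show ?case by (simp add: continuous_on_eq_continuous_within)
next
  case (Suc k)
  then show ?case unfolding Ck_on_Suc_iff by (metis Suc.IH)
qed

lemma Ck_on_const: "Ck_on k (\<lambda>x. c) U"
  by (induction k arbitrary: c) (auto simp: Ck_on_Suc_iff dir_deriv_def[abs_def])

lemma dir_deriv_bounded_linear:
  assumes "bounded_linear h" shows "dir_deriv h v = (\<lambda>x. h v)"
proof
  fix x show "dir_deriv h v x = h v"
    using bounded_linear_imp_has_derivative[OF assms] dir_deriv_eqI by blast
qed

lemma Ck_on_bounded_linear:
  assumes "bounded_linear h" shows "Ck_on k h U"
proof (cases k)
  case 0
  then show ?thesis using assms by (simp add: linear_continuous_on)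
next
  case (Suc j)
  then show ?thesis
    using assms by (simp add: Ck_on_Suc_iff dir_deriv_bounded_linear Ck_on_const
        bounded_linear_imp_differentiable)
qed

lemma Ck_on_bounded_linear_comp:
  assumes h: "bounded_linear h" and U: "open U"
  shows "Ck_on k f U \<Longrightarrow> Ck_on k (\<lambda>x. h (f x)) U"
proof (induction k arbitrary: f)
  case 0
  then show ?case using bounded_linear.continuous_on[OF h] by auto
next
  case (Suc k)
  have d: "((\<lambda>x. h (f x)) has_derivative (\<lambda>v. h (dir_deriv f v x))) (at x)" if "x \<in> U" for x
    using Suc.prems that by (intro bounded_linear.has_derivative[OF h] has_derivative_dir_deriv)
      (simp add: Ck_on_Suc_iff)
  have "Ck_on k (dir_deriv (\<lambda>x. h (f x)) v) U" for v
  proof (rule Ck_on_cong[OF U])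
    show "Ck_on k (\<lambda>x. h (dir_deriv f v x)) U"
      using Suc by (simp add: Ck_on_Suc_iff)
    show "\<And>y. y \<in> U \<Longrightarrow> h (dir_deriv f v y) = dir_deriv (\<lambda>x. h (f x)) v y"
      using dir_deriv_eqI[OF d] by simp
  qed
  then show ?case using d by (auto simp: Ck_on_Suc_iff differentiable_def)
qed

lemma Ck_on_add:
  assumes U: "open U"
  shows "Ck_on k f U \<Longrightarrow> Ck_on k g U \<Longrightarrow> Ck_on k (\<lambda>x. f x + g x) U"
proof (induction k arbitrary: f g)
  case 0
  then show ?case by (auto intro: continuous_intros)
next
  case (Suc k)
  have d: "((\<lambda>x. f x + g x) has_derivative (\<lambda>v. dir_deriv f v x + dir_deriv g v x)) (at x)"
    if "x \<in> U" for x
    using Suc.prems that by (auto intro!: has_derivative_add has_derivative_dir_deriv simp: Ck_on_Suc_iff)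
  have "Ck_on k (dir_deriv (\<lambda>x. f x + g x) v) U" for v
  proof (rule Ck_on_cong[OF U])
    show "Ck_on k (\<lambda>x. dir_deriv f v x + dir_deriv g v x) U"
      using Suc by (simp add: Ck_on_Suc_iff)
    show "\<And>y. y \<in> U \<Longrightarrow> dir_deriv f v y + dir_deriv g v y = dir_deriv (\<lambda>x. f x + g x) v y"
      using dir_deriv_eqI[OF d] by simp
  qed
  then show ?case using d by (auto simp: Ck_on_Suc_iff differentiable_def)
qed

lemma Ck_on_bilinear:
  assumes h: "bounded_bilinear h" and U: "open U"
  shows "Ck_on k f U \<Longrightarrow> Ck_on k g U \<Longrightarrow> Ck_on k (\<lambda>x. h (f x) (g x)) U"
proof (induction k arbitrary: f g)
  case 0
  then show ?case using bounded_bilinear.continuous_on[OF h] by auto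
next
  case (Suc k)
  have d: "((\<lambda>x. h (f x) (g x)) has_derivative
      (\<lambda>v. h (f x) (dir_deriv g v x) + h (dir_deriv f v x) (g x))) (at x)"
    if "x \<in> U" for x
    using Suc.prems that
    by (auto intro!: bounded_bilinear.FDERIV[OF h] has_derivative_dir_deriv simp: Ck_on_Suc_iff)
  have "Ck_on k (dir_deriv (\<lambda>x. h (f x) (g x)) v) U" for v
  proof (rule Ck_on_cong[OF U])
    have "Ck_on k f U" "Ck_on k g U" using Suc.prems Ck_on_lessD by auto
    then show "Ck_on k (\<lambda>x. h (f x) (dir_deriv g v x) + h (dir_deriv f v x) (g x)) U"
      using Suc by (auto simp: Ck_on_Suc_iff intro!: Ck_on_add[OF U])
    show "\<And>y. y \<in> U \<Longrightarrow> h (f y) (dir_deriv g v y) + h (dir_deriv f v y) (g y)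
        = dir_deriv (\<lambda>x. h (f x) (g x)) v y"
      using dir_deriv_eqI[OF d] by simp
  qed
  then show ?case using d by (auto simp: Ck_on_Suc_iff differentiable_def)
qed

lemma Ck_on_sum:
  assumes U: "open U" and "\<And>i. i \<in> I \<Longrightarrow> Ck_on k (f i) U"
  shows "Ck_on k (\<lambda>x. \<Sum>i\<in>I. f i x) U"
  using assms(2) by (induction I rule: infinite_finite_induct) (auto intro!: Ck_on_const Ck_on_add[OF U])

text \<open>The chain rule is expanded in a basis of the middle space, which is why that space is
  Euclidean: \<open>dir_deriv g b\<close> with a fixed direction b is again a function of class C^k,
  to which the induction hypothesis applies, whereas the direction \<open>dir_deriv f v x\<close>
  varies with x.\<close>

lemma Ck_on_compose:
  fixes f :: "'a::real_normed_vector \<Rightarrow> 'b::euclidean_space"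
    and g :: "'b \<Rightarrow> 'c::real_normed_vector"
  assumes U: "open U" and V: "open V" and fU: "\<And>x. x \<in> U \<Longrightarrow> f x \<in> V"
  shows "Ck_on k f U \<Longrightarrow> Ck_on k g V \<Longrightarrow> Ck_on k (\<lambda>x. g (f x)) U"
proof (induction k arbitrary: g)
  case 0
  then show ?case using fU
    by (auto intro!: continuous_on_compose2[of V g U f])
next
  case (Suc k)
  have dg: "g differentiable (at (f x))" and df: "f differentiable (at x)" if "x \<in> U" for x
    using Suc.prems that fU by (auto simp: Ck_on_Suc_iff)
  have d: "((\<lambda>x. g (f x)) has_derivative (\<lambda>v. dir_deriv g (dir_deriv f v x) (f x))) (at x)"
    if "x \<in> U" for x
    using diff_chain_at[OF has_derivative_dir_deriv[OF df[OF that]] has_derivative_dir_deriv[OF dg[OF that]]]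
    by (simp add: o_def)
  have e: "dir_deriv (\<lambda>x. g (f x)) v x = (\<Sum>b\<in>Basis. (dir_deriv f v x \<bullet> b) *\<^sub>R dir_deriv g b (f x))"
    if "x \<in> U" for v x
  proof -
    interpret linear "\<lambda>v. dir_deriv g v (f x)" using linear_dir_deriv[OF dg[OF that]] .
    have "dir_deriv g (dir_deriv f v x) (f x) = dir_deriv g (\<Sum>b\<in>Basis. (dir_deriv f v x \<bullet> b) *\<^sub>R b) (f x)"
      by (simp add: euclidean_representation)
    also have "\<dots> = (\<Sum>b\<in>Basis. (dir_deriv f v x \<bullet> b) *\<^sub>R dir_deriv g b (f x))"
      by (simp add: sum scale)
    finally show ?thesis using dir_deriv_eqI[OF d[OF that]] by simp
  qed
  have "Ck_on k (dir_deriv (\<lambda>x. g (f x)) v) U" for v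
  proof (rule Ck_on_cong[OF U])
    have k: "Ck_on k f U" "Ck_on k (dir_deriv f v) U" "\<And>b. Ck_on k (dir_deriv g b) V"
      using Suc.prems Ck_on_lessD by (auto simp: Ck_on_Suc_iff)
    show "Ck_on k (\<lambda>x. \<Sum>b\<in>Basis. (dir_deriv f v x \<bullet> b) *\<^sub>R dir_deriv g b (f x)) U"
      by (intro Ck_on_sum[OF U] Ck_on_bilinear[OF bounded_bilinear_scaleR U]
          Ck_on_bounded_linear_comp[OF bounded_linear_inner_left U] Suc.IH k)
  qed (simp add: e)
  then show ?case using d by (auto simp: Ck_on_Suc_iff differentiable_def)
qed

lemma dir_deriv_powr:
  assumes "x > (0::real)" shows "dir_deriv (\<lambda>x. x powr s) v x = v * s * x powr (s - 1)"
proof -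
  have "((\<lambda>x. x powr s) has_derivative (\<lambda>v. v * s * x powr (s - 1))) (at x)"
    by (rule derivative_eq_intros refl assms | use assms in \<open>simp add: fun_eq_iff powr_diff field_simps\<close>)+
  then show ?thesis by (rule dir_deriv_eqI)
qed

lemma Ck_on_powr: "Ck_on k (\<lambda>x::real. x powr s) {0<..}"
proof (induction k arbitrary: s)
  case 0
  then show ?case by (auto intro!: continuous_intros)
next
  case (Suc k)
  have "(\<lambda>x. x powr s) differentiable (at x)" if "x > 0" for x :: real
  proof -
    have "((\<lambda>x. x powr s) has_real_derivative s * x powr (s - 1)) (at x)"
      using that by (auto intro!: derivative_eq_intros simp: powr_diff)
    then show ?thesis unfolding differentiable_def has_field_derivative_def by blast
  qed
  moreover have "Ck_on k (dir_deriv (\<lambda>x::real. x powr s) v) {0<..}" for v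
    by (rule Ck_on_cong[of _ "\<lambda>x. v * s * x powr (s - 1)"])
      (auto simp: dir_deriv_powr intro!: Ck_on_bilinear[OF bounded_bilinear_mult] Ck_on_const Suc)
  ultimately show ?case by (simp add: Ck_on_Suc_iff)
qed

section \<open>Closure properties of smooth maps\<close>

named_theorems Cinf_intros

lemma Cinf_on_dir_deriv [Cinf_intros]: "Cinf_on f U \<Longrightarrow> Cinf_on (dir_deriv f v) U"
  unfolding Cinf_on_def using Ck_on_Suc_iff by blast

lemma Cinf_on_differentiable: "Cinf_on f U \<Longrightarrow> x \<in> U \<Longrightarrow> f differentiable (at x)"
  unfolding Cinf_on_def using Ck_on_Suc_iff by blast

lemma Cinf_on_continuous: "Cinf_on f U \<Longrightarrow> continuous_on U f"
  unfolding Cinf_on_def using Ck_on.simps(1) by blast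

lemma Cinf_on_has_derivative:
  "Cinf_on f U \<Longrightarrow> x \<in> U \<Longrightarrow> (f has_derivative (\<lambda>v. dir_deriv f v x)) (at x)"
  using Cinf_on_differentiable has_derivative_dir_deriv by blast

lemma Cinf_on_cong: "open U \<Longrightarrow> (\<And>y. y \<in> U \<Longrightarrow> f y = g y) \<Longrightarrow> Cinf_on f U \<Longrightarrow> Cinf_on g U"
  unfolding Cinf_on_def using Ck_on_cong by metis

lemma Cinf_on_subset: "Cinf_on f U \<Longrightarrow> V \<subseteq> U \<Longrightarrow> Cinf_on f V"
  unfolding Cinf_on_def using Ck_on_subset by blast

lemma Cinf_on_local:
  "(\<And>x. x \<in> U \<Longrightarrow> \<exists>V. open V \<and> x \<in> V \<and> Cinf_on f V) \<Longrightarrow> Cinf_on f U"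
  unfolding Cinf_on_def by (metis Ck_on_local)

lemma Cinf_on_const [Cinf_intros]: "Cinf_on (\<lambda>x. c) U"
  by (simp add: Cinf_on_def Ck_on_const)

lemma Cinf_on_bounded_linear: "bounded_linear h \<Longrightarrow> Cinf_on h U"
  by (simp add: Cinf_on_def Ck_on_bounded_linear)

lemma Cinf_on_ident [Cinf_intros]: "Cinf_on (\<lambda>x. x) U"
  by (rule Cinf_on_bounded_linear) (rule bounded_linear_ident)

lemma Cinf_on_bounded_linear_comp:
  "bounded_linear h \<Longrightarrow> open U \<Longrightarrow> Cinf_on f U \<Longrightarrow> Cinf_on (\<lambda>x. h (f x)) U"
  by (simp add: Cinf_on_def Ck_on_bounded_linear_comp)

lemma Cinf_on_add [Cinf_intros]:
  "open U \<Longrightarrow> Cinf_on f U \<Longrightarrow> Cinf_on g U \<Longrightarrow> Cinf_on (\<lambda>x. f x + g x) U"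
  by (simp add: Cinf_on_def Ck_on_add)

lemma Cinf_on_bilinear:
  "bounded_bilinear h \<Longrightarrow> open U \<Longrightarrow> Cinf_on f U \<Longrightarrow> Cinf_on g U \<Longrightarrow> Cinf_on (\<lambda>x. h (f x) (g x)) U"
  by (simp add: Cinf_on_def Ck_on_bilinear)

lemmas Cinf_on_scaleR [Cinf_intros] = Cinf_on_bilinear[OF bounded_bilinear_scaleR]
lemmas Cinf_on_mult [Cinf_intros] = Cinf_on_bilinear[OF bounded_bilinear_mult]
lemmas Cinf_on_inner [Cinf_intros] = Cinf_on_bilinear[OF bounded_bilinear_inner]
lemmas Cinf_on_fst [Cinf_intros] = Cinf_on_bounded_linear_comp[OF bounded_linear_fst]
lemmas Cinf_on_snd [Cinf_intros] = Cinf_on_bounded_linear_comp[OF bounded_linear_snd]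
lemmas Cinf_on_minus [Cinf_intros] =
  Cinf_on_bounded_linear_comp[OF bounded_linear_minus[OF bounded_linear_ident]]

lemma Cinf_on_diff [Cinf_intros]:
  "open U \<Longrightarrow> Cinf_on f U \<Longrightarrow> Cinf_on g U \<Longrightarrow> Cinf_on (\<lambda>x. f x - g x) U"
  using Cinf_on_add[of U f "\<lambda>x. - g x"] Cinf_on_minus[of U g] by simp

lemma Cinf_on_sum [Cinf_intros]:
  "open U \<Longrightarrow> (\<And>i. i \<in> I \<Longrightarrow> Cinf_on (f i) U) \<Longrightarrow> Cinf_on (\<lambda>x. \<Sum>i\<in>I. f i x) U"
  by (simp add: Cinf_on_def Ck_on_sum)

lemma Cinf_on_Pair [Cinf_intros]:
  fixes f :: "'a::real_normed_vector \<Rightarrow> 'b::real_normed_vector"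
    and g :: "'a \<Rightarrow> 'c::real_normed_vector"
  assumes "open U" "Cinf_on f U" "Cinf_on g U" shows "Cinf_on (\<lambda>x. (f x, g x)) U"
proof -
  have "Cinf_on (\<lambda>x. (f x, 0) + (0, g x)) U"
    by (intro Cinf_on_add assms
        Cinf_on_bounded_linear_comp[OF bounded_linear_Pair[OF bounded_linear_ident bounded_linear_zero]]
        Cinf_on_bounded_linear_comp[OF bounded_linear_Pair[OF bounded_linear_zero bounded_linear_ident]])
  then show ?thesis by simp
qed

lemma Cinf_on_compose:
  fixes f :: "'a::real_normed_vector \<Rightarrow> 'b::euclidean_space"
  assumes "open U" "open V" "\<And>x. x \<in> U \<Longrightarrow> f x \<in> V" "Cinf_on f U" "Cinf_on g V"
  shows "Cinf_on (\<lambda>x. g (f x)) U"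
  using assms Ck_on_compose unfolding Cinf_on_def by metis

lemma Cinf_on_powr [Cinf_intros]:
  "open U \<Longrightarrow> Cinf_on f U \<Longrightarrow> (\<And>x. x \<in> U \<Longrightarrow> f x > (0::real)) \<Longrightarrow> Cinf_on (\<lambda>x. f x powr s) U"
  by (rule Cinf_on_compose[of U "{0<..}"]) (auto simp: Cinf_on_def Ck_on_powr)

lemma Cinf_on_imp_smooth_on: "open U \<Longrightarrow> Cinf_on f U \<Longrightarrow> M \<subseteq> U \<Longrightarrow> smooth_on M f"
  unfolding smooth_on_def Cinf_on_def by blast

lemma smooth_on_alt:
  "smooth_on M f \<longleftrightarrow> (\<forall>x\<in>M. \<exists>U F. open U \<and> x \<in> U \<and> Cinf_on F U \<and> (\<forall>y\<in>M \<inter> U. F y = f y))"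
  unfolding smooth_on_def Cinf_on_def ..

section \<open>Chain, product and sum rules for directional derivatives\<close>

lemma dir_deriv_compose:
  assumes "f differentiable (at x)" "g differentiable (at (f x))"
  shows "dir_deriv (\<lambda>x. g (f x)) v x = dir_deriv g (dir_deriv f v x) (f x)"
  using diff_chain_at[OF has_derivative_dir_deriv[OF assms(1)] has_derivative_dir_deriv[OF assms(2)]]
  by (intro dir_deriv_eqI[where f' = "\<lambda>v. dir_deriv g (dir_deriv f v x) (f x)"]) (simp add: o_def)

lemma dir_deriv_bilinear:
  assumes "bounded_bilinear h" "f differentiable (at x)" "g differentiable (at x)"
  shows "dir_deriv (\<lambda>x. h (f x) (g x)) v x = h (f x) (dir_deriv g v x) + h (dir_deriv f v x) (g x)"
  using bounded_bilinear.FDERIV[OF assms(1) has_derivative_dir_deriv[OF assms(2)] has_derivative_dir_deriv[OF assms(3)]]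
    dir_deriv_eqI by fastforce

lemmas dir_deriv_scaleR = dir_deriv_bilinear[OF bounded_bilinear_scaleR]
lemmas dir_deriv_mult = dir_deriv_bilinear[OF bounded_bilinear_mult]
lemmas dir_deriv_inner = dir_deriv_bilinear[OF bounded_bilinear_inner]

lemma dir_deriv_linear_comp:
  assumes "bounded_linear h" "f differentiable (at x)"
  shows "dir_deriv (\<lambda>x. h (f x)) v x = h (dir_deriv f v x)"
  using bounded_linear.has_derivative[OF assms(1) has_derivative_dir_deriv[OF assms(2)]]
    dir_deriv_eqI by fastforce

lemma dir_deriv_sum:
  assumes "\<And>i. i \<in> I \<Longrightarrow> f i differentiable (at x)"
  shows "dir_deriv (\<lambda>x. \<Sum>i\<in>I. f i x) v x = (\<Sum>i\<in>I. dir_deriv (f i) v x)"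
  using has_derivative_sum[of I f "\<lambda>i v. dir_deriv (f i) v x" "at x"]
    has_derivative_dir_deriv assms dir_deriv_eqI by fastforce

lemma dir_deriv_const [simp]: "dir_deriv (\<lambda>x. c) v x = 0"
  by (simp add: dir_deriv_def)

lemma dir_deriv_ident [simp]: "dir_deriv (\<lambda>x. x) v x = v"
  by (simp add: dir_deriv_def)

subsection \<open>Symmetry of second derivatives\<close>

lemma has_real_derivative_along_line:
  fixes f :: "'a::real_normed_vector \<Rightarrow> real"
  assumes "f differentiable (at (x + t *\<^sub>R v))"
  shows "((\<lambda>t. f (x + t *\<^sub>R v)) has_real_derivative dir_deriv f v (x + t *\<^sub>R v)) (at t)"
proof -
  have "((\<lambda>t. x + t *\<^sub>R v) has_derivative (\<lambda>h. h *\<^sub>R v)) (at t)"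
    by (auto intro!: derivative_eq_intros)
  from diff_chain_at[OF this has_derivative_dir_deriv[OF assms]]
  have "((\<lambda>t. f (x + t *\<^sub>R v)) has_derivative (\<lambda>h. dir_deriv f (h *\<^sub>R v) (x + t *\<^sub>R v))) (at t)"
    by (simp add: o_def)
  moreover have "dir_deriv f (h *\<^sub>R v) (x + t *\<^sub>R v) = dir_deriv f v (x + t *\<^sub>R v) * h" for h
    using linear_scale[OF linear_dir_deriv[OF assms]] by (simp add: mult.commute)
  ultimately show ?thesis by (simp add: has_field_derivative_def)
qed

text \<open>The mean value theorem is applied twice: in direction u to the difference of f along two
  parallel segments, then in direction v to \<open>dir_deriv f u\<close>.\<close>

lemma second_difference_mean_value:
  fixes f :: "'a::real_normed_vector \<Rightarrow> real"
  assumes "h > 0" and dom: "\<And>s t. 0 \<le> s \<Longrightarrow> s \<le> h \<Longrightarrow> 0 \<le> t \<Longrightarrow> t \<le> h \<Longrightarrow> x + s *\<^sub>R u + t *\<^sub>R v \<in> U"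
    and f: "Cinf_on f U"
  shows "\<exists>s t. 0 \<le> s \<and> s \<le> h \<and> 0 \<le> t \<and> t \<le> h \<and>
    f (x + h *\<^sub>R u + h *\<^sub>R v) - f (x + h *\<^sub>R u) - f (x + h *\<^sub>R v) + f x
      = h * h * dir_deriv (dir_deriv f u) v (x + s *\<^sub>R u + t *\<^sub>R v)"
proof -
  define g where "g s = f (x + h *\<^sub>R v + s *\<^sub>R u) - f (x + s *\<^sub>R u)" for s
  have g: "(g has_real_derivative
      (dir_deriv f u (x + h *\<^sub>R v + s *\<^sub>R u) - dir_deriv f u (x + s *\<^sub>R u))) (at s)"
    if "0 \<le> s" "s \<le> h" for s
    unfolding g_def
    by (intro DERIV_diff has_real_derivative_along_line Cinf_on_differentiable[OF f])
      (use dom[of s h] dom[of s 0] that \<open>h > 0\<close> in \<open>auto simp: algebra_simps\<close>)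
  obtain s where s: "0 < s" "s < h"
    "g h - g 0 = h * (dir_deriv f u (x + h *\<^sub>R v + s *\<^sub>R u) - dir_deriv f u (x + s *\<^sub>R u))"
    using MVT2[of 0 h g, OF \<open>h > 0\<close> g] by auto
  have k: "((\<lambda>t. dir_deriv f u (x + s *\<^sub>R u + t *\<^sub>R v)) has_real_derivative
     dir_deriv (dir_deriv f u) v (x + s *\<^sub>R u + t *\<^sub>R v)) (at t)" if "0 \<le> t" "t \<le> h" for t
    by (intro has_real_derivative_along_line Cinf_on_differentiable[OF Cinf_on_dir_deriv[OF f]])
      (use dom[of s t] that s in auto)
  obtain t where t: "0 < t" "t < h"
    "dir_deriv f u (x + s *\<^sub>R u + h *\<^sub>R v) - dir_deriv f u (x + s *\<^sub>R u)
      = h * dir_deriv (dir_deriv f u) v (x + s *\<^sub>R u + t *\<^sub>R v)"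
    using MVT2[of 0 h _ "\<lambda>t. dir_deriv (dir_deriv f u) v (x + s *\<^sub>R u + t *\<^sub>R v)", OF \<open>h > 0\<close> k] by auto
  have "f (x + h *\<^sub>R u + h *\<^sub>R v) - f (x + h *\<^sub>R u) - f (x + h *\<^sub>R v) + f x = g h - g 0"
    by (simp add: g_def algebra_simps)
  also have "\<dots> = h * h * dir_deriv (dir_deriv f u) v (x + s *\<^sub>R u + t *\<^sub>R v)"
    using s(3) t(3) by (simp add: algebra_simps)
  finally show ?thesis using s t by (intro exI[of _ s] exI[of _ t]) auto
qed

text \<open>The second difference over the parallelogram spanned by h u and h v is symmetric in u
  and v, so it equals h^2 times either mixed derivative at some nearby point. Continuity of both
  then excludes different values at x.\<close>

lemma dir_deriv_commute_real:
  fixes f :: "'a::real_normed_vector \<Rightarrow> real"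
  assumes "open U" "x \<in> U" and f: "Cinf_on f U"
  shows "dir_deriv (dir_deriv f u) v x = dir_deriv (dir_deriv f v) u x"
proof (rule ccontr)
  define A where "A = dir_deriv (dir_deriv f u) v"
  define B where "B = dir_deriv (dir_deriv f v) u"
  assume "\<not> ?thesis"
  then have e: "\<bar>A x - B x\<bar> / 2 > 0" (is "?e > 0") by (simp add: A_def B_def)
  have "isCont A x" "isCont B x"
    unfolding A_def B_def using assms Cinf_on_continuous Cinf_on_dir_deriv continuous_on_eq_continuous_at
    by metis+
  then obtain d1 d2 where d: "d1 > 0" "d2 > 0" "\<And>y. dist y x < d1 \<Longrightarrow> \<bar>A y - A x\<bar> < ?e"
    "\<And>y. dist y x < d2 \<Longrightarrow> \<bar>B y - B x\<bar> < ?e"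
    unfolding continuous_at_eps_delta dist_real_def using e by metis
  obtain d3 where d3: "d3 > 0" "ball x d3 \<subseteq> U" using assms openE by blast
  define m where "m = min d1 (min d2 d3)"
  \<comment> \<open>Small enough for the whole parallelogram to stay within distance m of x; the
    summand 1 covers the case u = v = 0.\<close>
  define h where "h = m / (2 * (norm u + norm v + 1))"
  have m: "m > 0" using d d3 by (simp add: m_def)
  have h: "h > 0" using m unfolding h_def
    by (intro divide_pos_pos) (auto simp: add_nonneg_pos)
  have near: "dist (x + s *\<^sub>R u + t *\<^sub>R v) x < m" if "0 \<le> s" "s \<le> h" "0 \<le> t" "t \<le> h" for s t
  proof -
    have "dist (x + s *\<^sub>R u + t *\<^sub>R v) x = norm (s *\<^sub>R u + t *\<^sub>R v)" by (simp add: dist_norm)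
    also have "\<dots> \<le> s * norm u + t * norm v"
      using norm_triangle_ineq[of "s *\<^sub>R u" "t *\<^sub>R v"] that by simp
    also have "\<dots> \<le> h * norm u + h * norm v"
      using that by (intro add_mono mult_right_mono) auto
    also have "\<dots> \<le> h * (norm u + norm v + 1)" using h by (simp add: algebra_simps)
    also have "\<dots> = m / 2" unfolding h_def using norm_ge_zero[of u] norm_ge_zero[of v]
      by (simp add: field_simps add_nonneg_eq_0_iff)
    also have "\<dots> < m" using m by simp
    finally show ?thesis .
  qed
  have dom: "x + s *\<^sub>R u + t *\<^sub>R v \<in> U" if "0 \<le> s" "s \<le> h" "0 \<le> t" "t \<le> h" for s t
    using near[OF that] d3(2) by (auto simp: m_def dist_commute)
  have dom': "x + s *\<^sub>R v + t *\<^sub>R u \<in> U" if "0 \<le> s" "s \<le> h" "0 \<le> t" "t \<le> h" for s t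
    using dom[OF that(3,4,1,2)] by (simp add: algebra_simps)
  obtain s t where st: "0 \<le> s" "s \<le> h" "0 \<le> t" "t \<le> h"
    "f (x + h *\<^sub>R u + h *\<^sub>R v) - f (x + h *\<^sub>R u) - f (x + h *\<^sub>R v) + f x = h * h * A (x + s *\<^sub>R u + t *\<^sub>R v)"
    using second_difference_mean_value[OF h dom f] unfolding A_def by blast
  obtain s' t' where st': "0 \<le> s'" "s' \<le> h" "0 \<le> t'" "t' \<le> h"
    "f (x + h *\<^sub>R v + h *\<^sub>R u) - f (x + h *\<^sub>R v) - f (x + h *\<^sub>R u) + f x = h * h * B (x + s' *\<^sub>R v + t' *\<^sub>R u)"
    using second_difference_mean_value[OF h dom' f] unfolding B_def by blast
  have "h * h * A (x + s *\<^sub>R u + t *\<^sub>R v) = h * h * B (x + s' *\<^sub>R v + t' *\<^sub>R u)"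
    using st(5) st'(5) by (simp add: algebra_simps)
  then have "A (x + s *\<^sub>R u + t *\<^sub>R v) = B (x + s' *\<^sub>R v + t' *\<^sub>R u)" using h by simp
  moreover have "\<bar>A (x + s *\<^sub>R u + t *\<^sub>R v) - A x\<bar> < ?e"
    using near[OF st(1-4)] by (intro d) (simp add: m_def)
  moreover have "\<bar>B (x + s' *\<^sub>R v + t' *\<^sub>R u) - B x\<bar> < ?e"
    using near[OF st'(3,4,1,2)] by (intro d) (simp add: m_def algebra_simps)
  ultimately show False by (smt (verit) field_sum_of_halves)
qed

lemma dir_deriv_commute:
  fixes f :: "'a::real_normed_vector \<Rightarrow> 'b::euclidean_space"
  assumes U: "open U" "x \<in> U" and f: "Cinf_on f U"
  shows "dir_deriv (dir_deriv f u) v x = dir_deriv (dir_deriv f v) u x"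
proof (rule euclidean_eqI)
  fix b :: 'b assume "b \<in> Basis"
  have *: "dir_deriv (dir_deriv (\<lambda>x. f x \<bullet> b) u) v x = dir_deriv (dir_deriv f u) v x \<bullet> b" for u v
  proof -
    have "dir_deriv (dir_deriv (\<lambda>x. f x \<bullet> b) u) v x = dir_deriv (\<lambda>x. dir_deriv f u x \<bullet> b) v x"
      by (rule dir_deriv_cong[OF U])
        (rule dir_deriv_linear_comp[OF bounded_linear_inner_left Cinf_on_differentiable[OF f]])
    then show ?thesis
      using dir_deriv_linear_comp[OF bounded_linear_inner_left, of "dir_deriv f u" x b v]
        Cinf_on_differentiable[OF Cinf_on_dir_deriv[OF f]] U by simp
  qed
  have "Cinf_on (\<lambda>x. f x \<bullet> b) U" using U f by (intro Cinf_intros)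
  from dir_deriv_commute_real[OF U this, of u v] show
    "dir_deriv (dir_deriv f u) v x \<bullet> b = dir_deriv (dir_deriv f v) u x \<bullet> b" by (simp add: *)
qed

subsection \<open>Linear algebra\<close>

lemma orth_proj_unique:
  assumes V: "subspace V" and "y \<in> V" "\<And>z. z \<in> V \<Longrightarrow> (u - y) \<bullet> z = 0"
    and "y' \<in> V" "\<And>z. z \<in> V \<Longrightarrow> (u - y') \<bullet> z = 0"
  shows "y' = y"
proof -
  have "y - y' \<in> V" using assms by (simp add: subspace_diff)
  then have "(u - y') \<bullet> (y - y') = 0" "(u - y) \<bullet> (y - y') = 0" using assms by simp_all
  moreover have "(u - y') \<bullet> (y - y') - (u - y) \<bullet> (y - y') = (y - y') \<bullet> (y - y')"
    by (simp add: inner_diff_left)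
  ultimately show ?thesis by simp
qed

lemma orth_proj_eqI:
  assumes "subspace V" "y \<in> V" "\<And>z. z \<in> V \<Longrightarrow> (u - y) \<bullet> z = 0"
  shows "orth_proj V u = y"
  unfolding orth_proj_def
proof (rule the_equality)
  show "y \<in> V \<and> (\<forall>z\<in>V. (u - y) \<bullet> z = 0)" using assms by blast
  show "y' = y" if "y' \<in> V \<and> (\<forall>z\<in>V. (u - y') \<bullet> z = 0)" for y'
    using orth_proj_unique[OF assms] that by blast
qed

lemma orth_proj_props:
  assumes "subspace V"
  shows orth_proj_in: "orth_proj V u \<in> V"
    and orth_proj_orthogonal: "z \<in> V \<Longrightarrow> (u - orth_proj V u) \<bullet> z = 0"
proof -
  obtain y w where "y \<in> span V" "\<And>z. z \<in> span V \<Longrightarrow> orthogonal w z" "u = y + w"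
    using orthogonal_subspace_decomp_exists[of V u] by blast
  then have *: "y \<in> V" "\<And>z. z \<in> V \<Longrightarrow> (u - y) \<bullet> z = 0"
    using span_eq_iff[THEN iffD2, OF assms] by (auto simp: orthogonal_def)
  then have "orth_proj V u = y" using orth_proj_eqI assms by blast
  then show "orth_proj V u \<in> V" "z \<in> V \<Longrightarrow> (u - orth_proj V u) \<bullet> z = 0" using * by auto
qed

lemma orth_proj_sum:
  assumes "subspace V"
  shows "(\<Sum>i\<in>I. orth_proj V (f i)) = orth_proj V (\<Sum>i\<in>I. f i)"
proof (rule sym, rule orth_proj_eqI[OF assms])
  show "(\<Sum>i\<in>I. orth_proj V (f i)) \<in> V"
    by (simp add: assms orth_proj_in subspace_sum)
  show "((\<Sum>i\<in>I. f i) - (\<Sum>i\<in>I. orth_proj V (f i))) \<bullet> z = 0" if "z \<in> V" for z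
    using orth_proj_orthogonal[OF assms that] by (simp add: inner_sum_left flip: sum_subtractf)
qed

lemma orth_proj_eq_0_iff:
  assumes "subspace V" shows "orth_proj V u = 0 \<longleftrightarrow> (\<forall>z\<in>V. u \<bullet> z = 0)"
  using orth_proj_orthogonal[OF assms, of _ u] orth_proj_eqI[OF assms, of 0 u] subspace_0[OF assms]
  by auto

lemma orth_proj_cong:
  assumes "subspace V" "\<And>z. z \<in> V \<Longrightarrow> u \<bullet> z = u' \<bullet> z"
  shows "orth_proj V u = orth_proj V u'"
  by (rule orth_proj_eqI[OF assms(1)])
    (use assms orth_proj_in orth_proj_orthogonal[OF assms(1), of _ u'] in \<open>auto simp: inner_diff_left\<close>)

text \<open>A maximiser v of the quadratic form on the unit sphere of W is an eigenvector, with the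
  maximum as eigenvalue; by homogeneity the maximum bounds the form on all of W.\<close>

lemma self_adjoint_eigenvector:
  fixes T :: "'a::euclidean_space \<Rightarrow> 'a"
  assumes T: "linear T" "\<And>x y. T x \<bullet> y = x \<bullet> T y"
    and W: "subspace W" "W \<noteq> {0}" "\<And>w. w \<in> W \<Longrightarrow> T w \<in> W"
  obtains v \<mu> where "v \<in> W" "v \<noteq> 0" "T v = \<mu> *\<^sub>R v"
proof -
  interpret linear T by fact
  let ?S = "sphere 0 1 \<inter> W"
  obtain w0 where "w0 \<in> W" "w0 \<noteq> 0" using W(2) subspace_0[OF W(1)] by blast
  then have "(1 / norm w0) *\<^sub>R w0 \<in> ?S" using W(1) by (auto simp: subspace_scale)
  moreover have "compact ?S" by (simp add: W closed_subspace compact_Int_closed)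
  moreover have "continuous_on ?S (\<lambda>v. v \<bullet> T v)"
    by (intro continuous_intros linear_continuous_on) (simp add: T linear_conv_bounded_linear[symmetric])
  ultimately obtain v where v: "v \<in> ?S" "\<And>w. w \<in> ?S \<Longrightarrow> w \<bullet> T w \<le> v \<bullet> T v"
    using continuous_attains_sup[of ?S "\<lambda>v. v \<bullet> T v"] by blast
  define \<mu> where "\<mu> = v \<bullet> T v"
  have vv: "v \<bullet> v = 1" using v(1) by (simp add: dot_square_norm)
  have le: "w \<bullet> T w \<le> \<mu> * (w \<bullet> w)" if "w \<in> W" for w
  proof (cases "w = 0")
    case False
    have "(1 / norm w) *\<^sub>R w \<in> ?S" using that W(1) False by (auto simp: subspace_scale)
    from v(2)[OF this] have "(w \<bullet> T w) / (norm w * norm w) \<le> \<mu>"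
      unfolding \<mu>_def by (simp add: scale)
    then show ?thesis using False
      by (simp add: dot_square_norm power2_eq_square pos_divide_le_eq)
  qed (simp add: zero)
  \<comment> \<open>The residual of the eigenvalue equation is itself the test direction: to first
    order in t, moving from v to v + t z changes the form minus \<mu> times the squared norm by 2 t
    |z|^2, so maximality forces z = 0.\<close>
  define z where "z = T v - \<mu> *\<^sub>R v"
  have zW: "z \<in> W" unfolding z_def using v(1) W by (intro subspace_diff subspace_scale) auto
  have zz: "z \<bullet> T v - \<mu> * (z \<bullet> v) = z \<bullet> z" by (simp add: z_def inner_diff_right)
  define C where "C = z \<bullet> T z - \<mu> * (z \<bullet> z)"
  have ineq: "2 * t * (z \<bullet> z) + t * t * C \<le> 0" for t
  proof -
    have "v + t *\<^sub>R z \<in> W" using zW v(1) W(1) by (intro subspace_add subspace_scale) auto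
    from le[OF this] have "(v + t *\<^sub>R z) \<bullet> T (v + t *\<^sub>R z) \<le> \<mu> * ((v + t *\<^sub>R z) \<bullet> (v + t *\<^sub>R z))" .
    moreover have "v \<bullet> T z = z \<bullet> T v" by (metis T(2) inner_commute)
    moreover have "(v + t *\<^sub>R z) \<bullet> T (v + t *\<^sub>R z) =
        v \<bullet> T v + t * (z \<bullet> T v) + t * (v \<bullet> T z) + t * t * (z \<bullet> T z)"
      by (simp add: add scale inner_add_left inner_add_right distrib_left)
    moreover have "(v + t *\<^sub>R z) \<bullet> (v + t *\<^sub>R z) = 1 + 2 * t * (z \<bullet> v) + t * t * (z \<bullet> z)"
      by (simp add: vv inner_add_left inner_add_right distrib_left inner_commute[of v z])
    ultimately have "v \<bullet> T v + t * (z \<bullet> T v) + t * (z \<bullet> T v) + t * t * (z \<bullet> T z)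
        \<le> \<mu> * (1 + 2 * t * (z \<bullet> v) + t * t * (z \<bullet> z))" by metis
    then have "2 * t * (z \<bullet> T v - \<mu> * (z \<bullet> v)) + t * t * (z \<bullet> T z - \<mu> * (z \<bullet> z)) \<le> 0"
      unfolding \<mu>_def[symmetric] by (simp add: algebra_simps)
    then show ?thesis by (simp only: zz C_def)
  qed
  have "z \<bullet> z = 0"
  proof (rule ccontr)
    assume "z \<bullet> z \<noteq> 0"
    then have q: "z \<bullet> z > 0" by (metis inner_ge_zero order_less_le)
    \<comment> \<open>So small that the quadratic term in \<open>ineq\<close> cannot outweigh the
      linear one.\<close>
    define t where "t = (z \<bullet> z) / (\<bar>C\<bar> + 1)"
    have t: "t > 0" unfolding t_def using q by (intro divide_pos_pos) auto
    have "t * \<bar>C\<bar> \<le> z \<bullet> z" unfolding t_def using q by (simp add: field_simps)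
    moreover have "- (t * \<bar>C\<bar>) \<le> t * C" using t by (simp add: abs_if)
    ultimately have "0 < 2 * (z \<bullet> z) + t * C" using q by linarith
    then have "0 < t * (2 * (z \<bullet> z) + t * C)" using t by simp
    then show False using ineq[of t] by (simp add: algebra_simps)
  qed
  then have "T v = \<mu> *\<^sub>R v" by (simp add: z_def)
  moreover have "v \<noteq> 0" using vv by auto
  ultimately show thesis using that[of v \<mu>] v by auto
qed

text \<open>Put R = T^2 - \<kappa> T. Its range is invariant under T, so if it were nonzero it would
  contain an eigenvector v = R w of T. The only possible eigenvalues are roots of t^2 - \<kappa> t,
  hence R v = 0 and |v|^2 = w . R v = 0.\<close>

lemma self_adjoint_two_eigenvalues:
  fixes T :: "'a::euclidean_space \<Rightarrow> 'a"
  assumes T: "linear T" "\<And>x y. T x \<bullet> y = x \<bullet> T y"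
    and ev: "\<And>v \<mu>. v \<noteq> 0 \<Longrightarrow> T v = \<mu> *\<^sub>R v \<Longrightarrow> \<mu> = 0 \<or> \<mu> = \<kappa>"
  shows "T (T v) = \<kappa> *\<^sub>R T v"
proof -
  interpret linear T by fact
  define R where "R v = T (T v) - \<kappa> *\<^sub>R T v" for v
  have R: "linear R"
    by (rule linearI) (simp_all add: R_def add scale algebra_simps)
  have Rsa: "R x \<bullet> y = x \<bullet> R y" for x y
    by (simp add: R_def inner_diff_left inner_diff_right T(2))
  have TR: "T (R x) = R (T x)" for x by (simp add: R_def diff scale)
  have "range R = {0}"
  proof (rule ccontr)
    assume "range R \<noteq> {0}"
    moreover have "subspace (range R)" using linear_subspace_image[OF R subspace_UNIV] .
    moreover have "T w \<in> range R" if "w \<in> range R" for w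
      using that TR by (metis imageE rangeI)
    ultimately obtain v \<mu> where v: "v \<in> range R" "v \<noteq> 0" "T v = \<mu> *\<^sub>R v"
      using self_adjoint_eigenvector[OF T, of "range R"] by metis
    then obtain w where w: "v = R w" by auto
    have "R v = 0" using ev[OF v(2,3)] v(3) by (auto simp: R_def scale zero)
    then have "v \<bullet> v = 0" using w Rsa by (metis inner_zero_right)
    then show False using v by simp
  qed
  then have "R v = 0" by blast
  then show ?thesis by (simp add: R_def)
qed

text \<open>All values of T are in the \<kappa>-eigenspace, so T is \<kappa> times the orthogonal
  projection onto it. Expanding T b in an orthonormal basis of that eigenspace and exchanging sums
  turns the trace into a count of basis vectors.\<close>

lemma trace_self_adjoint_projection:
  fixes T :: "'a::euclidean_space \<Rightarrow> 'a"
  assumes T: "linear T" "\<And>x y. T x \<bullet> y = x \<bullet> T y" and TT: "\<And>v. T (T v) = \<kappa> *\<^sub>R T v"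
  shows "(\<Sum>b\<in>Basis. b \<bullet> T b) = \<kappa> * real (dim {v. T v = \<kappa> *\<^sub>R v})"
proof -
  interpret linear T by fact
  let ?V = "{v. T v = \<kappa> *\<^sub>R v}"
  have V: "subspace ?V"
    by (rule subspaceI) (auto simp: zero add scale algebra_simps)
  obtain E where E: "E \<subseteq> ?V" "pairwise orthogonal E" "\<And>x. x \<in> E \<Longrightarrow> norm x = 1"
    "card E = dim ?V" "span E = ?V" using orthonormal_basis_subspace[OF V] by metis
  have fin: "finite E" using E pairwise_orthogonal_imp_finite by blast
  have "b \<bullet> T b = (\<Sum>e\<in>E. \<kappa> * (e \<bullet> b)\<^sup>2)" for b
  proof -
    have "T b \<in> span E" using TT E by simp
    then have "T b = (\<Sum>e\<in>E. (T b \<bullet> e) *\<^sub>R e)"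
      using orthonormal_basis_expand[OF E(2,3) _ fin] by metis
    moreover have "T b \<bullet> e = \<kappa> * (e \<bullet> b)" if "e \<in> E" for e
      using T(2)[of b e] E(1) that by (auto simp: inner_commute)
    ultimately have "T b = (\<Sum>e\<in>E. (\<kappa> * (e \<bullet> b)) *\<^sub>R e)"
      by (metis (no_types, lifting) sum.cong)
    then have "b \<bullet> T b = b \<bullet> (\<Sum>e\<in>E. (\<kappa> * (e \<bullet> b)) *\<^sub>R e)" by metis
    then show ?thesis by (simp add: inner_sum_right power2_eq_square inner_commute mult.assoc)
  qed
  then have "(\<Sum>b\<in>Basis. b \<bullet> T b) = (\<Sum>e\<in>E. \<Sum>b\<in>Basis. \<kappa> * (e \<bullet> b)\<^sup>2)"
    using sum.swap by simp
  also have "\<dots> = (\<Sum>e\<in>E. \<kappa> * (e \<bullet> e))"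
    by (subst (2) euclidean_inner) (simp add: power2_eq_square sum_distrib_left)
  also have "\<dots> = (\<Sum>e\<in>E. \<kappa>)" by (rule sum.cong) (auto simp: E(3) dot_square_norm)
  finally show ?thesis by (simp add: E(4) mult.commute)
qed

subsection \<open>Homogeneous functions\<close>

lemma open_minus_origin [simp]: "open (- {0 :: 'a::real_normed_vector})" by (simp add: open_Compl)

section \<open>Powers of the norm\<close>

lemma norm_powr_eq:
  fixes y :: "'a::real_inner"
  assumes "y \<noteq> 0" shows "norm y powr s = (y \<bullet> y) powr (s / 2)"
proof -
  have "y \<bullet> y = norm y powr 2" using assms by (simp add: dot_square_norm)
  then show ?thesis by (simp only: powr_powr) simp
qed

lemma Cinf_on_norm_powr [Cinf_intros]:
  "Cinf_on (\<lambda>y::'a::euclidean_space. norm y powr s) (- {0})"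
  by (rule Cinf_on_cong[of _ "\<lambda>y. (y \<bullet> y) powr (s / 2)"]) (auto simp: norm_powr_eq intro!: Cinf_intros)

lemma dir_deriv_norm_powr:
  fixes y :: "'a::euclidean_space"
  assumes "y \<noteq> 0"
  shows "dir_deriv (\<lambda>y. norm y powr s) v y = s * norm y powr (s - 2) * (y \<bullet> v)"
proof -
  have pos: "y \<bullet> y > 0" using assms by simp
  have i: "(\<lambda>y::'a. y \<bullet> y) differentiable (at y)"
    by (rule Cinf_on_differentiable[of _ UNIV]) (auto intro!: Cinf_intros)
  have p: "(\<lambda>t. t powr (s / 2)) differentiable (at (y \<bullet> y))"
    by (rule Cinf_on_differentiable[of _ "{0<..}"]) (use pos in \<open>auto intro!: Cinf_intros\<close>)
  have "dir_deriv (\<lambda>y. norm y powr s) v y = dir_deriv (\<lambda>y. (y \<bullet> y) powr (s / 2)) v y"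
    by (rule dir_deriv_cong[of "-{0}"]) (use assms norm_powr_eq in auto)
  also have "\<dots> = dir_deriv (\<lambda>t. t powr (s / 2)) (dir_deriv (\<lambda>y. y \<bullet> y) v y) (y \<bullet> y)"
    by (rule dir_deriv_compose[OF i p])
  also have "\<dots> = s * norm y powr (s - 2) * (y \<bullet> v)"
    using assms pos by (simp add: dir_deriv_powr dir_deriv_inner norm_powr_eq diff_divide_distrib inner_commute)
  finally show ?thesis .
qed

text \<open>The degree is real because integrality of the exponent is a conclusion, not a premise.
  Only positive factors and nonzero points count, since the maps in question may be singular at the
  origin and need have no parity.\<close>

definition homog :: "real \<Rightarrow> ('a::real_normed_vector \<Rightarrow> 'b::real_normed_vector) \<Rightarrow> bool" where
  "homog s F \<longleftrightarrow> (\<forall>t>0. \<forall>x. x \<noteq> 0 \<longrightarrow> F (t *\<^sub>R x) = t powr s *\<^sub>R F x)"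

lemma homogD: "homog s F \<Longrightarrow> t > 0 \<Longrightarrow> x \<noteq> 0 \<Longrightarrow> F (t *\<^sub>R x) = t powr s *\<^sub>R F x"
  by (simp add: homog_def)

lemma homog_dir_deriv:
  assumes F: "Cinf_on F (- {0})" "homog s F"
  shows "homog (s - 1) (dir_deriv F v)"
  unfolding homog_def
proof (intro allI impI)
  fix t :: real and x :: 'a assume t: "t > 0" and x: "x \<noteq> 0"
  have dx: "F differentiable (at x)" and dtx: "F differentiable (at (t *\<^sub>R x))"
    using F t x by (auto intro: Cinf_on_differentiable)
  have "dir_deriv (\<lambda>x. F (t *\<^sub>R x)) v x = dir_deriv F (dir_deriv (\<lambda>x. t *\<^sub>R x) v x) (t *\<^sub>R x)"
    by (rule dir_deriv_compose[where g = F]) (use dtx in \<open>auto intro!: derivative_intros\<close>)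
  also have "dir_deriv (\<lambda>x. t *\<^sub>R x) v x = t *\<^sub>R v"
    by (rule dir_deriv_eqI) (auto intro!: derivative_eq_intros)
  also have "dir_deriv F (t *\<^sub>R v) (t *\<^sub>R x) = t *\<^sub>R dir_deriv F v (t *\<^sub>R x)"
    using linear_scale[OF linear_dir_deriv[OF dtx]] .
  finally have 1: "dir_deriv (\<lambda>x. F (t *\<^sub>R x)) v x = t *\<^sub>R dir_deriv F v (t *\<^sub>R x)" .
  have "dir_deriv (\<lambda>x. F (t *\<^sub>R x)) v x = dir_deriv (\<lambda>x. t powr s *\<^sub>R F x) v x"
    by (rule dir_deriv_cong[of "-{0}"]) (use x t homogD[OF F(2)] in auto)
  also have "\<dots> = t powr s *\<^sub>R dir_deriv F v x"
    by (rule dir_deriv_linear_comp[OF bounded_linear_scaleR_right dx])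
  finally have "t *\<^sub>R dir_deriv F v (t *\<^sub>R x) = t powr s *\<^sub>R dir_deriv F v x" using 1 by simp
  then have "(1 / t) *\<^sub>R t *\<^sub>R dir_deriv F v (t *\<^sub>R x) = (1 / t) *\<^sub>R t powr s *\<^sub>R dir_deriv F v x" by simp
  then show "dir_deriv F v (t *\<^sub>R x) = t powr (s - 1) *\<^sub>R dir_deriv F v x"
    using t by (simp add: powr_diff)
qed

lemma homog_euler:
  assumes F: "Cinf_on F (- {0})" "homog s F" and x: "x \<noteq> 0"
  shows "dir_deriv F x x = s *\<^sub>R F x"
proof -
  have dx: "F differentiable (at ((1::real) *\<^sub>R x))" using F x by (auto intro: Cinf_on_differentiable)
  have "dir_deriv (\<lambda>t::real. F (t *\<^sub>R x)) 1 1 = dir_deriv F (dir_deriv (\<lambda>t. t *\<^sub>R x) 1 1) (1 *\<^sub>R x)"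
    by (rule dir_deriv_compose[where g = F]) (use dx in \<open>auto intro!: derivative_intros\<close>)
  also have "dir_deriv (\<lambda>t::real. t *\<^sub>R x) 1 1 = 1 *\<^sub>R x"
    by (rule dir_deriv_eqI) (auto intro!: derivative_eq_intros)
  finally have 1: "dir_deriv (\<lambda>t::real. F (t *\<^sub>R x)) 1 1 = dir_deriv F x x" by simp
  have "dir_deriv (\<lambda>t::real. F (t *\<^sub>R x)) 1 1 = dir_deriv (\<lambda>t. t powr s *\<^sub>R F x) 1 1"
    by (rule dir_deriv_cong[of "{0<..}"]) (use x homogD[OF F(2)] in auto)
  also have "\<dots> = dir_deriv (\<lambda>t. t powr s) 1 1 *\<^sub>R F x"
    by (rule dir_deriv_linear_comp[OF bounded_linear_scaleR_left])
      (rule Cinf_on_differentiable[of _ "{0<..}"], auto intro!: Cinf_intros)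
  finally show ?thesis using 1 by (simp add: dir_deriv_powr)
qed

lemma dir_deriv_basis_sum:
  fixes f :: "'a::euclidean_space \<Rightarrow> 'b::real_normed_vector"
  assumes "f differentiable (at x)"
  shows "(\<Sum>b\<in>Basis. (v \<bullet> b) *\<^sub>R dir_deriv f b x) = dir_deriv f v x"
proof -
  interpret linear "\<lambda>v. dir_deriv f v x" using linear_dir_deriv[OF assms] .
  have "dir_deriv f v x = dir_deriv f (\<Sum>b\<in>Basis. (v \<bullet> b) *\<^sub>R b) x"
    by (simp add: euclidean_representation)
  then show ?thesis by (simp add: sum scale)
qed

lemma dir_deriv_dir_linear:
  assumes "open U" "x \<in> U" and f: "Cinf_on f U"
  shows "linear (\<lambda>v. dir_deriv (dir_deriv f v) w x)"
proof (rule linearI)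
  have d: "dir_deriv f v differentiable (at x)" for v
    using Cinf_on_differentiable[OF Cinf_on_dir_deriv[OF f] assms(2)] .
  fix v v' :: 'a and c :: real
  have "dir_deriv (dir_deriv f (v + v')) w x = dir_deriv (\<lambda>x. dir_deriv f v x + dir_deriv f v' x) w x"
    by (rule dir_deriv_cong[OF assms(1,2)])
      (use linear_add[OF linear_dir_deriv[OF Cinf_on_differentiable[OF f]]] in auto)
  also have "\<dots> = dir_deriv (dir_deriv f v) w x + dir_deriv (dir_deriv f v') w x"
    by (rule dir_deriv_eqI) (intro has_derivative_add has_derivative_dir_deriv d)
  finally show "dir_deriv (dir_deriv f (v + v')) w x
      = dir_deriv (dir_deriv f v) w x + dir_deriv (dir_deriv f v') w x" .
  have "dir_deriv (dir_deriv f (c *\<^sub>R v)) w x = dir_deriv (\<lambda>x. c *\<^sub>R dir_deriv f v x) w x"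
    by (rule dir_deriv_cong[OF assms(1,2)])
      (use linear_scale[OF linear_dir_deriv[OF Cinf_on_differentiable[OF f]]] in auto)
  also have "\<dots> = c *\<^sub>R dir_deriv (dir_deriv f v) w x"
    by (rule dir_deriv_linear_comp[OF bounded_linear_scaleR_right d])
  finally show "dir_deriv (dir_deriv f (c *\<^sub>R v)) w x = c *\<^sub>R dir_deriv (dir_deriv f v) w x" .
qed

section \<open>The Laplacian of vector-valued maps\<close>

definition vlap :: "('a::euclidean_space \<Rightarrow> 'b::real_normed_vector) \<Rightarrow> 'a \<Rightarrow> 'b" where
  "vlap F x = (\<Sum>b\<in>Basis. dir_deriv (dir_deriv F b) b x)"

lemma laplacian_eq_vlap: "laplacian P = vlap P"
  by (simp add: fun_eq_iff laplacian_def vlap_def dir_deriv_def[abs_def])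

lemma vlap_cong:
  assumes "open U" "x \<in> U" "\<And>y. y \<in> U \<Longrightarrow> f y = g y"
  shows "vlap f x = vlap g x"
  unfolding vlap_def using dir_deriv_cong[OF assms(1) _ assms(3)]
  by (intro sum.cong refl dir_deriv_cong[OF assms(1,2)]) auto

lemma Cinf_on_vlap [Cinf_intros]: "open U \<Longrightarrow> Cinf_on F U \<Longrightarrow> Cinf_on (vlap F) U"
  unfolding vlap_def[abs_def] by (intro Cinf_intros)

lemma vlap_linear_comp:
  assumes "bounded_linear h" "open U" "x \<in> U" "Cinf_on F U"
  shows "vlap (\<lambda>x. h (F x)) x = h (vlap F x)"
proof -
  have "dir_deriv (dir_deriv (\<lambda>x. h (F x)) b) b x = h (dir_deriv (dir_deriv F b) b x)" for b
  proof -
    have "dir_deriv (dir_deriv (\<lambda>x. h (F x)) b) b x = dir_deriv (\<lambda>x. h (dir_deriv F b x)) b x"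
      by (rule dir_deriv_cong[OF assms(2,3)])
        (rule dir_deriv_linear_comp[OF assms(1) Cinf_on_differentiable[OF assms(4)]])
    also have "\<dots> = h (dir_deriv (dir_deriv F b) b x)"
      by (rule dir_deriv_linear_comp[OF assms(1) Cinf_on_differentiable[OF Cinf_on_dir_deriv[OF assms(4)] assms(3)]])
    finally show ?thesis .
  qed
  then show ?thesis
    by (simp add: vlap_def linear_sum[OF bounded_linear.linear[OF assms(1)]])
qed

lemma vlap_dir_deriv:
  fixes F :: "'a::euclidean_space \<Rightarrow> 'b::euclidean_space"
  assumes "open U" "x \<in> U" "Cinf_on F U"
  shows "vlap (dir_deriv F v) x = dir_deriv (vlap F) v x"
proof -
  have "dir_deriv (vlap F) v x = (\<Sum>b\<in>Basis. dir_deriv (dir_deriv (dir_deriv F b) b) v x)"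
    unfolding vlap_def[abs_def]
    by (rule dir_deriv_sum) (intro Cinf_on_differentiable[OF _ assms(2)] Cinf_intros assms)
  moreover have "dir_deriv (dir_deriv (dir_deriv F v) b) b x = dir_deriv (dir_deriv (dir_deriv F b) b) v x" for b
  proof -
    have "dir_deriv (dir_deriv (dir_deriv F v) b) b x = dir_deriv (dir_deriv (dir_deriv F b) v) b x"
      by (rule dir_deriv_cong[OF assms(1,2)]) (rule dir_deriv_commute[OF assms(1) _ assms(3)])
    also have "\<dots> = dir_deriv (dir_deriv (dir_deriv F b) b) v x"
      by (rule dir_deriv_commute[OF assms(1,2)]) (intro Cinf_intros assms)
    finally show ?thesis .
  qed
  ultimately show ?thesis by (simp add: vlap_def)
qed

lemma vlap_bilinear:
  fixes F :: "'a::euclidean_space \<Rightarrow> 'b::real_normed_vector" and G :: "'a \<Rightarrow> 'c::real_normed_vector"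
    and h :: "'b \<Rightarrow> 'c \<Rightarrow> 'd::real_normed_vector"
  assumes h: "bounded_bilinear h" and U: "open U" "x \<in> U" and F: "Cinf_on F U" and G: "Cinf_on G U"
  shows "vlap (\<lambda>x. h (F x) (G x)) x = h (F x) (vlap G x) + h (vlap F x) (G x)
    + 2 *\<^sub>R (\<Sum>b\<in>Basis. h (dir_deriv F b x) (dir_deriv G b x))"
proof -
  have "dir_deriv (dir_deriv (\<lambda>x. h (F x) (G x)) b) b x = h (F x) (dir_deriv (dir_deriv G b) b x)
    + h (dir_deriv (dir_deriv F b) b x) (G x) + 2 *\<^sub>R h (dir_deriv F b x) (dir_deriv G b x)" for b
  proof -
    note d = Cinf_on_differentiable[OF F] Cinf_on_differentiable[OF G]
      Cinf_on_differentiable[OF Cinf_on_dir_deriv[OF F]] Cinf_on_differentiable[OF Cinf_on_dir_deriv[OF G]]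
    have "dir_deriv (dir_deriv (\<lambda>x. h (F x) (G x)) b) b x
        = dir_deriv (\<lambda>x. h (F x) (dir_deriv G b x) + h (dir_deriv F b x) (G x)) b x"
      by (rule dir_deriv_cong[OF U]) (rule dir_deriv_bilinear[OF h]; intro d)
    also have "\<dots> = dir_deriv (\<lambda>x. h (F x) (dir_deriv G b x)) b x + dir_deriv (\<lambda>x. h (dir_deriv F b x) (G x)) b x"
      by (rule dir_deriv_eqI)
        (intro has_derivative_add has_derivative_dir_deriv Cinf_on_differentiable[OF _ U(2)]
          Cinf_on_bilinear[OF h] Cinf_on_dir_deriv U F G)
    also have "dir_deriv (\<lambda>x. h (F x) (dir_deriv G b x)) b x
        = h (F x) (dir_deriv (dir_deriv G b) b x) + h (dir_deriv F b x) (dir_deriv G b x)"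
      by (rule dir_deriv_bilinear[OF h]) (intro d U)+
    also have "dir_deriv (\<lambda>x. h (dir_deriv F b x) (G x)) b x
        = h (dir_deriv F b x) (dir_deriv G b x) + h (dir_deriv (dir_deriv F b) b x) (G x)"
      by (rule dir_deriv_bilinear[OF h]) (intro d U)+
    finally show ?thesis by (simp add: scaleR_2)
  qed
  then show ?thesis
    by (simp add: vlap_def sum.distrib bounded_bilinear.sum_left[OF h] bounded_bilinear.sum_right[OF h]
        scaleR_sum_right)
qed

lemmas vlap_inner = vlap_bilinear[OF bounded_bilinear_inner]
lemmas vlap_scaleR = vlap_bilinear[OF bounded_bilinear_scaleR]

subsection \<open>Homogeneous harmonic maps of radial length\<close>

lemma vlap_sum:
  assumes "open U" "x \<in> U" "\<And>i. i \<in> I \<Longrightarrow> Cinf_on (f i) U"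
  shows "vlap (\<lambda>x. \<Sum>i\<in>I. f i x) x = (\<Sum>i\<in>I. vlap (f i) x)"
proof -
  have "dir_deriv (dir_deriv (\<lambda>x. \<Sum>i\<in>I. f i x) b) b x = (\<Sum>i\<in>I. dir_deriv (dir_deriv (f i) b) b x)" for b
  proof -
    have "dir_deriv (dir_deriv (\<lambda>x. \<Sum>i\<in>I. f i x) b) b x = dir_deriv (\<lambda>x. \<Sum>i\<in>I. dir_deriv (f i) b x) b x"
      by (rule dir_deriv_cong[OF assms(1,2)]) (rule dir_deriv_sum, rule Cinf_on_differentiable[OF assms(3)])
    also have "\<dots> = (\<Sum>i\<in>I. dir_deriv (dir_deriv (f i) b) b x)"
      by (rule dir_deriv_sum, rule Cinf_on_differentiable[OF Cinf_on_dir_deriv[OF assms(3)] assms(2)])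
    finally show ?thesis .
  qed
  then show ?thesis by (simp add: vlap_def sum.swap[of _ I])
qed

lemma vlap_norm_powr:
  fixes x :: "'a::euclidean_space"
  assumes x: "x \<noteq> 0"
  shows "vlap (\<lambda>y. norm y powr s) x = s * (s + real DIM('a) - 2) * norm x powr (s - 2)"
proof -
  have "dir_deriv (dir_deriv (\<lambda>y. norm y powr s) b) b x
      = s * (s - 2) * norm x powr (s - 4) * (x \<bullet> b)\<^sup>2 + s * norm x powr (s - 2)" if "b \<in> Basis" for b :: 'a
  proof -
    have "dir_deriv (dir_deriv (\<lambda>y. norm y powr s) b) b x = dir_deriv (\<lambda>y. (norm y powr (s - 2)) * (s * (y \<bullet> b))) b x"
      by (rule dir_deriv_cong[of "-{0}"]) (use x in \<open>auto simp: dir_deriv_norm_powr\<close>)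
    also have "\<dots> = (norm x powr (s - 2)) * dir_deriv (\<lambda>y. s * (y \<bullet> b)) b x
        + dir_deriv (\<lambda>y. norm y powr (s - 2)) b x * (s * (x \<bullet> b))"
      by (rule dir_deriv_mult; rule Cinf_on_differentiable[of _ "-{0}"]) (use x in \<open>auto intro!: Cinf_intros\<close>)
    also have "dir_deriv (\<lambda>y. s * (y \<bullet> b)) b x = s * (b \<bullet> b)"
      by (rule dir_deriv_eqI) (auto intro!: derivative_eq_intros)
    finally show ?thesis using x that
      by (simp add: dir_deriv_norm_powr power2_eq_square algebra_simps)
  qed
  then have "vlap (\<lambda>y. norm y powr s) x
      = (\<Sum>b\<in>Basis. s * (s - 2) * norm x powr (s - 4) * (x \<bullet> b)\<^sup>2 + s * norm x powr (s - 2))"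
    by (simp add: vlap_def)
  also have "\<dots> = s * (s - 2) * norm x powr (s - 4) * (\<Sum>b\<in>Basis. (x \<bullet> b)\<^sup>2) + real DIM('a) * (s * norm x powr (s - 2))"
    by (simp add: sum.distrib sum_distrib_left)
  also have "(\<Sum>b\<in>Basis. (x \<bullet> b)\<^sup>2) = norm x powr 2"
    using x by (simp add: power2_eq_square flip: euclidean_inner) (simp add: dot_square_norm power2_eq_square)
  also have "s * (s - 2) * norm x powr (s - 4) * norm x powr 2 = s * (s - 2) * norm x powr (s - 2)"
    by (simp only: mult.assoc powr_add[symmetric]) simp
  finally show ?thesis by (simp add: algebra_simps)
qed

text \<open>The squared Euclidean length of the tensor of k-th derivatives. Splitting off the
  innermost derivative lets inductions pass from F to \<open>dir_deriv F b\<close>, which is again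
  harmonic, and homogeneous of degree one less, if F is so.\<close>

primrec energy :: "nat \<Rightarrow> ('a::euclidean_space \<Rightarrow> 'b::real_inner) \<Rightarrow> 'a \<Rightarrow> real" where
  "energy 0 F = (\<lambda>x. F x \<bullet> F x)"
| "energy (Suc k) F = (\<lambda>x. \<Sum>b\<in>Basis. energy k (dir_deriv F b) x)"

lemma energy_nonneg: "energy k F x \<ge> 0"
  by (induction k arbitrary: F) (auto intro: sum_nonneg)

lemma Cinf_on_energy:
  fixes F :: "'a::euclidean_space \<Rightarrow> 'b::euclidean_space"
  shows "open U \<Longrightarrow> Cinf_on F U \<Longrightarrow> Cinf_on (energy k F) U"
proof (induction k arbitrary: F)
  case 0
  then show ?case by (auto intro!: Cinf_intros)
next
  case (Suc k)
  then show ?case by (auto intro!: Cinf_on_sum Cinf_on_dir_deriv)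
qed

text \<open>For harmonic F the product rule leaves only the gradient term in the Laplacian of |F|^2.
  The derivatives of F are harmonic again, so the same holds at every order.\<close>

lemma energy_Suc_eq_vlap:
  fixes F :: "'a::euclidean_space \<Rightarrow> 'b::euclidean_space"
  assumes U: "open U" "x \<in> U"
  shows "Cinf_on F U \<Longrightarrow> (\<And>y. y \<in> U \<Longrightarrow> vlap F y = 0) \<Longrightarrow> energy (Suc k) F x = vlap (energy k F) x / 2"
proof (induction k arbitrary: F)
  case 0
  then show ?case using vlap_inner[OF U 0(1) 0(1)] U by simp
next
  case (Suc k)
  have h: "vlap (dir_deriv F b) y = 0" if y: "y \<in> U" for b y
  proof -
    have "vlap (dir_deriv F b) y = dir_deriv (\<lambda>x. 0) b y"
      unfolding vlap_dir_deriv[OF U(1) y Suc.prems(1)]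
      by (rule dir_deriv_cong[OF U(1) y]) (rule Suc.prems(2))
    then show ?thesis by simp
  qed
  have "energy (Suc (Suc k)) F x = (\<Sum>b\<in>Basis. vlap (energy k (dir_deriv F b)) x / 2)"
    unfolding energy.simps(2)[of "Suc k"] using Suc.IH[OF Cinf_on_dir_deriv[OF Suc.prems(1)] h]
    by (intro sum.cong refl) auto
  also have "\<dots> = vlap (energy (Suc k) F) x / 2"
    using vlap_sum[OF U, of Basis "\<lambda>b. energy k (dir_deriv F b)"] Suc.prems(1) U(1)
    by (simp add: sum_divide_distrib Cinf_on_energy Cinf_on_dir_deriv)
  finally show ?case .
qed

text \<open>Starting from |F|^2 = r^(2\<alpha>), half the Laplacian is taken k times. On r^s it
  multiplies by s (s + DIM - 2) / 2 and lowers the exponent by 2; the factors of the product are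
  these numbers for s = 2\<alpha> - 2j.\<close>

lemma energy_radial:
  fixes F :: "'a::euclidean_space \<Rightarrow> 'b::euclidean_space"
  assumes F: "Cinf_on F (- {0})" and harm: "\<And>y. y \<noteq> 0 \<Longrightarrow> vlap F y = 0"
    and len: "\<And>y. y \<noteq> 0 \<Longrightarrow> norm (F y) = norm y powr \<alpha>" and "x \<noteq> 0"
  shows "energy k F x = (\<Prod>j<k. (\<alpha> - real j) * (2 * \<alpha> - 2 * real j + real DIM('a) - 2))
    * norm x powr (2 * \<alpha> - 2 * real k)"
  using \<open>x \<noteq> 0\<close>
proof (induction k arbitrary: x)
  case 0
  then show ?case
    using len[of x] by (simp add: dot_square_norm powr_power mult.commute)
next
  case (Suc k)
  let ?c = "\<Prod>j<k. (\<alpha> - real j) * (2 * \<alpha> - 2 * real j + real DIM('a) - 2)"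
  have x: "x \<in> - {0}" using Suc by simp
  have "energy (Suc k) F x = vlap (energy k F) x / 2"
    by (rule energy_Suc_eq_vlap[OF _ x F]) (auto simp: harm)
  also have "vlap (energy k F) x = vlap (\<lambda>y. ?c * norm y powr (2 * \<alpha> - 2 * real k)) x"
    by (rule vlap_cong[OF _ x]) (use Suc.IH in auto)
  also have "\<dots> = ?c * vlap (\<lambda>y. norm y powr (2 * \<alpha> - 2 * real k)) x"
    by (rule vlap_linear_comp[OF bounded_linear_mult_right _ x Cinf_on_norm_powr]) simp
  finally show ?case using Suc.prems
    by (simp add: vlap_norm_powr algebra_simps)
qed

text \<open>For k = 0 this is Euler's identity \<alpha> F(x) = sum of x_b D_b F(x) combined with
  Cauchy-Schwarz. Higher orders apply it to the derivatives, each of which lowers the degree by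
  one.\<close>

lemma energy_Suc_ge:
  fixes F :: "'a::euclidean_space \<Rightarrow> 'b::euclidean_space"
  assumes "x \<noteq> 0"
  shows "Cinf_on F (- {0}) \<Longrightarrow> homog \<alpha> F \<Longrightarrow> (\<alpha> - real k)\<^sup>2 * energy k F x \<le> energy (Suc k) F x * (x \<bullet> x)"
proof (induction k arbitrary: F \<alpha>)
  case 0
  have d: "F differentiable (at x)" using 0 assms by (auto intro: Cinf_on_differentiable)
  have "\<bar>\<alpha>\<bar> * norm (F x) = norm (\<Sum>b\<in>Basis. (x \<bullet> b) *\<^sub>R dir_deriv F b x)"
    using homog_euler[OF 0 assms] by (simp add: dir_deriv_basis_sum[OF d])
  also have "\<dots> \<le> (\<Sum>b\<in>Basis. \<bar>x \<bullet> b\<bar> * norm (dir_deriv F b x))"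
    using norm_sum[of "\<lambda>b. (x \<bullet> b) *\<^sub>R dir_deriv F b x" Basis] by simp
  finally have "(\<bar>\<alpha>\<bar> * norm (F x))\<^sup>2 \<le> (\<Sum>b\<in>Basis. \<bar>x \<bullet> b\<bar> * norm (dir_deriv F b x))\<^sup>2"
    by (intro power_mono) auto
  also have "\<dots> \<le> (\<Sum>b\<in>Basis. \<bar>x \<bullet> b\<bar>\<^sup>2) * (\<Sum>b\<in>Basis. (norm (dir_deriv F b x))\<^sup>2)"
    by (rule Cauchy_Schwarz_ineq_sum)
  also have "(\<Sum>b\<in>Basis. \<bar>x \<bullet> b\<bar>\<^sup>2) = x \<bullet> x"
    by (subst euclidean_inner) (simp add: power2_eq_square)
  finally show ?case
    by (simp add: power_mult_distrib mult.commute flip: dot_square_norm)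
next
  case (Suc k)
  have "(\<alpha> - real (Suc k))\<^sup>2 * energy (Suc k) F x = (\<Sum>b\<in>Basis. (\<alpha> - 1 - real k)\<^sup>2 * energy k (dir_deriv F b) x)"
    unfolding energy.simps sum_distrib_left by (simp add: diff_diff_add)
  also have "\<dots> \<le> (\<Sum>b\<in>Basis. energy (Suc k) (dir_deriv F b) x * (x \<bullet> x))"
    using Suc by (intro sum_mono Suc.IH Cinf_on_dir_deriv homog_dir_deriv)
  finally show ?case by (simp add: sum_distrib_right)
qed

text \<open>Euler's identity integrates: (k + 1) F = sum of x_b D_b F, and the D_b F are polynomial
  by induction. At degree 0 the gradient vanishes, and F is constant because the punctured space is
  connected; this is where dimension at least 2 enters. Homogeneity of the polynomial for all real
  c, not only positive ones, is carried along.\<close>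

lemma homog_energy_zero_polynomial:
  fixes F :: "'a::euclidean_space \<Rightarrow> 'b::euclidean_space"
  assumes dim: "DIM('a) \<ge> 2"
  shows "Cinf_on F (- {0}) \<Longrightarrow> homog (real k) F \<Longrightarrow> (\<And>x. x \<noteq> 0 \<Longrightarrow> energy (Suc k) F x = 0) \<Longrightarrow>
    \<exists>P. (\<forall>i\<in>Basis. real_polynomial_function (\<lambda>x. P x \<bullet> i)) \<and> (\<forall>c x. P (c *\<^sub>R x) = c ^ k *\<^sub>R P x)
      \<and> (\<forall>x. x \<noteq> 0 \<longrightarrow> F x = P x)"
proof (induction k arbitrary: F)
  case 0
  have z: "dir_deriv F v x = 0" if "x \<noteq> 0" for v x
  proof -
    have "dir_deriv F b x = 0" if "b \<in> Basis" for b
      using 0(3)[OF \<open>x \<noteq> 0\<close>] that by (simp add: sum_nonneg_eq_0_iff)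
    then show ?thesis
      using dir_deriv_basis_sum[OF Cinf_on_differentiable[OF 0(1)], of x v] \<open>x \<noteq> 0\<close> by simp
  qed
  have con: "connected (- {0 :: 'a})"
    by (rule path_connected_imp_connected[OF path_connected_punctured_universe[OF dim]])
  have "(F has_derivative (\<lambda>v. 0)) (at x)" if "x \<in> - {0}" for x
  proof -
    have "(\<lambda>v. dir_deriv F v x) = (\<lambda>v. 0)" using z that by auto
    then show ?thesis using Cinf_on_has_derivative[OF 0(1) that] by metis
  qed
  note D = this
  obtain b :: 'a where "b \<in> Basis" using nonempty_Basis by blast
  then have b: "b \<in> - {0}" by auto
  have "F x = F b" if "x \<noteq> 0" for x
    by (rule has_derivative_zero_unique_connected[OF open_minus_origin con D _ b]) (use that in auto)
  then show ?case
    by (intro exI[of _ "\<lambda>x. F b"]) (simp add: real_polynomial_function.intros(2))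
next
  case (Suc k)
  have "\<exists>P. (\<forall>i\<in>Basis. real_polynomial_function (\<lambda>x. P x \<bullet> i)) \<and> (\<forall>c x. P (c *\<^sub>R x) = c ^ k *\<^sub>R P x)
      \<and> (\<forall>x. x \<noteq> 0 \<longrightarrow> dir_deriv F b x = P x)" if "b \<in> Basis" for b
  proof (rule Suc.IH)
    show "Cinf_on (dir_deriv F b) (- {0})" using Suc.prems by (simp add: Cinf_on_dir_deriv)
    show "homog (real k) (dir_deriv F b)" using homog_dir_deriv[OF Suc.prems(1,2)] by simp
    show "energy (Suc k) (dir_deriv F b) x = 0" if "x \<noteq> 0" for x
      using Suc.prems(3)[OF that] \<open>b \<in> Basis\<close>
        sum_nonneg_eq_0_iff[of Basis "\<lambda>b. energy (Suc k) (dir_deriv F b) x"] energy_nonneg by fastforce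
  qed
  then obtain P where P: "\<And>b i. b \<in> Basis \<Longrightarrow> i \<in> Basis \<Longrightarrow> real_polynomial_function (\<lambda>x. P b x \<bullet> i)"
    "\<And>b c x. b \<in> Basis \<Longrightarrow> P b (c *\<^sub>R x) = c ^ k *\<^sub>R P b x"
    "\<And>b x. b \<in> Basis \<Longrightarrow> x \<noteq> 0 \<Longrightarrow> dir_deriv F b x = P b x" by metis
  define Q where "Q x = (1 / real (Suc k)) *\<^sub>R (\<Sum>b\<in>Basis. (x \<bullet> b) *\<^sub>R P b x)" for x
  have "real_polynomial_function (\<lambda>x. Q x \<bullet> i)" if "i \<in> Basis" for i
    unfolding Q_def inner_scaleR_left inner_sum_left using that
    by (intro real_polynomial_function.intros real_polynomial_function_sum P
        bounded_linear_inner_left finite_Basis)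
  moreover have "Q (c *\<^sub>R x) = c ^ Suc k *\<^sub>R Q x" for c x
    by (simp add: Q_def P(2) scaleR_sum_right algebra_simps)
  moreover have "F x = Q x" if "x \<noteq> 0" for x
  proof -
    have "real (Suc k) *\<^sub>R F x = dir_deriv F x x"
      using homog_euler[OF Suc.prems(1,2) that] by simp
    also have "\<dots> = (\<Sum>b\<in>Basis. (x \<bullet> b) *\<^sub>R dir_deriv F b x)"
      using dir_deriv_basis_sum[OF Cinf_on_differentiable[OF Suc.prems(1)], of x x] that by simp
    also have "\<dots> = real (Suc k) *\<^sub>R Q x" using that by (simp add: Q_def P(3) del: of_nat_Suc)
    finally show ?thesis by (simp del: of_nat_Suc)
  qed
  ultimately show ?case by blast
qed

theorem homog_harmonic_polynomial:
  fixes F :: "'a::euclidean_space \<Rightarrow> 'b::euclidean_space"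
  assumes F: "Cinf_on F (- {0})" "homog \<alpha> F" and harm: "\<And>y. y \<noteq> 0 \<Longrightarrow> vlap F y = 0"
    and len: "\<And>y. y \<noteq> 0 \<Longrightarrow> norm (F y) = norm y powr \<alpha>"
    and "\<alpha> > 0" and dim: "DIM('a) \<ge> 3 \<or> DIM('a) = 2 \<and> \<alpha> = 1"
  obtains k P where "\<alpha> = real k" "\<And>i. i \<in> Basis \<Longrightarrow> real_polynomial_function (\<lambda>x. P x \<bullet> i)"
    "\<And>c x. P (c *\<^sub>R x) = c ^ k *\<^sub>R P x" "\<And>x. x \<noteq> 0 \<Longrightarrow> F x = P x"
proof -
  define c where "c k = (\<Prod>j<k. (\<alpha> - real j) * (2 * \<alpha> - 2 * real j + real DIM('a) - 2))" for k :: nat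
  note E = energy_radial[OF F(1) harm len, folded c_def]
  have "\<exists>k::nat. \<alpha> = real k"
  proof (rule ccontr)
    assume nk: "\<not> ?thesis"
    with dim have dim: "DIM('a) \<ge> 3" by (metis of_nat_1)
    \<comment> \<open>The first integer above \<alpha>: all factors of \<open>c k\<close> are still
      positive, while \<alpha> - k lies strictly between -1 and 0.\<close>
    define k where "k = nat \<lceil>\<alpha>\<rceil>"
    have "real k = of_int \<lceil>\<alpha>\<rceil>" using \<open>\<alpha> > 0\<close> by (simp add: k_def)
    then have k: "\<alpha> < real k" "real k < \<alpha> + 1"
      using nk le_of_int_ceiling[of \<alpha>] of_int_ceiling_le_add_one[of \<alpha>] ceiling_correct[of \<alpha>]
      by (auto simp: less_le)
    have "c k > 0" unfolding c_def
    proof (rule prod_pos)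
      fix j assume "j \<in> {..<k}"
      then have "real j + 1 \<le> real k" by (simp add: Suc_leI)
      then have "\<alpha> - real j > 0" using k by simp
      then show "(\<alpha> - real j) * (2 * \<alpha> - 2 * real j + real DIM('a) - 2) > 0"
        using dim by (intro mult_pos_pos) auto
    qed
    obtain b :: 'a where b: "b \<in> Basis" using nonempty_Basis by blast
    then have b1: "norm b = 1" "b \<noteq> 0" by auto
    define \<gamma> where "\<gamma> = \<alpha> - real k"
    have "\<gamma>\<^sup>2 * c k \<le> c (Suc k)"
      using energy_Suc_ge[OF b1(2) F, of k] E[OF _ _ b1(2), of k] E[OF _ _ b1(2), of "Suc k"] b1
      by (simp add: \<gamma>_def dot_square_norm)
    also have "c (Suc k) = \<gamma> * (2 * \<gamma> + real DIM('a) - 2) * c k"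
      by (simp add: c_def \<gamma>_def algebra_simps)
    finally have "\<gamma>\<^sup>2 \<le> \<gamma> * (2 * \<gamma> + real DIM('a) - 2)" using \<open>c k > 0\<close> by simp
    then have "\<gamma> * (\<gamma> + real DIM('a) - 2) \<ge> 0" by (simp add: power2_eq_square algebra_simps)
    moreover have "\<gamma> < 0" "\<gamma> + real DIM('a) - 2 > 0" using k dim by (auto simp: \<gamma>_def)
    ultimately show False by (simp add: zero_le_mult_iff)
  qed
  then obtain k :: nat where k: "\<alpha> = real k" by blast
  \<comment> \<open>The last factor, with index j = k, is zero.\<close>
  have "c (Suc k) = 0" by (simp add: c_def k)
  then have "energy (Suc k) F x = 0" if "x \<noteq> 0" for x
    using E[OF _ _ that, of "Suc k"] by simp
  moreover have "DIM('a) \<ge> 2" "homog (real k) F" using dim F k by auto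
  ultimately obtain P where "\<forall>i\<in>Basis. real_polynomial_function (\<lambda>x. P x \<bullet> i)"
    "\<forall>c x. P (c *\<^sub>R x) = c ^ k *\<^sub>R P x" "\<forall>x. x \<noteq> 0 \<longrightarrow> F x = P x"
    using homog_energy_zero_polynomial[of F k] F(1) by blast
  then show thesis by (intro that[OF k, of P]) auto
qed

section \<open>Harmonicity of polynomials across the origin\<close>

lemma Cinf_on_real_polynomial_function:
  "real_polynomial_function p \<Longrightarrow> Cinf_on p UNIV"
  by (induction rule: real_polynomial_function.induct)
    (simp_all add: Cinf_on_bounded_linear Cinf_on_const Cinf_on_add Cinf_on_mult)

text \<open>\<open>spherical_harmonic\<close> asks for harmonicity everywhere, but the homogeneous
  extension is controlled only off the origin; continuity of the Laplacian of a polynomial closes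
  the gap.\<close>

lemma vlap_polynomial_eq_0:
  assumes "real_polynomial_function p" "\<And>x. x \<noteq> 0 \<Longrightarrow> vlap p x = 0"
  shows "vlap p x = 0"
proof -
  have "continuous_on (closure (- {0})) (vlap p)"
    using Cinf_on_continuous[OF Cinf_on_vlap[OF _ Cinf_on_real_polynomial_function[OF assms(1)]]]
      continuous_on_subset by auto
  moreover have "x \<in> closure (- {0})" by (simp add: closure_complement)
  ultimately show ?thesis using continuous_constant_on_closure[of "- {0}" "vlap p" 0 x] assms(2) by auto
qed

subsection \<open>Tangent spaces and differentials\<close>

lemma has_vector_derivative_compose_within:
  fixes \<gamma> :: "real \<Rightarrow> 'a::euclidean_space" and f :: "'a \<Rightarrow> 'b::euclidean_space"
  assumes f: "(f has_derivative D) (at (\<gamma> 0) within M)"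
    and \<gamma>: "(\<gamma> has_vector_derivative v) (at 0)" "\<epsilon> > 0" "\<gamma> ` {-\<epsilon><..<\<epsilon>} \<subseteq> M"
  shows "((\<lambda>t. f (\<gamma> t)) has_vector_derivative D v) (at 0)"
proof -
  let ?I = "{-\<epsilon><..<\<epsilon>}"
  have at: "at 0 within ?I = at (0::real)" using \<gamma>(2) by (intro at_within_open) auto
  have "(\<gamma> has_derivative (\<lambda>h. h *\<^sub>R v)) (at 0 within ?I)"
    using \<gamma>(1) unfolding at has_vector_derivative_def .
  from diff_chain_within[OF this has_derivative_subset[OF f \<gamma>(3)]]
  have "((\<lambda>t. f (\<gamma> t)) has_derivative (\<lambda>h. D (h *\<^sub>R v))) (at 0)"
    by (simp add: o_def at)
  moreover have "D (h *\<^sub>R v) = h *\<^sub>R D v" for h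
    using linear_scale[OF has_derivative_linear[OF f]] .
  ultimately show ?thesis by (simp add: has_vector_derivative_def)
qed

text \<open>Any derivative within M, evaluated at a tangent vector, is the derivative of f along a
  curve in M with that velocity, so the choice made by \<open>differential\<close> is immaterial
  there.\<close>

lemma differential_eq:
  assumes "(f has_derivative D) (at p within M)" "v \<in> tangent_space M p"
  shows "differential M f p v = D v"
proof -
  obtain \<gamma> \<epsilon> where \<gamma>: "\<epsilon> > 0" "\<gamma> ` {-\<epsilon><..<\<epsilon>} \<subseteq> M" "\<gamma> 0 = p" "(\<gamma> has_vector_derivative v) (at 0)"
    using assms(2) unfolding tangent_space_def by auto
  have "f differentiable (at p within M)" using assms(1) by (auto simp: differentiable_def)
  then have "(f has_derivative differential M f p) (at (\<gamma> 0) within M)"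
    unfolding differential_def frechet_derivative_works \<gamma>(3) .
  from has_vector_derivative_compose_within[OF this \<gamma>(4,1,2)]
    has_vector_derivative_compose_within[OF assms(1)[folded \<gamma>(3)] \<gamma>(4,1,2)]
  show ?thesis by (rule vector_derivative_unique_at)
qed

lemma Cinf_on_has_vector_derivative:
  fixes \<gamma> :: "real \<Rightarrow> 'a::real_normed_vector"
  assumes "Cinf_on \<gamma> U" "t \<in> U"
  shows "(\<gamma> has_vector_derivative dir_deriv \<gamma> 1 t) (at t)"
proof -
  have "dir_deriv \<gamma> h t = h *\<^sub>R dir_deriv \<gamma> 1 t" for h
    using linear_scale[OF linear_dir_deriv[OF Cinf_on_differentiable[OF assms]], of h 1] by simp
  then have "(\<lambda>h. dir_deriv \<gamma> h t) = (\<lambda>h. h *\<^sub>R dir_deriv \<gamma> 1 t)" by (rule HOL.ext)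
  then show ?thesis
    using Cinf_on_has_derivative[OF assms] unfolding has_vector_derivative_def by metis
qed

lemma tangent_spaceI:
  fixes \<gamma> :: "real \<Rightarrow> 'a::euclidean_space"
  assumes "Cinf_on \<gamma> UNIV" "range \<gamma> \<subseteq> M" "\<gamma> 0 = p" "dir_deriv \<gamma> 1 0 = v"
  shows "v \<in> tangent_space M p"
  unfolding tangent_space_def
  using assms Cinf_on_has_vector_derivative[OF assms(1), of 0] Cinf_on_imp_smooth_on[OF open_UNIV assms(1)]
  by (intro CollectI exI[of _ \<gamma>] exI[of _ 1]) auto

lemma smooth_on_has_derivative_within:
  assumes "smooth_on M f" "p \<in> M"
  obtains D where "(f has_derivative D) (at p within M)"
proof -
  obtain U F where U: "open U" "p \<in> U" "Cinf_on F U" "\<forall>y\<in>M \<inter> U. F y = f y"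
    using assms unfolding smooth_on_alt by blast
  have "(F has_derivative (\<lambda>v. dir_deriv F v p)) (at p within M)"
    using Cinf_on_has_derivative[OF U(3,2)] has_derivative_at_withinI by blast
  moreover obtain d where "d > 0" "ball p d \<subseteq> U" using U openE by blast
  then have d: "d > 0" "\<And>y. y \<in> M \<Longrightarrow> dist y p < d \<Longrightarrow> F y = f y"
    using U(4) by (auto simp: dist_commute subset_iff)
  ultimately have "(f has_derivative (\<lambda>v. dir_deriv F v p)) (at p within M)"
    using has_derivative_transform_within d assms(2) by blast
  then show thesis using that by blast
qed

section \<open>The retraction onto the sphere and its derivatives\<close>

declare powr_neg_one' [simp del]

text \<open>Written with a real power of the norm so that the smoothness and derivative rules for
  such powers apply directly.\<close>

definition radial :: "'a::euclidean_space \<Rightarrow> 'a" where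
  "radial y = norm y powr (- 1) *\<^sub>R y"

lemma radial_eq [simp]: "norm x = 1 \<Longrightarrow> radial x = x"
  by (simp add: radial_def)

lemma norm_radial [simp]: "y \<noteq> 0 \<Longrightarrow> norm (radial y) = 1"
  by (simp add: radial_def powr_minus powr_neg_one')

lemma radial_nonzero [simp]: "y \<noteq> 0 \<Longrightarrow> radial y \<noteq> 0"
  using norm_radial by fastforce

lemma radial_scale: "t > 0 \<Longrightarrow> radial (t *\<^sub>R y) = radial y"
  by (simp add: radial_def powr_mult powr_minus powr_neg_one' field_simps)

lemma norm_scale_radial: "norm y *\<^sub>R radial y = y"
  by (cases "y = 0") (simp_all add: radial_def powr_minus powr_neg_one')

lemma Cinf_on_radial [Cinf_intros]: "Cinf_on radial (- {0})"
  unfolding radial_def[abs_def] by (intro Cinf_intros open_minus_origin)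

lemma dir_deriv_radial:
  assumes "y \<noteq> 0"
  shows "dir_deriv radial v y = norm y powr (- 1) *\<^sub>R v - (norm y powr (- 3) * (y \<bullet> v)) *\<^sub>R y"
proof -
  have "dir_deriv radial v y = norm y powr (- 1) *\<^sub>R dir_deriv (\<lambda>y. y) v y
      + dir_deriv (\<lambda>y. norm y powr (- 1)) v y *\<^sub>R y"
    unfolding radial_def[abs_def]
    by (rule dir_deriv_scaleR; rule Cinf_on_differentiable[of _ "-{0}"])
      (use assms in \<open>auto intro!: Cinf_intros\<close>)
  then show ?thesis using assms by (simp add: dir_deriv_norm_powr)
qed

text \<open>This is the second fundamental form of the unit sphere, obtained as the tangential
  Hessian of the nearest-point retraction.\<close>

lemma dir_deriv2_radial:
  assumes x: "norm x = 1" "u \<bullet> x = 0" "w \<bullet> x = 0"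
  shows "dir_deriv (dir_deriv radial w) u x = - (u \<bullet> w) *\<^sub>R x"
proof -
  have x0: "x \<in> - {0}" using x by auto
  have inn: "dir_deriv (\<lambda>y. y \<bullet> w) u x = u \<bullet> w"
    by (rule dir_deriv_eqI) (auto intro!: derivative_eq_intros)
  have "dir_deriv (dir_deriv radial w) u x
      = dir_deriv (\<lambda>y. norm y powr (- 1) *\<^sub>R w - (norm y powr (- 3) * (y \<bullet> w)) *\<^sub>R y) u x"
    by (rule dir_deriv_cong[OF _ x0]) (auto simp: dir_deriv_radial)
  also have "\<dots> = dir_deriv (\<lambda>y. norm y powr (- 1) *\<^sub>R w) u x
      - dir_deriv (\<lambda>y. (norm y powr (- 3) * (y \<bullet> w)) *\<^sub>R y) u x"
    by (rule dir_deriv_eqI)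
      (intro has_derivative_diff has_derivative_dir_deriv Cinf_on_differentiable[OF _ x0] Cinf_intros; simp)
  also have "dir_deriv (\<lambda>y. norm y powr (- 1) *\<^sub>R w) u x = 0"
    using x x0
    by (subst dir_deriv_linear_comp[OF bounded_linear_scaleR_left Cinf_on_differentiable[OF Cinf_on_norm_powr x0]])
      (simp add: dir_deriv_norm_powr inner_commute)
  also have "dir_deriv (\<lambda>y. (norm y powr (- 3) * (y \<bullet> w)) *\<^sub>R y) u x
      = (norm x powr (- 3) * (x \<bullet> w)) *\<^sub>R u + dir_deriv (\<lambda>y. norm y powr (- 3) * (y \<bullet> w)) u x *\<^sub>R x"
    by (subst dir_deriv_scaleR) (auto intro!: Cinf_on_differentiable[OF _ x0] Cinf_intros)
  also have "dir_deriv (\<lambda>y. norm y powr (- 3) * (y \<bullet> w)) u x = u \<bullet> w"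
    using x x0 by (subst dir_deriv_mult)
      (auto simp: inn dir_deriv_norm_powr inner_commute intro!: Cinf_on_differentiable[OF _ x0] Cinf_intros)
  finally show ?thesis using x by (simp add: inner_commute)
qed

lemma tangent_space_sphere:
  fixes p :: "'a::euclidean_space"
  assumes "norm p = 1"
  shows "tangent_space (sphere 0 1) p = {v. v \<bullet> p = 0}"
proof (intro set_eqI iffI)
  fix v assume v: "v \<in> tangent_space (sphere 0 1) p"
  then obtain \<gamma> :: "real \<Rightarrow> 'a" and \<epsilon> where \<gamma>: "\<epsilon> > 0" "\<gamma> ` {-\<epsilon><..<\<epsilon>} \<subseteq> sphere 0 1"
    "\<gamma> 0 = p" "(\<gamma> has_vector_derivative v) (at 0)" unfolding tangent_space_def by auto
  have "((\<lambda>t. \<gamma> t \<bullet> \<gamma> t) has_vector_derivative (p \<bullet> v + v \<bullet> p)) (at 0)"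
    using bounded_bilinear.has_vector_derivative[OF bounded_bilinear_inner \<gamma>(4,4)] \<gamma>(3) by simp
  moreover have "((\<lambda>t. \<gamma> t \<bullet> \<gamma> t) has_vector_derivative 0) (at 0)"
  proof (rule has_vector_derivative_transform_within_open[of "\<lambda>t. 1"])
    show "open {-\<epsilon><..<\<epsilon>}" "0 \<in> {-\<epsilon><..<\<epsilon>}" using \<gamma>(1) by auto
    show "1 = \<gamma> t \<bullet> \<gamma> t" if "t \<in> {-\<epsilon><..<\<epsilon>}" for t
    proof -
      have "\<gamma> t \<in> sphere 0 1" using \<gamma>(2) that by blast
      then show ?thesis by (simp add: dot_square_norm)
    qed
  qed (rule has_vector_derivative_const)
  ultimately have "p \<bullet> v + v \<bullet> p = 0" using vector_derivative_unique_at by blast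
  then show "v \<in> {v. v \<bullet> p = 0}" by (simp add: inner_commute)
next
  fix v assume "v \<in> {v. v \<bullet> p = 0}"
  then have v: "v \<bullet> p = 0" by simp
  have nz: "p + t *\<^sub>R v \<noteq> 0" for t
  proof
    assume "p + t *\<^sub>R v = 0"
    then have "(p + t *\<^sub>R v) \<bullet> p = 0" by simp
    then show False using v assms by (simp add: inner_add_left dot_square_norm)
  qed
  let ?\<gamma> = "\<lambda>t. radial (p + t *\<^sub>R v)"
  show "v \<in> tangent_space (sphere 0 1) p"
  proof (rule tangent_spaceI[of ?\<gamma>])
    show "Cinf_on ?\<gamma> UNIV"
      by (rule Cinf_on_compose[of UNIV "-{0}"]) (use nz in \<open>auto intro!: Cinf_intros\<close>)
    have "dir_deriv ?\<gamma> 1 0 = dir_deriv radial (dir_deriv (\<lambda>t. p + t *\<^sub>R v) 1 0) (p + 0 *\<^sub>R v)"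
      by (rule dir_deriv_compose[where g = radial])
        (use nz[of 0] in \<open>auto intro!: derivative_intros Cinf_on_differentiable[OF Cinf_on_radial]\<close>)
    also have "dir_deriv (\<lambda>t::real. p + t *\<^sub>R v) 1 0 = 1 *\<^sub>R v"
      by (rule dir_deriv_eqI) (auto intro!: derivative_eq_intros)
    also have "dir_deriv radial (1 *\<^sub>R v) (p + 0 *\<^sub>R v) = v"
      using nz[of 0] assms v by (simp add: dir_deriv_radial inner_commute)
    finally show "dir_deriv ?\<gamma> 1 0 = v" .
  qed (use nz assms in auto)
qed

subsection \<open>The homogeneous extension of a map between spheres\<close>

locale sphere_map =
  fixes f :: "'a::euclidean_space \<Rightarrow> 'b::euclidean_space"
  assumes smooth: "smooth_on (sphere 0 1) f" and maps: "f ` sphere 0 1 \<subseteq> sphere 0 1"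
begin

text \<open>Constant along rays. Hence its Euclidean Laplacian at a unit vector is the Laplacian of
  f on the sphere, and the hypothesis \<open>smooth_on\<close>, which only provides local
  extensions, becomes smoothness on one open set.\<close>

definition ext :: "'a \<Rightarrow> 'b" where
  "ext y = f (radial y)"

lemma ext_eq [simp]: "norm x = 1 \<Longrightarrow> ext x = f x"
  by (simp add: ext_def)

lemma norm_ext [simp]: "y \<noteq> 0 \<Longrightarrow> norm (ext y) = 1"
  using maps unfolding ext_def by (metis norm_radial imageI mem_sphere_0 subsetD)

lemma Cinf_ext [Cinf_intros]: "Cinf_on ext (- {0})"
proof (rule Cinf_on_local)
  fix y :: 'a assume y: "y \<in> - {0}"
  then have "radial y \<in> sphere 0 1" by simp
  then obtain U F where U: "open U" "radial y \<in> U" "Cinf_on F U" "\<forall>z\<in>sphere 0 1 \<inter> U. F z = f z"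
    using smooth unfolding smooth_on_alt by blast
  let ?V = "radial -` U \<inter> - {0}"
  have op: "open ?V"
    using continuous_open_preimage[OF Cinf_on_continuous[OF Cinf_on_radial] open_minus_origin U(1)]
    by (simp add: Int_commute)
  have "Cinf_on (\<lambda>z. F (radial z)) ?V"
    by (rule Cinf_on_compose[OF op U(1)]) (auto intro: Cinf_on_subset[OF Cinf_on_radial] U(3))
  then have "Cinf_on ext ?V"
    by (rule Cinf_on_cong[OF op, rotated]) (use U(4) in \<open>auto simp: ext_def\<close>)
  then show "\<exists>V. open V \<and> y \<in> V \<and> Cinf_on ext V" using op y U(2) by blast
qed

lemma homog_ext: "homog 0 ext"
  by (simp add: homog_def ext_def radial_scale)

lemma ext_scale: "t > 0 \<Longrightarrow> ext (t *\<^sub>R y) = ext y"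
  by (simp add: ext_def radial_scale)

lemma D_radial: "y \<noteq> 0 \<Longrightarrow> dir_deriv ext y y = 0"
  using homog_euler[OF Cinf_ext homog_ext] by simp

lemma D_differentiable: "y \<noteq> 0 \<Longrightarrow> ext differentiable (at y)"
  using Cinf_on_differentiable[OF Cinf_ext] by simp

lemma D_linear: "y \<noteq> 0 \<Longrightarrow> linear (\<lambda>v. dir_deriv ext v y)"
  using linear_dir_deriv D_differentiable by blast

lemma D_orth: assumes "y \<noteq> 0" shows "ext y \<bullet> dir_deriv ext v y = 0"
proof -
  have "dir_deriv (\<lambda>y. ext y \<bullet> ext y) v y = dir_deriv (\<lambda>y. 1) v y"
    by (rule dir_deriv_cong[of "-{0}"]) (use assms in \<open>auto simp: dot_square_norm\<close>)
  then show ?thesis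
    by (simp add: dir_deriv_inner D_differentiable assms inner_commute)
qed

text \<open>\<open>dir_deriv ext x\<close> with x frozen as a direction has degree -1, so Euler's
  identity reduces its radial derivative at x to the first radial derivative of \<open>ext\<close>,
  which is zero.\<close>

lemma D2_radial:
  assumes "norm x = 1" shows "dir_deriv (dir_deriv ext x) x x = 0"
proof -
  have x: "x \<in> - {0}" using assms by auto
  have "linear (\<lambda>v. dir_deriv (dir_deriv ext v) x x)"
    by (rule dir_deriv_dir_linear[OF _ x Cinf_ext]) simp
  have "homog (- 1) (dir_deriv ext x)"
    using homog_dir_deriv[OF Cinf_ext homog_ext] by simp
  from homog_euler[OF Cinf_on_dir_deriv[OF Cinf_ext] this]
  show ?thesis using x D_radial by simp
qed

lemma D2_sym:
  assumes "y \<noteq> 0"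
  shows "dir_deriv (dir_deriv ext u) v y = dir_deriv (dir_deriv ext v) u y"
  using dir_deriv_commute[OF _ _ Cinf_ext, of y u v] assms by simp

lemma ext_inner_vlap:
  assumes "y \<noteq> 0"
  shows "ext y \<bullet> vlap ext y = - (\<Sum>b\<in>Basis. (norm (dir_deriv ext b y))\<^sup>2)"
proof -
  have y: "y \<in> - {0}" using assms by auto
  have "vlap (\<lambda>y. ext y \<bullet> ext y) y = vlap (\<lambda>y. 1) y"
    by (rule vlap_cong[OF _ y]) (auto simp: dot_square_norm)
  also have "vlap (\<lambda>y. 1 :: real) y = 0"
    by (simp add: vlap_def) (simp add: dir_deriv_def[abs_def])
  finally show ?thesis
    using vlap_inner[OF _ y Cinf_ext Cinf_ext] by (simp add: inner_commute dot_square_norm)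
qed

lemma has_derivative_within_sphere:
  assumes "norm x = 1"
  shows "(f has_derivative (\<lambda>v. dir_deriv ext v x)) (at x within sphere 0 1)"
proof -
  have "x \<noteq> 0" using assms by auto
  then have "(ext has_derivative (\<lambda>v. dir_deriv ext v x)) (at x within sphere 0 1)"
    using has_derivative_at_withinI has_derivative_dir_deriv D_differentiable by blast
  then show ?thesis
    by (rule has_derivative_transform_within[of _ _ _ _ 1]) (use assms in auto)
qed

lemma differential_f:
  assumes "norm x = 1" "v \<bullet> x = 0"
  shows "differential (sphere 0 1) f x v = dir_deriv ext v x"
  using differential_eq[OF has_derivative_within_sphere] tangent_space_sphere assms by blast

text \<open>With B the differential of \<open>ext\<close> at x, this is B^T B. It represents the
  pullback metric, extended to the ambient space by zero on the radial direction.\<close>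

definition pullback_op :: "'a \<Rightarrow> 'a \<Rightarrow> 'a" where
  "pullback_op x v = (\<Sum>b\<in>Basis. (dir_deriv ext b x \<bullet> dir_deriv ext v x) *\<^sub>R b)"

lemma pullback_op_inner:
  assumes "x \<noteq> 0"
  shows "pullback_op x v \<bullet> w = dir_deriv ext v x \<bullet> dir_deriv ext w x"
proof -
  have "pullback_op x v \<bullet> w = dir_deriv ext v x \<bullet> (\<Sum>b\<in>Basis. (w \<bullet> b) *\<^sub>R dir_deriv ext b x)"
    by (simp add: pullback_op_def inner_sum_left inner_sum_right inner_commute mult.commute)
  then show ?thesis by (simp add: dir_deriv_basis_sum[OF D_differentiable[OF assms]])
qed

lemma linear_pullback_op: "x \<noteq> 0 \<Longrightarrow> linear (pullback_op x)"
  using linear_add[OF D_linear[of x]] linear_scale[OF D_linear[of x]]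
  by (intro linearI)
    (simp_all add: pullback_op_def inner_add_right scaleR_add_left sum.distrib scaleR_sum_right)

lemma D_pullback_op:
  assumes "x \<noteq> 0"
  shows "dir_deriv ext (pullback_op x v) x = (\<Sum>b\<in>Basis. (dir_deriv ext b x \<bullet> dir_deriv ext v x) *\<^sub>R dir_deriv ext b x)"
proof -
  interpret linear "\<lambda>v. dir_deriv ext v x" using D_linear[OF assms] .
  show ?thesis by (simp add: pullback_op_def sum scale)
qed

text \<open>The condition s > 0 or s < 0 matters: the radial vector x is in the kernel of
  \<open>pullback_op x\<close> but is not tangent. Eigenvectors for a nonzero eigenvalue are tangent
  automatically, since B x = 0.\<close>

lemma singular_space_eq:
  assumes x: "norm x = 1" and s: "s \<noteq> 0"
  shows "singular_space (sphere 0 1) f x s = {v. pullback_op x v = s\<^sup>2 *\<^sub>R v}"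
proof (intro set_eqI iffI)
  have x0: "x \<noteq> 0" using x by auto
  interpret linear "\<lambda>v. dir_deriv ext v x" using D_linear[OF x0] .
  fix v
  {
    assume "v \<in> singular_space (sphere 0 1) f x s"
    then have v: "v \<bullet> x = 0" "\<And>w. w \<bullet> x = 0 \<Longrightarrow> dir_deriv ext v x \<bullet> dir_deriv ext w x = s\<^sup>2 * (v \<bullet> w)"
      using x by (auto simp: singular_space_def tangent_space_sphere differential_f)
    have "pullback_op x v \<bullet> w = (s\<^sup>2 *\<^sub>R v) \<bullet> w" for w
    proof -
      have "(w - (w \<bullet> x) *\<^sub>R x) \<bullet> x = 0" using x by (simp add: inner_diff_left dot_square_norm)
      from v(2)[OF this] show ?thesis
        using v(1) D_radial[OF x0] x0 by (simp add: diff scale inner_diff_right pullback_op_inner)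
    qed
    then show "v \<in> {v. pullback_op x v = s\<^sup>2 *\<^sub>R v}" using vector_eq_rdot by blast
  next
    assume "v \<in> {v. pullback_op x v = s\<^sup>2 *\<^sub>R v}"
    then have v: "dir_deriv ext v x \<bullet> dir_deriv ext w x = s\<^sup>2 * (v \<bullet> w)" for w
      using pullback_op_inner[OF x0, of v w] by simp
    from v[of x] have "v \<bullet> x = 0" using s D_radial[OF x0] by simp
    then show "v \<in> singular_space (sphere 0 1) f x s"
      using x v by (auto simp: singular_space_def tangent_space_sphere differential_f)
  }
qed

text \<open>An eigenvalue of B^T B at v is |B v|^2 / |v|^2, hence nonnegative, and if nonzero its
  square root is a singular value of f. So 0 and \<open>lam\<close> squared are the only
  candidates.\<close>

lemma pullback_op_projection:
  assumes x: "norm x = 1" and "lam > 0"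
    and eq: "\<And>s. singular_value (sphere 0 1) f x s \<Longrightarrow> s \<noteq> 0 \<Longrightarrow> s = lam"
  shows "pullback_op x (pullback_op x v) = lam\<^sup>2 *\<^sub>R pullback_op x v"
proof (rule self_adjoint_two_eigenvalues)
  have x0: "x \<noteq> 0" using x by auto
  show "linear (pullback_op x)" using linear_pullback_op[OF x0] .
  show "pullback_op x v \<bullet> w = v \<bullet> pullback_op x w" for v w
    using pullback_op_inner[OF x0] by (simp add: inner_commute)
  show "\<mu> = 0 \<or> \<mu> = lam\<^sup>2" if "v \<noteq> 0" "pullback_op x v = \<mu> *\<^sub>R v" for v \<mu>
  proof (cases "\<mu> = 0")
    case False
    have "\<mu> * (v \<bullet> v) = dir_deriv ext v x \<bullet> dir_deriv ext v x"
      using pullback_op_inner[OF x0, of v v] that by simp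
    then have "\<mu> * (v \<bullet> v) \<ge> 0" by simp
    moreover have "v \<bullet> v > 0" using that(1) by simp
    ultimately have \<mu>: "\<mu> > 0" using False by (simp add: zero_le_mult_iff)
    have "v \<in> singular_space (sphere 0 1) f x (sqrt \<mu>)"
      using \<mu> that(2) by (subst singular_space_eq[OF x]) auto
    then have "singular_value (sphere 0 1) f x (sqrt \<mu>)"
      using \<mu> that(1) unfolding singular_value_def by auto
    then have "sqrt \<mu> = lam" using eq \<mu> by simp
    then show ?thesis using \<mu> by auto
  qed simp
qed

text \<open>One factor B^T is cancelled on the left: z = B^T B v - lam^2 v is in the kernel of B^T
  B, and |B z|^2 = z . B^T B z = 0.\<close>

lemma D_pullback_op_eq:
  assumes x: "norm x = 1" and "lam > 0"
    and eq: "\<And>s. singular_value (sphere 0 1) f x s \<Longrightarrow> s \<noteq> 0 \<Longrightarrow> s = lam"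
  shows "dir_deriv ext (pullback_op x v) x = lam\<^sup>2 *\<^sub>R dir_deriv ext v x"
proof -
  have x0: "x \<noteq> 0" using x by auto
  interpret linear "\<lambda>v. dir_deriv ext v x" using D_linear[OF x0] .
  let ?z = "pullback_op x v - lam\<^sup>2 *\<^sub>R v"
  have "pullback_op x ?z = 0"
    using pullback_op_projection[OF assms] linear_pullback_op[OF x0] by (simp add: linear_diff linear_scale)
  then have "dir_deriv ext ?z x = 0"
    using pullback_op_inner[OF x0, of ?z ?z] by simp
  then show ?thesis by (simp add: diff scale)
qed

lemma sum_norm_D:
  assumes x: "norm x = 1" and "lam > 0"
    and eq: "\<And>s. singular_value (sphere 0 1) f x s \<Longrightarrow> s \<noteq> 0 \<Longrightarrow> s = lam"
  shows "(\<Sum>b\<in>Basis. (norm (dir_deriv ext b x))\<^sup>2) = lam\<^sup>2 * real (singular_multiplicity (sphere 0 1) f x lam)"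
proof -
  have x0: "x \<noteq> 0" using x by auto
  have "(\<Sum>b\<in>Basis. b \<bullet> pullback_op x b) = lam\<^sup>2 * real (dim {v. pullback_op x v = lam\<^sup>2 *\<^sub>R v})"
    by (rule trace_self_adjoint_projection[OF linear_pullback_op[OF x0] _ pullback_op_projection[OF assms]])
      (metis pullback_op_inner[OF x0] inner_commute)
  moreover have "b \<bullet> pullback_op x b = (norm (dir_deriv ext b x))\<^sup>2" for b
    using pullback_op_inner[OF x0, of b b] by (simp add: inner_commute dot_square_norm)
  ultimately show ?thesis
    using \<open>lam > 0\<close> by (simp add: singular_multiplicity_def singular_space_eq[OF x])
qed

end

subsection \<open>The Laplacian of a map with constant singular values\<close>

text \<open>The curvature computation needs the singular values only through these two identities, B
  B^T B = lam^2 B and trace(B^T B) = lam^2 p.\<close>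

locale constant_singular_map = sphere_map +
  fixes lam :: real and p :: nat
  assumes lam_pos: "lam > 0"
    and D_pullback: "norm x = 1 \<Longrightarrow> dir_deriv ext (pullback_op x v) x = lam\<^sup>2 *\<^sub>R dir_deriv ext v x"
    and energy_density: "norm x = 1 \<Longrightarrow> (\<Sum>b\<in>Basis. (norm (dir_deriv ext b x))\<^sup>2) = lam\<^sup>2 * real p"
begin

lemma D_homog: "t > 0 \<Longrightarrow> y \<noteq> 0 \<Longrightarrow> dir_deriv ext v (t *\<^sub>R y) = (1 / t) *\<^sub>R dir_deriv ext v y"
  using homogD[OF homog_dir_deriv[OF Cinf_ext homog_ext, of v], of t y] by (simp add: powr_neg_one')

lemma D_eq_radial: "y \<noteq> 0 \<Longrightarrow> dir_deriv ext v y = norm y powr (- 1) *\<^sub>R dir_deriv ext v (radial y)"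
  using D_homog[of "norm y" "radial y" v] unfolding norm_scale_radial by (simp add: powr_neg_one')

text \<open>The identity is about to be differentiated in all ambient directions and therefore must
  hold on an open set. Since B has degree -1, the left side has degree -3, which accounts for the
  factor r^(-2).\<close>

lemma D_pullback_off_sphere:
  assumes "y \<noteq> 0"
  shows "(\<Sum>b\<in>Basis. (dir_deriv ext b y \<bullet> dir_deriv ext v y) *\<^sub>R dir_deriv ext b y)
    = (lam\<^sup>2 * norm y powr (- 2)) *\<^sub>R dir_deriv ext v y"
proof -
  have 1: "norm (radial y) = 1" "radial y \<noteq> 0" using assms by simp_all
  let ?r = "norm y powr (- 1)"
  have r2: "?r * ?r = norm y powr (- 2)" by (simp flip: powr_add)
  have "(\<Sum>b\<in>Basis. (dir_deriv ext b y \<bullet> dir_deriv ext v y) *\<^sub>R dir_deriv ext b y)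
    = (?r * ?r * ?r) *\<^sub>R (\<Sum>b\<in>Basis. (dir_deriv ext b (radial y) \<bullet> dir_deriv ext v (radial y)) *\<^sub>R dir_deriv ext b (radial y))"
    unfolding D_eq_radial[OF assms] by (simp add: scaleR_sum_right algebra_simps)
  also have "\<dots> = (?r * ?r * ?r * lam\<^sup>2) *\<^sub>R dir_deriv ext v (radial y)"
    using D_pullback[OF 1(1), of v] by (simp add: D_pullback_op[OF 1(2)])
  also have "\<dots> = (lam\<^sup>2 * norm y powr (- 2)) *\<^sub>R dir_deriv ext v y"
    unfolding D_eq_radial[OF assms, of v] r2[symmetric] by (simp add: algebra_simps)
  finally show ?thesis .
qed

lemma energy_off_sphere:
  assumes "y \<noteq> 0"
  shows "(\<Sum>b\<in>Basis. dir_deriv ext b y \<bullet> dir_deriv ext b y) = (lam\<^sup>2 * real p) * norm y powr (- 2)"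
proof -
  let ?r = "norm y powr (- 1)"
  have r2: "?r * ?r = norm y powr (- 2)" by (simp flip: powr_add)
  have "(\<Sum>b\<in>Basis. dir_deriv ext b y \<bullet> dir_deriv ext b y)
    = (?r * ?r) * (\<Sum>b\<in>Basis. (norm (dir_deriv ext b (radial y)))\<^sup>2)"
    unfolding D_eq_radial[OF assms] by (simp add: sum_distrib_left dot_square_norm power2_eq_square algebra_simps)
  then show ?thesis using assms by (simp add: energy_density r2)
qed

text \<open>Up to the symmetry of second derivatives, the left side is half the b-derivative of the
  energy density lam^2 p r^(-2). The gradient is radial, so it vanishes once it is fed into
  B.\<close>

lemma gradient_energy:
  assumes x: "norm x = 1"
  shows "(\<Sum>c\<in>Basis. dir_deriv (dir_deriv ext b) c x \<bullet> dir_deriv ext c x) = - (lam\<^sup>2 * real p * (x \<bullet> b))"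
proof -
  have x0: "x \<in> - {0}" using x by auto
  note d = Cinf_on_differentiable[OF Cinf_on_dir_deriv[OF Cinf_ext] x0]
  have "2 * (\<Sum>c\<in>Basis. dir_deriv (dir_deriv ext b) c x \<bullet> dir_deriv ext c x)
    = (\<Sum>c\<in>Basis. dir_deriv (\<lambda>y. dir_deriv ext c y \<bullet> dir_deriv ext c y) b x)"
    unfolding sum_distrib_left
  proof (rule sum.cong[OF refl])
    fix c
    have "dir_deriv (dir_deriv ext b) c x = dir_deriv (dir_deriv ext c) b x" using D2_sym x0 by blast
    then show "2 * (dir_deriv (dir_deriv ext b) c x \<bullet> dir_deriv ext c x)
        = dir_deriv (\<lambda>y. dir_deriv ext c y \<bullet> dir_deriv ext c y) b x"
      by (simp only: dir_deriv_inner[OF d d]) (simp add: inner_commute)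
  qed
  also have "\<dots> = dir_deriv (\<lambda>y. \<Sum>c\<in>Basis. dir_deriv ext c y \<bullet> dir_deriv ext c y) b x"
    by (rule dir_deriv_sum[symmetric]) (intro Cinf_on_differentiable[OF _ x0] Cinf_intros open_minus_origin)
  also have "\<dots> = dir_deriv (\<lambda>y. (lam\<^sup>2 * real p) * norm y powr (- 2)) b x"
    by (rule dir_deriv_cong[OF _ x0]) (auto simp: energy_off_sphere)
  also have "\<dots> = (lam\<^sup>2 * real p) * dir_deriv (\<lambda>y. norm y powr (- 2)) b x"
    by (rule dir_deriv_linear_comp[OF bounded_linear_mult_right Cinf_on_differentiable[OF Cinf_on_norm_powr x0]])
  also have "dir_deriv (\<lambda>y. norm y powr (- 2)) b x = - 2 * (x \<bullet> b)"
    using dir_deriv_norm_powr[of x "- 2" b] x x0 by simp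
  finally have "2 * (\<Sum>c\<in>Basis. dir_deriv (dir_deriv ext b) c x \<bullet> dir_deriv ext c x)
    = 2 * - (lam\<^sup>2 * real p * (x \<bullet> b))" by (simp only: mult_ac)
  then show ?thesis by (simp only: mult_cancel_left) simp
qed

text \<open>The divergence of the identity \<open>D D\<^sup>T D = lam\<^sup>2 D\<close>: it expresses the trace of the Hessian over
  the nonzero singular space by the Laplacian, without choosing a frame of that space.\<close>

lemma hessian_trace_identity:
  assumes x: "norm x = 1"
  shows "(\<Sum>c\<in>Basis. \<Sum>b\<in>Basis. (dir_deriv ext b x \<bullet> dir_deriv ext c x) *\<^sub>R dir_deriv (dir_deriv ext b) c x)
    = lam\<^sup>2 *\<^sub>R vlap ext x - (\<Sum>b\<in>Basis. (dir_deriv ext b x \<bullet> vlap ext x) *\<^sub>R dir_deriv ext b x)"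
proof -
  have x0: "x \<in> - {0}" using x by auto
  note d = Cinf_on_differentiable[OF Cinf_on_dir_deriv[OF Cinf_ext] x0]
  let ?D = "\<lambda>b. dir_deriv ext b x" and ?H = "\<lambda>b c. dir_deriv (dir_deriv ext b) c x"
  have lin: "linear ?D" using D_linear x0 by simp
  have *: "(\<Sum>b\<in>Basis. (?D b \<bullet> ?D c) *\<^sub>R ?H b c + (?D b \<bullet> ?H c c + ?H b c \<bullet> ?D c) *\<^sub>R ?D b)
      = lam\<^sup>2 *\<^sub>R ?H c c - (2 * lam\<^sup>2 * (x \<bullet> c)) *\<^sub>R ?D c" for c
  proof -
    have "(\<Sum>b\<in>Basis. (?D b \<bullet> ?D c) *\<^sub>R ?H b c + (?D b \<bullet> ?H c c + ?H b c \<bullet> ?D c) *\<^sub>R ?D b)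
      = (\<Sum>b\<in>Basis. dir_deriv (\<lambda>y. (dir_deriv ext b y \<bullet> dir_deriv ext c y) *\<^sub>R dir_deriv ext b y) c x)"
      by (intro sum.cong refl, subst dir_deriv_scaleR)
        (auto intro!: Cinf_on_differentiable[OF _ x0] Cinf_intros simp: dir_deriv_inner d)
    also have "\<dots> = dir_deriv (\<lambda>y. \<Sum>b\<in>Basis. (dir_deriv ext b y \<bullet> dir_deriv ext c y) *\<^sub>R dir_deriv ext b y) c x"
      by (rule dir_deriv_sum[symmetric]) (intro Cinf_on_differentiable[OF _ x0] Cinf_intros open_minus_origin)
    also have "\<dots> = dir_deriv (\<lambda>y. (lam\<^sup>2 * norm y powr (- 2)) *\<^sub>R dir_deriv ext c y) c x"
      by (rule dir_deriv_cong[OF _ x0]) (auto simp: D_pullback_off_sphere)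
    also have "\<dots> = (lam\<^sup>2 * norm x powr (- 2)) *\<^sub>R ?H c c + dir_deriv (\<lambda>y. lam\<^sup>2 * norm y powr (- 2)) c x *\<^sub>R ?D c"
      by (rule dir_deriv_scaleR; intro Cinf_on_differentiable[OF _ x0] Cinf_intros open_minus_origin)
    also have "dir_deriv (\<lambda>y. lam\<^sup>2 * norm y powr (- 2)) c x = lam\<^sup>2 * dir_deriv (\<lambda>y. norm y powr (- 2)) c x"
      by (rule dir_deriv_linear_comp[OF bounded_linear_mult_right Cinf_on_differentiable[OF Cinf_on_norm_powr x0]])
    finally show ?thesis using x x0 by (simp add: dir_deriv_norm_powr)
  qed
  \<comment> \<open>Coefficients proportional to the components of x assemble to B x = 0. This
    removes both the derivative of the factor r^(-2) and the gradient of the energy density.\<close>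
  have radial0: "(\<Sum>c\<in>Basis. (r * (x \<bullet> c)) *\<^sub>R ?D c) = 0" for r
  proof -
    have "(\<Sum>c\<in>Basis. (r * (x \<bullet> c)) *\<^sub>R ?D c) = r *\<^sub>R (\<Sum>c\<in>Basis. (x \<bullet> c) *\<^sub>R ?D c)"
      by (simp add: scaleR_sum_right)
    then show ?thesis using x0 by (simp add: dir_deriv_basis_sum D_differentiable D_radial)
  qed
  have "(\<Sum>c\<in>Basis. \<Sum>b\<in>Basis. (?D b \<bullet> ?D c) *\<^sub>R ?H b c)
      + ((\<Sum>c\<in>Basis. \<Sum>b\<in>Basis. (?D b \<bullet> ?H c c) *\<^sub>R ?D b) + (\<Sum>c\<in>Basis. \<Sum>b\<in>Basis. (?H b c \<bullet> ?D c) *\<^sub>R ?D b))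
      = (\<Sum>c\<in>Basis. lam\<^sup>2 *\<^sub>R ?H c c - (2 * lam\<^sup>2 * (x \<bullet> c)) *\<^sub>R ?D c)"
    by (simp only: *[symmetric] sum.distrib scaleR_add_left)
  moreover have "(\<Sum>c\<in>Basis. \<Sum>b\<in>Basis. (?D b \<bullet> ?H c c) *\<^sub>R ?D b) = (\<Sum>b\<in>Basis. (?D b \<bullet> vlap ext x) *\<^sub>R ?D b)"
    by (subst sum.swap) (simp add: vlap_def inner_sum_right scaleR_sum_left)
  moreover have "(\<Sum>c\<in>Basis. \<Sum>b\<in>Basis. (?H b c \<bullet> ?D c) *\<^sub>R ?D b) = 0"
  proof -
    have "(\<Sum>c\<in>Basis. \<Sum>b\<in>Basis. (?H b c \<bullet> ?D c) *\<^sub>R ?D b) = (\<Sum>b\<in>Basis. (\<Sum>c\<in>Basis. ?H b c \<bullet> ?D c) *\<^sub>R ?D b)"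
      by (subst sum.swap) (simp add: scaleR_sum_left)
    also have "\<dots> = (\<Sum>b\<in>Basis. (- (lam\<^sup>2 * real p) * (x \<bullet> b)) *\<^sub>R ?D b)"
      by (simp add: gradient_energy[OF x])
    finally show ?thesis by (simp only: radial0)
  qed
  moreover have "(\<Sum>c\<in>Basis. lam\<^sup>2 *\<^sub>R ?H c c - (2 * lam\<^sup>2 * (x \<bullet> c)) *\<^sub>R ?D c) = lam\<^sup>2 *\<^sub>R vlap ext x"
    by (simp only: sum_subtractf radial0) (simp add: vlap_def scaleR_sum_right)
  ultimately show ?thesis by (simp add: algebra_simps)
qed

end

subsection \<open>The geometry of Lawson-Osserman spheres\<close>

locale LO_map = sphere_map +
  fixes c s :: real
  assumes c_pos: "c > 0" and s_pos: "s > 0" and cs: "c\<^sup>2 + s\<^sup>2 = 1"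
begin

text \<open>Also constant along rays, so curves in the submanifold can be parametrised by straight
  lines x + t u without normalisation.\<close>

definition LO :: "'a \<Rightarrow> 'a \<times> 'b" where
  "LO y = (c *\<^sub>R radial y, s *\<^sub>R ext y)"

abbreviation "LO_sphere \<equiv> LO ` sphere 0 1"

lemma Cinf_LO [Cinf_intros]: "Cinf_on LO (- {0})"
  unfolding LO_def[abs_def] by (intro Cinf_intros open_minus_origin)

lemma LO_eq: "norm x = 1 \<Longrightarrow> LO x = (c *\<^sub>R x, s *\<^sub>R f x)"
  by (simp add: LO_def)

lemma LO_radial: "y \<noteq> 0 \<Longrightarrow> LO (radial y) = LO y"
  by (simp add: LO_def ext_def)

lemma LO_in: "y \<noteq> 0 \<Longrightarrow> LO y \<in> LO_sphere"
  by (metis LO_radial imageI mem_sphere_0 norm_radial)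

lemma LO_inner_self: "y \<noteq> 0 \<Longrightarrow> LO y \<bullet> LO y = 1"
  using cs by (simp add: LO_def inner_prod_def dot_square_norm power2_eq_square)

lemma dir_deriv_LO:
  assumes "y \<noteq> 0"
  shows "dir_deriv LO v y = (c *\<^sub>R dir_deriv radial v y, s *\<^sub>R dir_deriv ext v y)"
proof (rule dir_deriv_eqI)
  show "(LO has_derivative (\<lambda>v. (c *\<^sub>R dir_deriv radial v y, s *\<^sub>R dir_deriv ext v y))) (at y)"
    unfolding LO_def[abs_def] using assms
    by (intro has_derivative_Pair has_derivative_scaleR_right Cinf_on_has_derivative[OF Cinf_ext]
        Cinf_on_has_derivative[OF Cinf_on_radial]) auto
qed

lemma dir_deriv2_LO:
  assumes "y \<noteq> 0"
  shows "dir_deriv (dir_deriv LO w) u y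
    = (c *\<^sub>R dir_deriv (dir_deriv radial w) u y, s *\<^sub>R dir_deriv (dir_deriv ext w) u y)"
proof -
  have y: "y \<in> - {0}" using assms by simp
  have "dir_deriv (dir_deriv LO w) u y = dir_deriv (\<lambda>y. (c *\<^sub>R dir_deriv radial w y, s *\<^sub>R dir_deriv ext w y)) u y"
    by (rule dir_deriv_cong[OF _ y]) (auto simp: dir_deriv_LO)
  also have "\<dots> = (c *\<^sub>R dir_deriv (dir_deriv radial w) u y, s *\<^sub>R dir_deriv (dir_deriv ext w) u y)"
    by (rule dir_deriv_eqI)
      (intro has_derivative_Pair has_derivative_scaleR_right Cinf_on_has_derivative[OF _ y] Cinf_intros)
  finally show ?thesis .
qed

lemma dir_deriv_LO_sphere:
  assumes "norm x = 1"
  shows "dir_deriv LO v x = (c *\<^sub>R (v - (v \<bullet> x) *\<^sub>R x), s *\<^sub>R dir_deriv ext v x)"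
proof -
  have "x \<noteq> 0" using assms by auto
  then show ?thesis using assms by (simp add: dir_deriv_LO dir_deriv_radial inner_commute)
qed

lemma linear_dir_deriv_LO: "y \<noteq> 0 \<Longrightarrow> linear (\<lambda>v. dir_deriv LO v y)"
  using linear_dir_deriv Cinf_on_differentiable[OF Cinf_LO] by blast

lemma dir_deriv_LO_tangential:
  assumes "norm x = 1"
  shows "dir_deriv LO (v - (v \<bullet> x) *\<^sub>R x) x = dir_deriv LO v x"
proof -
  have x0: "x \<noteq> 0" using assms by auto
  have "dir_deriv LO x x = 0"
    using assms x0 by (simp add: dir_deriv_LO_sphere D_radial dot_square_norm zero_prod_def)
  then show ?thesis
    using linear_diff[OF linear_dir_deriv_LO[OF x0]] linear_scale[OF linear_dir_deriv_LO[OF x0]] by simp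
qed

lemma inner_LO_tangent:
  assumes "norm x = 1" shows "LO x \<bullet> dir_deriv LO v x = 0"
proof -
  have "x \<noteq> 0" using assms by auto
  then have "f x \<bullet> dir_deriv ext v x = 0" using D_orth[of x v] assms by simp
  then show ?thesis using assms
    by (simp add: LO_eq dir_deriv_LO_sphere inner_prod_def inner_diff_right inner_commute dot_square_norm)
qed

lemma line_nonzero:
  assumes "norm x = 1" "u \<bullet> x = 0" shows "x + t *\<^sub>R u \<noteq> 0"
proof
  assume "x + t *\<^sub>R u = 0"
  then have "(x + t *\<^sub>R u) \<bullet> x = 0" by simp
  then show False using assms by (simp add: inner_add_left dot_square_norm)
qed

lemma LO_curve:
  assumes "norm x = 1" "u \<bullet> x = 0"
  shows "Cinf_on (\<lambda>t. LO (x + t *\<^sub>R u)) UNIV" "dir_deriv (\<lambda>t. LO (x + t *\<^sub>R u)) 1 0 = dir_deriv LO u x"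
    "range (\<lambda>t. LO (x + t *\<^sub>R u)) \<subseteq> LO_sphere"
proof -
  note nz = line_nonzero[OF assms]
  show "Cinf_on (\<lambda>t. LO (x + t *\<^sub>R u)) UNIV"
    by (rule Cinf_on_compose[of UNIV "-{0}"]) (use nz in \<open>auto intro!: Cinf_intros\<close>)
  have "dir_deriv (\<lambda>t. LO (x + t *\<^sub>R u)) 1 0 = dir_deriv LO (dir_deriv (\<lambda>t. x + t *\<^sub>R u) 1 0) (x + 0 *\<^sub>R u)"
    by (rule dir_deriv_compose[where g = LO])
      (use nz[of 0] in \<open>auto intro!: derivative_intros Cinf_on_differentiable[OF Cinf_LO]\<close>)
  also have "dir_deriv (\<lambda>t::real. x + t *\<^sub>R u) 1 0 = 1 *\<^sub>R u"
    by (rule dir_deriv_eqI) (auto intro!: derivative_eq_intros)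
  finally show "dir_deriv (\<lambda>t. LO (x + t *\<^sub>R u)) 1 0 = dir_deriv LO u x" by simp
  show "range (\<lambda>t. LO (x + t *\<^sub>R u)) \<subseteq> LO_sphere" using LO_in nz by blast
qed

text \<open>The submanifold is the graph of s \<open>ext\<close> over the sphere of radius c; these
  equations serve both as defining submersion and for the computation of tangent vectors.\<close>

lemma LO_sphere_iff: "q \<in> LO_sphere \<longleftrightarrow> fst q \<noteq> 0 \<and> fst q \<bullet> fst q = c\<^sup>2 \<and> snd q = s *\<^sub>R ext (fst q)"
proof
  assume "q \<in> LO_sphere"
  then obtain x where x: "norm x = 1" "q = LO x" by auto
  then have "x \<noteq> 0" by auto
  with x c_pos show "fst q \<noteq> 0 \<and> fst q \<bullet> fst q = c\<^sup>2 \<and> snd q = s *\<^sub>R ext (fst q)"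
    by (simp add: LO_eq ext_scale dot_square_norm power2_eq_square)
next
  assume q: "fst q \<noteq> 0 \<and> fst q \<bullet> fst q = c\<^sup>2 \<and> snd q = s *\<^sub>R ext (fst q)"
  then have n: "norm (fst q) = c" using c_pos by (simp add: norm_eq_sqrt_inner)
  then have "LO (fst q) = q" using q c_pos
    by (simp add: LO_def radial_def powr_neg_one' prod_eq_iff)
  then show "q \<in> LO_sphere" using LO_in q by metis
qed

text \<open>One inclusion differentiates the two graph equations along a curve; the other uses the
  images of straight lines after removing the radial part of v.\<close>

lemma tangent_space_LO:
  assumes x: "norm x = 1"
  shows "tangent_space LO_sphere (LO x) = range (\<lambda>v. dir_deriv LO v x)"
proof (intro set_eqI iffI)
  have x0: "x \<noteq> 0" using x by auto
  fix v assume "v \<in> tangent_space LO_sphere (LO x)"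
  then obtain \<gamma> :: "real \<Rightarrow> 'a \<times> 'b" and \<epsilon> where \<gamma>: "\<epsilon> > 0" "\<gamma> ` {-\<epsilon><..<\<epsilon>} \<subseteq> LO_sphere"
    "\<gamma> 0 = LO x" "(\<gamma> has_vector_derivative v) (at 0)" unfolding tangent_space_def by auto
  have I: "open {-\<epsilon><..<\<epsilon>}" "0 \<in> {-\<epsilon><..<\<epsilon>}" using \<gamma>(1) by auto
  have on: "fst (\<gamma> t) \<bullet> fst (\<gamma> t) = c\<^sup>2" "snd (\<gamma> t) = s *\<^sub>R ext (fst (\<gamma> t))" if "t \<in> {-\<epsilon><..<\<epsilon>}" for t
    using \<gamma>(2) that LO_sphere_iff by blast+
  have f: "((\<lambda>t. fst (\<gamma> t)) has_vector_derivative fst v) (at 0)"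
    using bounded_linear.has_vector_derivative[OF bounded_linear_fst \<gamma>(4)] .
  have sn: "((\<lambda>t. snd (\<gamma> t)) has_vector_derivative snd v) (at 0)"
    using bounded_linear.has_vector_derivative[OF bounded_linear_snd \<gamma>(4)] .
  have \<gamma>0: "fst (\<gamma> 0) = c *\<^sub>R x" using \<gamma>(3) LO_eq[OF x] by simp
  have "((\<lambda>t. fst (\<gamma> t) \<bullet> fst (\<gamma> t)) has_vector_derivative (c *\<^sub>R x \<bullet> fst v + fst v \<bullet> c *\<^sub>R x)) (at 0)"
    using bounded_bilinear.has_vector_derivative[OF bounded_bilinear_inner f f] \<gamma>0 by simp
  moreover have "((\<lambda>t. fst (\<gamma> t) \<bullet> fst (\<gamma> t)) has_vector_derivative 0) (at 0)"
    by (rule has_vector_derivative_transform_within_open[OF has_vector_derivative_const[of "c\<^sup>2"] I])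
      (simp only: on)
  ultimately have "c *\<^sub>R x \<bullet> fst v + fst v \<bullet> c *\<^sub>R x = 0" using vector_derivative_unique_at by blast
  then have fv: "fst v \<bullet> x = 0" using c_pos by (simp add: inner_commute)
  have "(ext has_derivative (\<lambda>v. dir_deriv ext v (c *\<^sub>R x))) (at (fst (\<gamma> 0)) within UNIV)"
    using Cinf_on_has_derivative[OF Cinf_ext, of "c *\<^sub>R x"] c_pos x0 \<gamma>0 by simp
  from has_vector_derivative_compose_within[OF this f zero_less_one]
  have "((\<lambda>t. ext (fst (\<gamma> t))) has_vector_derivative dir_deriv ext (fst v) (c *\<^sub>R x)) (at 0)" by simp
  from bounded_linear.has_vector_derivative[OF bounded_linear_scaleR_right[of s] this]
  have "((\<lambda>t. snd (\<gamma> t)) has_vector_derivative s *\<^sub>R dir_deriv ext (fst v) (c *\<^sub>R x)) (at 0)"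
    by (rule has_vector_derivative_transform_within_open[OF _ I]) (simp only: on)
  then have sv: "snd v = s *\<^sub>R dir_deriv ext (fst v) (c *\<^sub>R x)" using sn vector_derivative_unique_at by blast
  \<comment> \<open>The first component of the base point is c x rather than x; degree -1 of the
    derivative produces the factor 1 / c.\<close>
  have "dir_deriv ext (fst v) (c *\<^sub>R x) = dir_deriv ext ((1 / c) *\<^sub>R fst v) x"
    using homogD[OF homog_dir_deriv[OF Cinf_ext homog_ext, of "fst v"] c_pos x0] c_pos
      linear_scale[OF D_linear[OF x0]] by (simp add: powr_neg_one')
  then have "v = dir_deriv LO ((1 / c) *\<^sub>R fst v) x"
    using sv fv c_pos x by (simp add: dir_deriv_LO_sphere prod_eq_iff)
  then show "v \<in> range (\<lambda>v. dir_deriv LO v x)" by blast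
next
  fix w assume "w \<in> range (\<lambda>v. dir_deriv LO v x)"
  then obtain v where v: "w = dir_deriv LO v x" by blast
  let ?u = "v - (v \<bullet> x) *\<^sub>R x"
  have u: "?u \<bullet> x = 0" using x by (simp add: inner_diff_left dot_square_norm)
  have "dir_deriv LO ?u x \<in> tangent_space LO_sphere (LO x)"
    by (rule tangent_spaceI[OF LO_curve(1,3)[OF x u] _ LO_curve(2)[OF x u]]) simp
  then show "w \<in> tangent_space LO_sphere (LO x)" using v dir_deriv_LO_tangential[OF x] by metis
qed

text \<open>Recovers the vector tangent to the sphere that is mapped to e, by rescaling the first
  component. Frames of the submanifold are thereby read as systems of vectors orthogonal to
  x.\<close>

lemma tangent_LO_eq:
  assumes x: "norm x = 1" and "e \<in> tangent_space LO_sphere (LO x)"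
  shows "fst e \<bullet> x = 0" "dir_deriv LO ((1 / c) *\<^sub>R fst e) x = e"
proof -
  have x0: "x \<noteq> 0" using x by auto
  obtain v where v: "e = dir_deriv LO v x" using assms(2) tangent_space_LO[OF x] by blast
  show "fst e \<bullet> x = 0" using x by (simp add: v dir_deriv_LO_sphere inner_diff_left dot_square_norm)
  have "(1 / c) *\<^sub>R fst e = v - (v \<bullet> x) *\<^sub>R x" using x c_pos by (simp add: v dir_deriv_LO_sphere)
  then show "dir_deriv LO ((1 / c) *\<^sub>R fst e) x = e" using dir_deriv_LO_tangential[OF x] v by simp
qed

lemma normal_space_LO:
  assumes x: "norm x = 1"
  shows "normal_space LO_sphere (sphere 0 1) (LO x)
    = {\<nu>. \<nu> \<bullet> LO x = 0 \<and> (\<forall>v. \<nu> \<bullet> dir_deriv LO v x = 0)}"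
proof -
  have "x \<noteq> 0" using x by auto
  then have "norm (LO x) = 1" using LO_inner_self by (simp add: norm_eq_sqrt_inner)
  then show ?thesis by (auto simp: normal_space_def tangent_space_sphere tangent_space_LO[OF x])
qed

lemma subspace_normal_LO:
  assumes x: "norm x = 1"
  shows "subspace (normal_space LO_sphere (sphere 0 1) (LO x))"
  unfolding normal_space_LO[OF x] by (rule subspaceI) (simp_all add: inner_add_left)

text \<open>Along the curve \<open>LO (x + t u)\<close> a tangent field is \<open>norm y * dir_deriv LO \<xi> y\<close> with
  \<open>\<xi>\<close> read off from its first component; the derivative of \<open>\<xi>\<close> contributes only
  tangential terms.\<close>

lemma tangent_field_normal_derivative:
  assumes x: "norm x = 1" and u: "u \<bullet> x = 0" and w: "w \<bullet> x = 0"
    and X: "tangent_field LO_sphere X" "X (LO x) = dir_deriv LO w x"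
    and \<nu>: "\<And>v. \<nu> \<bullet> dir_deriv LO v x = 0"
  shows "differential LO_sphere X (LO x) (dir_deriv LO u x) \<bullet> \<nu> = dir_deriv (dir_deriv LO w) u x \<bullet> \<nu>"
proof -
  have x0: "x \<in> - {0}" using x by auto
  have smX: "smooth_on LO_sphere X" using X(1) by (simp add: tangent_field_def)
  have "LO x \<in> LO_sphere" using x by simp
  then obtain D where D: "(X has_derivative D) (at (LO x) within LO_sphere)"
    using smooth_on_has_derivative_within[OF smX] by blast
  have Dd: "differential LO_sphere X (LO x) (dir_deriv LO u x) = D (dir_deriv LO u x)"
    by (rule differential_eq[OF D]) (use tangent_space_LO[OF x] in blast)
  define y where "y t = x + t *\<^sub>R u" for t :: real
  define \<gamma> where "\<gamma> t = LO (y t)" for t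
  have ynz: "y t \<noteq> 0" for t unfolding y_def by (rule line_nonzero[OF x u])
  have y0: "y 0 = x" by (simp add: y_def)
  have \<gamma>': "(\<gamma> has_vector_derivative dir_deriv LO u x) (at 0)"
    using Cinf_on_has_vector_derivative[OF LO_curve(1)[OF x u], of 0] LO_curve(2)[OF x u]
    by (simp add: \<gamma>_def[abs_def] y_def)
  have "\<gamma> ` {-1<..<1} \<subseteq> LO_sphere" using LO_in ynz by (auto simp: \<gamma>_def)
  from has_vector_derivative_compose_within[of X D \<gamma>, OF _ \<gamma>' zero_less_one this] D
  have X\<gamma>: "((\<lambda>t. X (\<gamma> t)) has_vector_derivative D (dir_deriv LO u x)) (at 0)"
    by (simp add: \<gamma>_def y0)
  define \<xi> where "\<xi> t = (1 / c) *\<^sub>R fst (X (\<gamma> t))" for t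
  have \<xi>': "(\<xi> has_vector_derivative (1 / c) *\<^sub>R fst (D (dir_deriv LO u x))) (at 0)"
    unfolding \<xi>_def[abs_def]
    by (intro bounded_linear.has_vector_derivative[OF bounded_linear_scaleR_right]
        bounded_linear.has_vector_derivative[OF bounded_linear_fst] X\<gamma>)
  have \<xi>0: "\<xi> 0 = w" using X(2) x w c_pos by (simp add: \<xi>_def \<gamma>_def y0 dir_deriv_LO_sphere)
  define G where "G b z = norm z powr 1 * (dir_deriv LO b z \<bullet> \<nu>)" for b z
  have CG: "Cinf_on (G b) (- {0})" for b
    unfolding G_def[abs_def] by (intro Cinf_intros open_minus_origin)
  have Gx: "G b x = 0" for b using \<nu> by (simp add: G_def inner_commute)
  have lin2: "linear (\<lambda>v. dir_deriv (dir_deriv LO v) u x)"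
    by (rule dir_deriv_dir_linear[OF _ x0 Cinf_LO]) simp
  have G': "dir_deriv (G b) u x = dir_deriv (dir_deriv LO b) u x \<bullet> \<nu>" for b
  proof -
    have "dir_deriv (G b) u x = norm x powr 1 * dir_deriv (\<lambda>z. dir_deriv LO b z \<bullet> \<nu>) u x
      + dir_deriv (\<lambda>z. norm z powr 1) u x * (dir_deriv LO b x \<bullet> \<nu>)"
      unfolding G_def[abs_def]
      by (rule dir_deriv_mult; intro Cinf_on_differentiable[OF _ x0] Cinf_intros open_minus_origin)
    also have "dir_deriv (\<lambda>z. dir_deriv LO b z \<bullet> \<nu>) u x = dir_deriv (dir_deriv LO b) u x \<bullet> \<nu>"
      by (rule dir_deriv_linear_comp[OF bounded_linear_inner_left
            Cinf_on_differentiable[OF Cinf_on_dir_deriv[OF Cinf_LO] x0]])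
    finally show ?thesis using x \<nu> by (simp add: inner_commute)
  qed
  have Gy: "((\<lambda>t. G b (y t)) has_vector_derivative dir_deriv (dir_deriv LO b) u x \<bullet> \<nu>) (at 0)" for b
  proof -
    have "(G b has_derivative (\<lambda>v. dir_deriv (G b) v x)) (at (y 0) within UNIV)"
      using Cinf_on_has_derivative[OF CG x0] by (simp add: y0)
    moreover have "(y has_vector_derivative u) (at 0)"
      unfolding y_def[abs_def] by (auto intro!: derivative_eq_intros)
    ultimately have "((\<lambda>t. G b (y t)) has_vector_derivative dir_deriv (G b) u x) (at 0)"
      using has_vector_derivative_compose_within[of "G b" _ y UNIV u 1] by simp
    then show ?thesis by (simp only: G')
  qed
  have rep: "X (\<gamma> t) \<bullet> \<nu> = (\<Sum>b\<in>Basis. (\<xi> t \<bullet> b) * G b (y t))" for t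
  proof -
    let ?z = "radial (y t)"
    have z: "norm ?z = 1" using ynz by simp
    have gz: "\<gamma> t = LO ?z" using LO_radial[OF ynz] by (simp add: \<gamma>_def)
    have "X (\<gamma> t) \<in> tangent_space LO_sphere (LO ?z)"
      using X(1) z unfolding tangent_field_def gz by auto
    from tangent_LO_eq(2)[OF z this] have "X (\<gamma> t) = dir_deriv LO (\<xi> t) ?z" by (simp add: \<xi>_def)
    also have "\<dots> = norm (y t) *\<^sub>R dir_deriv LO (\<xi> t) (y t)"
    proof -
      have "homog 0 LO" by (simp add: homog_def LO_def radial_scale ext_scale)
      from homogD[OF homog_dir_deriv[OF Cinf_LO this, of "\<xi> t"], of "norm (y t) powr (- 1)" "y t"]
      show ?thesis using ynz[of t] by (simp add: radial_def powr_neg_one')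
    qed
    also have "\<dots> = norm (y t) *\<^sub>R (\<Sum>b\<in>Basis. (\<xi> t \<bullet> b) *\<^sub>R dir_deriv LO b (y t))"
      using dir_deriv_basis_sum[OF Cinf_on_differentiable[OF Cinf_LO]] ynz by simp
    finally show ?thesis
      by (simp add: G_def inner_sum_left sum_distrib_left algebra_simps)
  qed
  have "((\<lambda>t. X (\<gamma> t) \<bullet> \<nu>) has_vector_derivative D (dir_deriv LO u x) \<bullet> \<nu>) (at 0)"
    by (rule bounded_linear.has_vector_derivative[OF bounded_linear_inner_left X\<gamma>])
  moreover have "((\<lambda>t. X (\<gamma> t) \<bullet> \<nu>) has_vector_derivative
     (\<Sum>b\<in>Basis. (\<xi> 0 \<bullet> b) * (dir_deriv (dir_deriv LO b) u x \<bullet> \<nu>) + ((1 / c) *\<^sub>R fst (D (dir_deriv LO u x)) \<bullet> b) * G b (y 0))) (at 0)"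
    unfolding rep
    by (intro has_vector_derivative_sum bounded_bilinear.has_vector_derivative[OF bounded_bilinear_mult]
        bounded_linear.has_vector_derivative[OF bounded_linear_inner_left] Gy \<xi>')
  ultimately have "D (dir_deriv LO u x) \<bullet> \<nu> = (\<Sum>b\<in>Basis. (w \<bullet> b) * (dir_deriv (dir_deriv LO b) u x \<bullet> \<nu>))"
    using vector_derivative_unique_at by (fastforce simp: \<xi>0 y0 Gx)
  also have "\<dots> = dir_deriv (dir_deriv LO w) u x \<bullet> \<nu>"
  proof -
    have "dir_deriv (dir_deriv LO w) u x = dir_deriv (dir_deriv LO (\<Sum>b\<in>Basis. (w \<bullet> b) *\<^sub>R b)) u x"
      by (simp add: euclidean_representation)
    also have "\<dots> = (\<Sum>b\<in>Basis. (w \<bullet> b) *\<^sub>R dir_deriv (dir_deriv LO b) u x)"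
      by (simp add: linear_sum[OF lin2] linear_scale[OF lin2])
    finally show ?thesis by (simp add: inner_sum_left)
  qed
  finally show ?thesis by (simp only: Dd)
qed

text \<open>The push-forward of the constant direction w, with the parameter recovered from the
  first component; it supplies the extension whose existence \<open>second_fundamental_form\<close>
  requires.\<close>

lemma tangent_field_exists:
  "tangent_field LO_sphere (\<lambda>q. dir_deriv LO w ((1 / c) *\<^sub>R fst q))"
  unfolding tangent_field_def
proof (intro conjI ballI)
  let ?U = "fst -` (- {0}) :: ('a \<times> 'b) set"
  have op: "open ?U" by (intro open_vimage continuous_intros)
  have "Cinf_on (\<lambda>q::'a \<times> 'b. dir_deriv LO w ((1 / c) *\<^sub>R fst q)) ?U"
    by (rule Cinf_on_compose[OF op open_minus_origin]) (use c_pos in \<open>auto intro!: Cinf_intros op\<close>)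
  moreover have "LO_sphere \<subseteq> ?U" using LO_sphere_iff by blast
  ultimately show "smooth_on LO_sphere (\<lambda>q. dir_deriv LO w ((1 / c) *\<^sub>R fst q))"
    using Cinf_on_imp_smooth_on[OF op] by blast
  fix q assume "q \<in> LO_sphere"
  then obtain x where x: "norm x = 1" "q = LO x" by auto
  then have "(1 / c) *\<^sub>R fst q = x" using c_pos by (simp add: LO_eq)
  then show "dir_deriv LO w ((1 / c) *\<^sub>R fst q) \<in> tangent_space LO_sphere q"
    unfolding x(2) tangent_space_LO[OF x(1)] by simp
qed

text \<open>The description by \<open>THE\<close> is justified here: an extension exists, and the
  normal part of its derivative does not depend on the extension.\<close>

lemma second_fundamental_form_LO:
  assumes x: "norm x = 1" and u: "u \<bullet> x = 0" and w: "w \<bullet> x = 0"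
  shows "second_fundamental_form LO_sphere (sphere 0 1) (LO x) (dir_deriv LO u x) (dir_deriv LO w x)
    = orth_proj (normal_space LO_sphere (sphere 0 1) (LO x)) (dir_deriv (dir_deriv LO w) u x)"
proof -
  let ?N = "normal_space LO_sphere (sphere 0 1) (LO x)"
  have *: "orth_proj ?N (differential LO_sphere X (LO x) (dir_deriv LO u x))
      = orth_proj ?N (dir_deriv (dir_deriv LO w) u x)"
    if X: "tangent_field LO_sphere X" "X (LO x) = dir_deriv LO w x" for X
    by (rule orth_proj_cong[OF subspace_normal_LO[OF x]])
      (rule tangent_field_normal_derivative[OF x u w X], simp add: normal_space_LO[OF x])
  let ?X = "\<lambda>q. dir_deriv LO w ((1 / c) *\<^sub>R fst q)"
  have X: "tangent_field LO_sphere ?X" "?X (LO x) = dir_deriv LO w x"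
    using tangent_field_exists c_pos x by (simp_all add: LO_eq)
  show ?thesis unfolding second_fundamental_form_def
  proof (rule the_equality)
    show "\<exists>X. tangent_field LO_sphere X \<and> X (LO x) = dir_deriv LO w x \<and>
        orth_proj ?N (dir_deriv (dir_deriv LO w) u x) = orth_proj ?N (differential LO_sphere X (LO x) (dir_deriv LO u x))"
      using X *[OF X] by (intro exI[of _ ?X]) simp
  qed (use * in blast)
qed

text \<open>The definition wants a map of the ambient space into itself with values in a subspace W.
  The scalar equation |a|^2 = c^2 is therefore placed on the line through a basis vector e, and W is
  that line times the second factor, of dimension 1 + DIM('b).\<close>

lemma embedded_submanifold_LO:
  assumes "DIM('a) = n + 1"
  shows "embedded_submanifold n LO_sphere"
proof -
  obtain e :: 'a where e: "e \<in> Basis" using nonempty_Basis by blast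
  let ?U = "fst -` (- {0}) :: ('a \<times> 'b) set"
  let ?W = "span {e} \<times> UNIV :: ('a \<times> 'b) set"
  define G where "G q = ((fst q \<bullet> fst q - c\<^sup>2) *\<^sub>R e, snd q - s *\<^sub>R ext (fst q))" for q :: "'a \<times> 'b"
  have op: "open ?U" by (intro open_vimage continuous_intros)
  have CG: "Cinf_on G ?U" unfolding G_def[abs_def]
    by (intro Cinf_intros op Cinf_on_compose[of ?U "-{0}" fst ext] open_minus_origin Cinf_on_bounded_linear)
      (auto intro: bounded_linear_fst bounded_linear_snd)
  have "e \<noteq> 0" using e nonzero_Basis by blast
  then have "dim (span {e}) = 1" by simp
  then have dimW: "dim ?W + n = DIM('a \<times> 'b)"
    using assms by (simp add: dim_Times del: dim_span)
  have zero: "LO_sphere \<inter> ?U = {q \<in> ?U. G q = 0}"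
    using \<open>e \<noteq> 0\<close> unfolding set_eq_iff Int_iff LO_sphere_iff G_def zero_prod_def by auto
  have range: "range (frechet_derivative G (at q)) = ?W" if q: "q \<in> LO_sphere" for q
  proof -
    have q': "fst q \<noteq> 0" "fst q \<bullet> fst q = c\<^sup>2" using q LO_sphere_iff by blast+
    have ext': "((\<lambda>q. ext (fst q)) has_derivative (\<lambda>v. dir_deriv ext (fst v) (fst q))) (at q)"
      using diff_chain_at[OF bounded_linear_imp_has_derivative[OF bounded_linear_fst]
          has_derivative_dir_deriv[OF D_differentiable[OF q'(1)]]] by (simp add: o_def)
    have "(G has_derivative (\<lambda>v. ((2 * (fst q \<bullet> fst v)) *\<^sub>R e, snd v - s *\<^sub>R dir_deriv ext (fst v) (fst q)))) (at q)"
      unfolding G_def[abs_def]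
      by (rule derivative_eq_intros ext' refl | simp add: inner_commute)+
    from frechet_derivative_at[OF this]
    have fd: "frechet_derivative G (at q) = (\<lambda>v. ((2 * (fst q \<bullet> fst v)) *\<^sub>R e, snd v - s *\<^sub>R dir_deriv ext (fst v) (fst q)))"
      by simp
    show ?thesis
    proof (intro equalityI subsetI)
      fix z assume "z \<in> ?W"
      then have "fst z \<in> range (\<lambda>r. r *\<^sub>R e)" by (auto simp: span_singleton)
      then obtain r where r: "fst z = r *\<^sub>R e" by blast
      \<comment> \<open>A radial displacement of the first component solves the scalar part; the
        second component of the preimage then compensates for its effect on
        \<open>ext\<close>.\<close>
      define a where "a = (r / (2 * c\<^sup>2)) *\<^sub>R fst q"
      have "2 * (fst q \<bullet> a) = r" using q'(2) c_pos by (simp add: a_def)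
      then have "z = frechet_derivative G (at q) (a, snd z + s *\<^sub>R dir_deriv ext a (fst q))"
        by (simp add: fd r prod_eq_iff)
      then show "z \<in> range (frechet_derivative G (at q))" by blast
    qed (auto simp: fd span_singleton)
  qed
  show ?thesis unfolding embedded_submanifold_def
  proof
    fix q assume q: "q \<in> LO_sphere"
    have "q \<in> ?U" using q LO_sphere_iff by blast
    moreover have "subspace ?W" by (simp add: subspace_Times)
    moreover have "smooth_on ?U G" using Cinf_on_imp_smooth_on[OF op CG] by simp
    moreover have "G ` ?U \<subseteq> ?W" by (auto simp: G_def span_singleton)
    moreover have "\<forall>q\<in>LO_sphere \<inter> ?U. range (frechet_derivative G (at q)) = ?W" using range by blast
    ultimately show "\<exists>U W (G :: 'a \<times> 'b \<Rightarrow> 'a \<times> 'b). open U \<and> q \<in> U \<and> subspace W \<and> dim W + n = DIM('a \<times> 'b) \<and>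
        smooth_on U G \<and> G ` U \<subseteq> W \<and> LO_sphere \<inter> U = {q \<in> U. G q = 0} \<and>
        (\<forall>q\<in>LO_sphere \<inter> U. range (frechet_derivative G (at q)) = W)"
      using op dimW zero by blast
  qed
qed

lemma LO_sphere_subset: "LO_sphere \<subseteq> sphere 0 1"
proof -
  have "norm (LO x) = 1" if "norm x = 1" for x
  proof -
    have "x \<noteq> 0" using that by auto
    then show ?thesis using LO_inner_self by (simp add: norm_eq_sqrt_inner)
  qed
  then show ?thesis by auto
qed

text \<open>Projections onto the normal space add up, and a projection vanishes exactly when its
  argument is orthogonal to all normal vectors. The mean curvature thus needs to be known only up to
  tangent vectors and multiples of the position.\<close>

lemma minimal_LO_iff:
  "minimal_submanifold LO_sphere (sphere 0 1) \<longleftrightarrow>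
    (\<forall>x. norm x = 1 \<longrightarrow> (\<forall>E. orthonormal_basis_of (range (\<lambda>v. dir_deriv LO v x)) E \<longrightarrow>
      (\<forall>\<nu>. \<nu> \<bullet> LO x = 0 \<longrightarrow> (\<forall>v. \<nu> \<bullet> dir_deriv LO v x = 0) \<longrightarrow>
        (\<Sum>e\<in>E. dir_deriv (dir_deriv LO ((1 / c) *\<^sub>R fst e)) ((1 / c) *\<^sub>R fst e) x) \<bullet> \<nu> = 0)))"
proof -
  have emb: "\<exists>d. embedded_submanifold d LO_sphere"
    using embedded_submanifold_LO[of "DIM('a) - 1"] DIM_positive[where 'a = 'a] by (metis Suc_diff_1 Suc_eq_plus1)
  have "(\<Sum>e\<in>E. second_fundamental_form LO_sphere (sphere 0 1) (LO x) e e) = 0 \<longleftrightarrow>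
      (\<forall>\<nu>. \<nu> \<bullet> LO x = 0 \<longrightarrow> (\<forall>v. \<nu> \<bullet> dir_deriv LO v x = 0) \<longrightarrow>
        (\<Sum>e\<in>E. dir_deriv (dir_deriv LO ((1 / c) *\<^sub>R fst e)) ((1 / c) *\<^sub>R fst e) x) \<bullet> \<nu> = 0)"
    if x: "norm x = 1" and E': "orthonormal_basis_of (range (\<lambda>v. dir_deriv LO v x)) E" for x E
  proof -
    note E = E'[folded tangent_space_LO[OF x]]
    have "second_fundamental_form LO_sphere (sphere 0 1) (LO x) e e
        = orth_proj (normal_space LO_sphere (sphere 0 1) (LO x)) (dir_deriv (dir_deriv LO ((1 / c) *\<^sub>R fst e)) ((1 / c) *\<^sub>R fst e) x)"
      if "e \<in> E" for e
    proof -
      have e: "e \<in> tangent_space LO_sphere (LO x)"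
        using E that span_base unfolding orthonormal_basis_of_def by metis
      have "((1 / c) *\<^sub>R fst e) \<bullet> x = 0" using tangent_LO_eq(1)[OF x e] by simp
      from second_fundamental_form_LO[OF x this this] show ?thesis
        by (simp only: tangent_LO_eq(2)[OF x e])
    qed
    then have "(\<Sum>e\<in>E. second_fundamental_form LO_sphere (sphere 0 1) (LO x) e e)
        = orth_proj (normal_space LO_sphere (sphere 0 1) (LO x))
          (\<Sum>e\<in>E. dir_deriv (dir_deriv LO ((1 / c) *\<^sub>R fst e)) ((1 / c) *\<^sub>R fst e) x)"
      by (simp add: orth_proj_sum[OF subspace_normal_LO[OF x]])
    then show ?thesis
      by (simp only: orth_proj_eq_0_iff[OF subspace_normal_LO[OF x]]) (simp only: normal_space_LO[OF x], blast)
  qed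
  note key = this
  have ball: "(\<forall>q\<in>LO_sphere. Q q) \<longleftrightarrow> (\<forall>x. norm x = 1 \<longrightarrow> Q (LO x))" for Q
    unfolding ball_simps(9) by (simp only: Ball_def mem_sphere_0)
  have "minimal_submanifold LO_sphere (sphere 0 1) \<longleftrightarrow> (\<forall>q\<in>LO_sphere.
      \<forall>E. orthonormal_basis_of (tangent_space LO_sphere q) E \<longrightarrow>
        (\<Sum>e\<in>E. second_fundamental_form LO_sphere (sphere 0 1) q e e) = 0)"
    unfolding minimal_submanifold_def by (simp only: emb LO_sphere_subset simp_thms)
  also have "\<dots> \<longleftrightarrow> (\<forall>x. norm x = 1 \<longrightarrow>
      (\<forall>E. orthonormal_basis_of (tangent_space LO_sphere (LO x)) E \<longrightarrow>
        (\<Sum>e\<in>E. second_fundamental_form LO_sphere (sphere 0 1) (LO x) e e) = 0))"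
    by (rule ball)
  also have "\<dots> \<longleftrightarrow> (\<forall>x. norm x = 1 \<longrightarrow> (\<forall>E. orthonormal_basis_of (range (\<lambda>v. dir_deriv LO v x)) E \<longrightarrow>
      (\<Sum>e\<in>E. second_fundamental_form LO_sphere (sphere 0 1) (LO x) e e) = 0))"
    by (intro all_cong1 imp_cong refl) (simp only: tangent_space_LO)
  also have "\<dots> \<longleftrightarrow> (\<forall>x. norm x = 1 \<longrightarrow> (\<forall>E. orthonormal_basis_of (range (\<lambda>v. dir_deriv LO v x)) E \<longrightarrow>
      (\<forall>\<nu>. \<nu> \<bullet> LO x = 0 \<longrightarrow> (\<forall>v. \<nu> \<bullet> dir_deriv LO v x = 0) \<longrightarrow>
        (\<Sum>e\<in>E. dir_deriv (dir_deriv LO ((1 / c) *\<^sub>R fst e)) ((1 / c) *\<^sub>R fst e) x) \<bullet> \<nu> = 0)))"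
    by (intro all_cong1 imp_cong refl key)
  finally show ?thesis .
qed

end

text \<open>A trace over the vectors u e depends only on the operator z -> sum of (u e . z) u e.
  Applied to it, any bilinear trace becomes a sum over the fixed basis.\<close>

lemma sum_frame_bilinear:
  fixes H :: "'a::euclidean_space \<Rightarrow> 'a \<Rightarrow> 'b::real_vector"
  assumes "\<And>w. linear (\<lambda>u. H u w)" "\<And>u. linear (H u)"
  shows "(\<Sum>e\<in>E. H (u e) (u e)) = (\<Sum>b\<in>Basis. H b (\<Sum>e\<in>E. (u e \<bullet> b) *\<^sub>R u e))"
proof -
  have "H v w = (\<Sum>b\<in>Basis. (v \<bullet> b) *\<^sub>R H b w)" for v w
  proof -
    have "H v w = H (\<Sum>b\<in>Basis. (v \<bullet> b) *\<^sub>R b) w" by (simp add: euclidean_representation)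
    then show ?thesis by (simp only: linear_sum[OF assms(1)] linear_scale[OF assms(1)])
  qed
  then have "(\<Sum>e\<in>E. H (u e) (u e)) = (\<Sum>e\<in>E. \<Sum>b\<in>Basis. (u e \<bullet> b) *\<^sub>R H b (u e))" by metis
  then show ?thesis
    by (subst (asm) sum.swap) (simp only: linear_sum[OF assms(2)] linear_scale[OF assms(2)])
qed

section \<open>The mean curvature for constant singular values\<close>

locale LO_constant = LO_map f c s + constant_singular_map f lam p
  for f :: "'a::euclidean_space \<Rightarrow> 'b::euclidean_space" and c s lam :: real and p :: nat
begin

text \<open>\<open>\<alpha>\<close> and \<open>\<beta>\<close> are the eigenvalues of the inverse of the induced metric, \<open>\<mu>\<close> is its trace.\<close>

definition "\<alpha> = 1 / (c\<^sup>2 + s\<^sup>2 * lam\<^sup>2)"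
definition "\<beta> = 1 / c\<^sup>2"
definition "\<mu> = \<beta> * (real DIM('a) - 1) + (\<alpha> - \<beta>) * real p"

lemma \<alpha>_pos: "\<alpha> > 0"
  unfolding \<alpha>_def using c_pos by (intro divide_pos_pos add_pos_nonneg) auto

lemma \<alpha>\<beta>: "c\<^sup>2 * \<beta> = 1" "\<alpha> * (c\<^sup>2 + s\<^sup>2 * lam\<^sup>2) = 1" "\<beta> - \<alpha> * \<beta> * s\<^sup>2 * lam\<^sup>2 = \<alpha>"
proof -
  have pos: "c\<^sup>2 > 0" "c\<^sup>2 + s\<^sup>2 * lam\<^sup>2 > 0"
    using c_pos by (auto intro: add_pos_nonneg)
  show 1: "c\<^sup>2 * \<beta> = 1" using c_pos by (simp add: \<beta>_def)
  show 2: "\<alpha> * (c\<^sup>2 + s\<^sup>2 * lam\<^sup>2) = 1" using pos(2) by (simp add: \<alpha>_def)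
  have "\<alpha> * \<beta> * s\<^sup>2 * lam\<^sup>2 = \<beta> * (\<alpha> * (c\<^sup>2 + s\<^sup>2 * lam\<^sup>2)) - \<alpha> * (c\<^sup>2 * \<beta>)"
    by (simp add: algebra_simps)
  then show "\<beta> - \<alpha> * \<beta> * s\<^sup>2 * lam\<^sup>2 = \<alpha>" by (simp only: 1 2 mult_1_right diff_diff_eq2 add_diff_cancel_left')
qed

text \<open>In the parameter space the induced metric is c^2 + s^2 T with T = B^T B, and the frame
  sum is its inverse on tangent vectors. Because T^2 = lam^2 T, the inverse is linear in T;
  \<open>w\<close> is that candidate, and pairing its image with the orthonormal vectors e gives the
  coefficients u e . z.\<close>

lemma inverse_metric:
  assumes x: "norm x = 1" and E: "orthonormal_basis_of (range (\<lambda>v. dir_deriv LO v x)) E"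
  shows "(\<Sum>e\<in>E. ((1 / c) *\<^sub>R fst e \<bullet> z) *\<^sub>R ((1 / c) *\<^sub>R fst e))
    = \<beta> *\<^sub>R (z - (z \<bullet> x) *\<^sub>R x) - (\<alpha> * \<beta> * s\<^sup>2) *\<^sub>R pullback_op x z"
proof -
  have x0: "x \<noteq> 0" using x by auto
  let ?u = "\<lambda>e :: 'a \<times> 'b. (1 / c) *\<^sub>R fst e" and ?T = "pullback_op x"
  note linT = linear_pullback_op[OF x0]
  define w where "w = \<beta> *\<^sub>R (z - (z \<bullet> x) *\<^sub>R x) - (\<alpha> * \<beta> * s\<^sup>2) *\<^sub>R ?T z"
  have Tx: "?T v \<bullet> x = 0" for v using pullback_op_inner[OF x0, of v x] D_radial[OF x0] by simp
  have T0: "?T x = 0" by (simp add: pullback_op_def D_radial[OF x0])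
  have TT: "?T (?T v) = lam\<^sup>2 *\<^sub>R ?T v" for v
  proof -
    have "?T (?T v) = (\<Sum>b\<in>Basis. (dir_deriv ext b x \<bullet> dir_deriv ext (?T v) x) *\<^sub>R b)"
      by (simp only: pullback_op_def)
    then show ?thesis by (simp add: D_pullback[OF x]) (simp add: pullback_op_def scaleR_sum_right)
  qed
  have wx: "w \<bullet> x = 0" using x Tx by (simp add: w_def inner_diff_left dot_square_norm)
  have metric: "c\<^sup>2 *\<^sub>R w + s\<^sup>2 *\<^sub>R ?T w = z - (z \<bullet> x) *\<^sub>R x"
  proof -
    have "?T w = \<beta> *\<^sub>R ?T z - (\<alpha> * \<beta> * s\<^sup>2 * lam\<^sup>2) *\<^sub>R ?T z"
      by (simp add: w_def linear_diff[OF linT] linear_scale[OF linT] T0 TT)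
    also have "\<dots> = (\<beta> - \<alpha> * \<beta> * s\<^sup>2 * lam\<^sup>2) *\<^sub>R ?T z" by (simp only: scaleR_diff_left)
    finally have Tw: "?T w = \<alpha> *\<^sub>R ?T z" by (simp only: \<alpha>\<beta>(3))
    have "c\<^sup>2 *\<^sub>R w = (c\<^sup>2 * \<beta>) *\<^sub>R (z - (z \<bullet> x) *\<^sub>R x) - ((c\<^sup>2 * \<beta>) * (\<alpha> * s\<^sup>2)) *\<^sub>R ?T z"
      by (simp add: w_def scaleR_diff_right mult_ac)
    then show ?thesis by (simp only: \<alpha>\<beta>(1) Tw) (simp add: mult.commute)
  qed
  have E': "pairwise orthogonal E" "\<And>e. e \<in> E \<Longrightarrow> norm e = 1" "span E = range (\<lambda>v. dir_deriv LO v x)"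
    using E unfolding orthonormal_basis_of_def by auto
  have fin: "finite E" using E'(1) pairwise_orthogonal_imp_finite by blast
  have "dir_deriv LO w x \<bullet> e = ?u e \<bullet> z" if "e \<in> E" for e
  proof -
    have e: "e \<in> tangent_space LO_sphere (LO x)"
      using that E'(3) span_base[of e E] by (simp only: tangent_space_LO[OF x])
    have ux: "?u e \<bullet> x = 0" using tangent_LO_eq(1)[OF x e] by simp
    have "dir_deriv LO w x \<bullet> e = dir_deriv LO w x \<bullet> dir_deriv LO (?u e) x"
      using tangent_LO_eq(2)[OF x e] by simp
    also have "\<dots> = c\<^sup>2 * (w \<bullet> ?u e) + s\<^sup>2 * (dir_deriv ext w x \<bullet> dir_deriv ext (?u e) x)"
      unfolding dir_deriv_LO_sphere[OF x] wx ux by (simp add: inner_prod_def power2_eq_square)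
    also have "\<dots> = (c\<^sup>2 *\<^sub>R w + s\<^sup>2 *\<^sub>R ?T w) \<bullet> ?u e"
      by (simp only: inner_add_left inner_scaleR_left pullback_op_inner[OF x0])
    also have "\<dots> = ?u e \<bullet> z" unfolding metric using ux
      by (simp add: inner_diff_left inner_diff_right inner_commute)
    finally show ?thesis .
  qed
  moreover have "(\<Sum>e\<in>E. (dir_deriv LO w x \<bullet> e) *\<^sub>R e) = dir_deriv LO w x"
    by (rule orthonormal_basis_expand[OF E'(1,2) _ fin]) (use E'(3) in auto)
  ultimately have "(\<Sum>e\<in>E. (?u e \<bullet> z) *\<^sub>R e) = dir_deriv LO w x" by simp
  then have "fst (\<Sum>e\<in>E. (?u e \<bullet> z) *\<^sub>R e) = c *\<^sub>R w" by (simp add: dir_deriv_LO_sphere[OF x] wx)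
  then have "(\<Sum>e\<in>E. (?u e \<bullet> z) *\<^sub>R fst e) = c *\<^sub>R w" by (simp only: fst_sum fst_scaleR)
  then have "(1 / c) *\<^sub>R (\<Sum>e\<in>E. (?u e \<bullet> z) *\<^sub>R fst e) = w" using c_pos by simp
  then show ?thesis by (simp add: w_def scaleR_sum_right mult.commute)
qed

text \<open>Both components are frame traces of Hessians. The radial Hessian contributes the trace
  of the inverse metric, namely \<mu>; that of \<open>ext\<close> contributes \<beta> times the
  Laplacian minus a contraction with B^T B, which \<open>hessian_trace_identity\<close>
  resolves.\<close>

lemma mean_curvature_vector:
  assumes x: "norm x = 1" and E: "orthonormal_basis_of (range (\<lambda>v. dir_deriv LO v x)) E"
  shows "(\<Sum>e\<in>E. dir_deriv (dir_deriv LO ((1 / c) *\<^sub>R fst e)) ((1 / c) *\<^sub>R fst e) x)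
    = (- (c * \<mu>) *\<^sub>R x, s *\<^sub>R (\<alpha> *\<^sub>R vlap ext x
        + (\<alpha> * \<beta> * s\<^sup>2) *\<^sub>R (\<Sum>b\<in>Basis. (dir_deriv ext b x \<bullet> vlap ext x) *\<^sub>R dir_deriv ext b x)))"
proof -
  have x0: "x \<in> - {0}" using x by auto
  let ?u = "\<lambda>e :: 'a \<times> 'b. (1 / c) *\<^sub>R fst e" and ?T = "pullback_op x"
  define k where "k = \<alpha> * \<beta> * s\<^sup>2"
  define H where "H u w = dir_deriv (dir_deriv ext w) u x" for u w
  note frame = inverse_metric[OF x E, folded k_def]
  have tang: "e \<in> tangent_space LO_sphere (LO x)" if "e \<in> E" for e
    using that E span_base[of e E] unfolding tangent_space_LO[OF x] orthonormal_basis_of_def by simp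
  have ux: "?u e \<bullet> x = 0" if "e \<in> E" for e using tangent_LO_eq(1)[OF x tang[OF that]] by simp
  have "(\<Sum>e\<in>E. ?u e \<bullet> ?u e) = (\<Sum>b\<in>Basis. b \<bullet> (\<Sum>e\<in>E. (?u e \<bullet> b) *\<^sub>R ?u e))"
    by (rule sum_frame_bilinear) (auto intro!: linearI simp: inner_add_left inner_add_right)
  also have "\<dots> = (\<Sum>b\<in>Basis. \<beta> * (b \<bullet> b - (x \<bullet> b) * (x \<bullet> b)) - k * (norm (dir_deriv ext b x))\<^sup>2)"
  proof (rule sum.cong[OF refl])
    fix b :: 'a
    have "b \<bullet> ?T b = (norm (dir_deriv ext b x))\<^sup>2"
      using x0 pullback_op_inner[of x b b] by (simp add: inner_commute[of b] dot_square_norm)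
    then show "b \<bullet> (\<Sum>e\<in>E. (?u e \<bullet> b) *\<^sub>R ?u e)
        = \<beta> * (b \<bullet> b - (x \<bullet> b) * (x \<bullet> b)) - k * (norm (dir_deriv ext b x))\<^sup>2"
      unfolding frame by (simp add: inner_diff_right inner_commute[of b x])
  qed
  also have "\<dots> = \<beta> * (real DIM('a) - x \<bullet> x) - k * (lam\<^sup>2 * real p)"
    by (simp add: sum_subtractf sum_distrib_left[symmetric] energy_density[OF x] euclidean_inner[symmetric])
  also have "\<dots> = \<mu>"
  proof -
    have "k * lam\<^sup>2 = \<beta> - \<alpha>" using \<alpha>\<beta>(3) by (simp add: k_def)
    then have "k * (lam\<^sup>2 * real p) = (\<beta> - \<alpha>) * real p" by (simp only: mult.assoc[symmetric])
    then show ?thesis using x by (simp add: \<mu>_def dot_square_norm algebra_simps)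
  qed
  finally have tr: "(\<Sum>e\<in>E. ?u e \<bullet> ?u e) = \<mu>" .
  have lin1: "linear (\<lambda>u. H u w)" for w
    unfolding H_def by (rule linear_dir_deriv[OF Cinf_on_differentiable[OF Cinf_on_dir_deriv[OF Cinf_ext] x0]])
  have lin2: "linear (H u)" for u
    unfolding H_def[abs_def] by (rule dir_deriv_dir_linear[OF _ x0 Cinf_ext]) simp
  have "(\<Sum>e\<in>E. H (?u e) (?u e)) = (\<Sum>b\<in>Basis. H b (\<Sum>e\<in>E. (?u e \<bullet> b) *\<^sub>R ?u e))"
    by (rule sum_frame_bilinear[OF lin1 lin2])
  also have "\<dots> = (\<Sum>b\<in>Basis. \<beta> *\<^sub>R (H b b - (x \<bullet> b) *\<^sub>R H b x) - k *\<^sub>R H b (?T b))"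
    unfolding frame by (simp only: linear_diff[OF lin2] linear_scale[OF lin2] inner_commute)
  also have "\<dots> = \<beta> *\<^sub>R ((\<Sum>b\<in>Basis. H b b) - (\<Sum>b\<in>Basis. (x \<bullet> b) *\<^sub>R H b x)) - k *\<^sub>R (\<Sum>b\<in>Basis. H b (?T b))"
    by (simp only: sum_subtractf scaleR_sum_right[symmetric])
  also have "(\<Sum>b\<in>Basis. H b b) = vlap ext x" by (simp add: vlap_def H_def)
  also have "(\<Sum>b\<in>Basis. (x \<bullet> b) *\<^sub>R H b x) = 0"
    unfolding H_def using D2_radial[OF x]
    by (simp add: dir_deriv_basis_sum[OF Cinf_on_differentiable[OF Cinf_on_dir_deriv[OF Cinf_ext] x0]])
  also have "(\<Sum>b\<in>Basis. H b (?T b)) = (\<Sum>c\<in>Basis. \<Sum>b\<in>Basis. (dir_deriv ext b x \<bullet> dir_deriv ext c x) *\<^sub>R H c b)"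
    by (simp only: pullback_op_def linear_sum[OF lin2] linear_scale[OF lin2])
  also have "\<dots> = lam\<^sup>2 *\<^sub>R vlap ext x - (\<Sum>b\<in>Basis. (dir_deriv ext b x \<bullet> vlap ext x) *\<^sub>R dir_deriv ext b x)" (is "_ = _ - ?S")
    unfolding H_def by (rule hessian_trace_identity[OF x])
  also have "\<beta> *\<^sub>R (vlap ext x - 0) - k *\<^sub>R (lam\<^sup>2 *\<^sub>R vlap ext x - ?S) = (\<beta> - k * lam\<^sup>2) *\<^sub>R vlap ext x + k *\<^sub>R ?S"
    by (simp add: algebra_simps)
  also have "\<beta> - k * lam\<^sup>2 = \<alpha>" using \<alpha>\<beta>(3) by (simp add: k_def)
  finally have H: "(\<Sum>e\<in>E. H (?u e) (?u e)) = \<alpha> *\<^sub>R vlap ext x + k *\<^sub>R ?S" .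
  have "(\<Sum>e\<in>E. dir_deriv (dir_deriv LO (?u e)) (?u e) x)
      = (\<Sum>e\<in>E. (- (c * (?u e \<bullet> ?u e)) *\<^sub>R x, s *\<^sub>R H (?u e) (?u e)))"
  proof (rule sum.cong[OF refl])
    fix e assume "e \<in> E"
    from dir_deriv2_radial[OF x ux[OF this] ux[OF this]]
    show "dir_deriv (dir_deriv LO (?u e)) (?u e) x = (- (c * (?u e \<bullet> ?u e)) *\<^sub>R x, s *\<^sub>R H (?u e) (?u e))"
      using x0 by (simp add: dir_deriv2_LO H_def)
  qed
  also have "\<dots> = (- (c * (\<Sum>e\<in>E. ?u e \<bullet> ?u e)) *\<^sub>R x, s *\<^sub>R (\<Sum>e\<in>E. H (?u e) (?u e)))"
    by (simp only: sum_prod[symmetric] scaleR_sum_right sum_distrib_left sum_negf[symmetric] scaleR_sum_left)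
  finally show ?thesis by (simp only: tr H k_def)
qed

text \<open>Subtracting a suitable tangent vector turns the trace into a vector orthogonal to the
  tangent space. Minimality then makes it a multiple of the position vector, and comparing
  components separates the eigenmap equation from the scalar one.\<close>

lemma mean_curvature_normal_iff:
  assumes x: "norm x = 1"
  shows "(\<forall>\<nu>. \<nu> \<bullet> LO x = 0 \<longrightarrow> (\<forall>v. \<nu> \<bullet> dir_deriv LO v x = 0) \<longrightarrow>
      (- (c * \<mu>) *\<^sub>R x, s *\<^sub>R (\<alpha> *\<^sub>R vlap ext x
        + (\<alpha> * \<beta> * s\<^sup>2) *\<^sub>R (\<Sum>b\<in>Basis. (dir_deriv ext b x \<bullet> vlap ext x) *\<^sub>R dir_deriv ext b x))) \<bullet> \<nu> = 0)
    \<longleftrightarrow> vlap ext x = - (lam\<^sup>2 * real p) *\<^sub>R f x \<and> \<mu> = \<alpha> * (lam\<^sup>2 * real p)"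
    (is "?L \<longleftrightarrow> ?R")
proof
  have x0: "x \<noteq> 0" using x by auto
  let ?S = "\<Sum>b\<in>Basis. (dir_deriv ext b x \<bullet> vlap ext x) *\<^sub>R dir_deriv ext b x"
  let ?k = "\<alpha> * \<beta> * s\<^sup>2"
  let ?H = "(- (c * \<mu>) *\<^sub>R x, s *\<^sub>R (\<alpha> *\<^sub>R vlap ext x + ?k *\<^sub>R ?S))"
  have fD: "dir_deriv ext b x \<bullet> f x = 0" for b using D_orth[OF x0, of b] x by (simp add: inner_commute)
  have nf: "norm (f x) = 1" using norm_ext[OF x0] x by simp
  {
    assume R: ?R
    then have "?S = 0" by (simp add: fD)
    then have "?H = - \<mu> *\<^sub>R LO x" using R x by (simp add: LO_eq)
    then show ?L by (simp only: inner_scaleR_left) (simp add: inner_commute)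
  next
    assume L: ?L
    define w where "w = (\<Sum>b\<in>Basis. (dir_deriv ext b x \<bullet> vlap ext x) *\<^sub>R b)"
    have wv: "w \<bullet> v = vlap ext x \<bullet> dir_deriv ext v x" for v
    proof -
      have "w \<bullet> v = vlap ext x \<bullet> (\<Sum>b\<in>Basis. (v \<bullet> b) *\<^sub>R dir_deriv ext b x)"
        by (simp add: w_def inner_sum_left inner_sum_right inner_commute mult.commute)
      then show ?thesis by (simp add: dir_deriv_basis_sum[OF D_differentiable[OF x0]])
    qed
    have wx: "w \<bullet> x = 0" by (simp add: wv D_radial[OF x0])
    have Dw: "dir_deriv ext w x = ?S"
      by (simp add: w_def linear_sum[OF D_linear[OF x0]] linear_scale[OF D_linear[OF x0]])
    \<comment> \<open>The coefficient of the subtracted vector is dictated by two effects at once: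
      it removes the term B B^T applied to the Laplacian, and, since c^2 \<beta> = 1, what remains
      is orthogonal to every tangent vector.\<close>
    define \<tau> where "\<tau> = (- (c * \<mu>) *\<^sub>R x - (c * ?k) *\<^sub>R w, (s * \<alpha>) *\<^sub>R vlap ext x)"
    have \<tau>: "\<tau> = ?H - ?k *\<^sub>R dir_deriv LO w x"
      by (simp add: \<tau>_def dir_deriv_LO_sphere[OF x] wx Dw algebra_simps)
    have \<tau>T: "\<tau> \<bullet> dir_deriv LO v x = 0" for v
    proof -
      have "\<tau> \<bullet> dir_deriv LO v x = (s\<^sup>2 * \<alpha> - c\<^sup>2 * ?k) * (w \<bullet> v)"
        unfolding \<tau>_def dir_deriv_LO_sphere[OF x] using wx x wv[of v, symmetric]
        by (simp add: inner_prod_def inner_diff_left inner_diff_right dot_square_norm inner_commute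
            power2_eq_square algebra_simps)
      also have "c\<^sup>2 * ?k = (c\<^sup>2 * \<beta>) * (s\<^sup>2 * \<alpha>)" by (simp only: mult_ac)
      finally show ?thesis by (simp only: \<alpha>\<beta>(1)) simp
    qed
    define r where "r = \<tau> \<bullet> LO x"
    define \<nu> where "\<nu> = \<tau> - r *\<^sub>R LO x"
    have \<nu>1: "\<nu> \<bullet> LO x = 0" by (simp add: \<nu>_def inner_diff_left r_def LO_inner_self[OF x0])
    have \<nu>2: "\<nu> \<bullet> dir_deriv LO v x = 0" for v
      by (simp add: \<nu>_def inner_diff_left \<tau>T inner_LO_tangent[OF x])
    have "?H \<bullet> \<nu> = 0" using L \<nu>1 \<nu>2 by blast
    then have "\<tau> \<bullet> \<nu> = 0"
      unfolding \<tau> inner_diff_left by (simp add: inner_commute[of _ \<nu>] \<nu>2)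
    moreover have "\<nu> \<bullet> \<nu> = \<tau> \<bullet> \<nu> - r * (LO x \<bullet> \<nu>)"
      by (metis \<nu>_def inner_diff_left inner_scaleR_left)
    ultimately have "\<nu> \<bullet> \<nu> = 0" using \<nu>1 by (simp add: inner_commute)
    then have "\<tau> = r *\<^sub>R LO x" by (simp add: \<nu>_def)
    then have e1: "- (c * \<mu>) *\<^sub>R x - (c * ?k) *\<^sub>R w = (r * c) *\<^sub>R x" and e2: "(s * \<alpha>) *\<^sub>R vlap ext x = (r * s) *\<^sub>R f x"
      by (simp_all add: \<tau>_def LO_eq[OF x])
    have "(- (c * \<mu>) *\<^sub>R x - (c * ?k) *\<^sub>R w) \<bullet> x = (r * c) *\<^sub>R x \<bullet> x" by (simp only: e1)
    then have "r * c = (- \<mu>) * c" using x wx by (simp add: inner_diff_left dot_square_norm mult.commute)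
    then have r: "r = - \<mu>" using c_pos by (simp only: mult_cancel_right) simp
    have "(1 / s) *\<^sub>R ((s * \<alpha>) *\<^sub>R vlap ext x) = (1 / s) *\<^sub>R ((r * s) *\<^sub>R f x)" by (simp only: e2)
    then have e3: "\<alpha> *\<^sub>R vlap ext x = - \<mu> *\<^sub>R f x" using s_pos by (simp add: r)
    \<comment> \<open>Pairing with f x fixes the eigenvalue: |ext| = 1 determines the component of
      the Laplacian along f as minus the energy density.\<close>
    have "f x \<bullet> (\<alpha> *\<^sub>R vlap ext x) = - \<mu>" unfolding e3 using nf by (simp add: dot_square_norm)
    moreover have "f x \<bullet> vlap ext x = - (lam\<^sup>2 * real p)"
      using ext_inner_vlap[OF x0] energy_density[OF x] x by simp
    ultimately have \<mu>: "\<mu> = \<alpha> * (lam\<^sup>2 * real p)" by simp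
    have "(1 / \<alpha>) *\<^sub>R (\<alpha> *\<^sub>R vlap ext x) = (1 / \<alpha>) *\<^sub>R (- \<mu> *\<^sub>R f x)" by (simp only: e3)
    then have "vlap ext x = - (lam\<^sup>2 * real p) *\<^sub>R f x" using \<alpha>_pos by (simp add: \<mu>)
    with \<mu> show ?R by blast
  }
qed

theorem minimal_LO_constant_iff:
  "minimal_submanifold LO_sphere (sphere 0 1) \<longleftrightarrow>
    (\<forall>x. norm x = 1 \<longrightarrow> vlap ext x = - (lam\<^sup>2 * real p) *\<^sub>R f x) \<and> \<mu> = \<alpha> * (lam\<^sup>2 * real p)"
proof -
  \<comment> \<open>Without a frame at each point, the condition quantified over frames would be
    vacuous.\<close>
  have E: "\<exists>E. orthonormal_basis_of (range (\<lambda>v. dir_deriv LO v x)) E" if "norm x = 1" for x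
  proof -
    have "x \<noteq> 0" using that by auto
    then have "subspace (range (\<lambda>v. dir_deriv LO v x))"
      using linear_subspace_image[OF linear_dir_deriv_LO subspace_UNIV] by blast
    then show ?thesis unfolding orthonormal_basis_of_def by (metis orthonormal_basis_subspace)
  qed
  have "minimal_submanifold LO_sphere (sphere 0 1) \<longleftrightarrow>
    (\<forall>x. norm x = 1 \<longrightarrow> (\<forall>E. orthonormal_basis_of (range (\<lambda>v. dir_deriv LO v x)) E \<longrightarrow>
      vlap ext x = - (lam\<^sup>2 * real p) *\<^sub>R f x \<and> \<mu> = \<alpha> * (lam\<^sup>2 * real p)))"
    unfolding minimal_LO_iff by (simp only: mean_curvature_vector mean_curvature_normal_iff cong: imp_cong)
  also have "\<dots> \<longleftrightarrow> (\<forall>x. norm x = 1 \<longrightarrow>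
      vlap ext x = - (lam\<^sup>2 * real p) *\<^sub>R f x \<and> \<mu> = \<alpha> * (lam\<^sup>2 * real p))"
    using E by blast
  also have "\<dots> \<longleftrightarrow> (\<forall>x. norm x = 1 \<longrightarrow> vlap ext x = - (lam\<^sup>2 * real p) *\<^sub>R f x) \<and> \<mu> = \<alpha> * (lam\<^sup>2 * real p)"
  proof -
    \<comment> \<open>The scalar equation does not involve x, and a single unit vector suffices to
      extract it.\<close>
    obtain x0 :: 'a where x0: "norm x0 = 1" using vector_choose_size[of 1] zero_le_one by metis
    have "(\<forall>x. A x \<longrightarrow> B x \<and> R) \<longleftrightarrow> (\<forall>x. A x \<longrightarrow> B x) \<and> R" if "A x0" for A B and R
      using that by blast
    from this[of "\<lambda>x. norm x = 1", OF x0] show ?thesis .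
  qed
  finally show ?thesis .
qed

end

subsection \<open>Eigenmaps\<close>

context constant_singular_map
begin

lemma is_LOS_iff:
  assumes "0 < \<theta>" "\<theta> < pi / 2"
  shows "is_LOS f \<theta> \<longleftrightarrow> (\<forall>x. norm x = 1 \<longrightarrow> vlap ext x = - (lam\<^sup>2 * real p) *\<^sub>R f x) \<and>
    1 / (cos \<theta>)\<^sup>2 * (real DIM('a) - 1) + (1 / ((cos \<theta>)\<^sup>2 + (sin \<theta>)\<^sup>2 * lam\<^sup>2) - 1 / (cos \<theta>)\<^sup>2) * real p
      = 1 / ((cos \<theta>)\<^sup>2 + (sin \<theta>)\<^sup>2 * lam\<^sup>2) * (lam\<^sup>2 * real p)"
proof -
  interpret LO: LO_constant f "cos \<theta>" "sin \<theta>" lam p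
    by unfold_locales (use assms in \<open>auto intro: cos_gt_zero sin_gt_zero\<close>)
  have "LO_set f \<theta> = LO.LO ` sphere 0 1"
    unfolding LO_set_def by (rule image_cong) (auto simp: LO.LO_eq)
  then show ?thesis
    using LO.minimal_LO_constant_iff by (simp only: is_LOS_def LO.\<mu>_def LO.\<alpha>_def LO.\<beta>_def)
qed

lemma vlap_ext_off_sphere:
  assumes eig: "\<And>x. norm x = 1 \<Longrightarrow> vlap ext x = - K *\<^sub>R f x" and y: "y \<noteq> 0"
  shows "vlap ext y = - (K * norm y powr (- 2)) *\<^sub>R ext y"
proof -
  have hom: "homog (- 2) (dir_deriv (dir_deriv ext b) b)" for b
    using homog_dir_deriv[OF Cinf_on_dir_deriv[OF Cinf_ext] homog_dir_deriv[OF Cinf_ext homog_ext]] by simp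
  have "vlap ext y = vlap ext (norm y *\<^sub>R radial y)" by (simp only: norm_scale_radial)
  also have "\<dots> = norm y powr (- 2) *\<^sub>R vlap ext (radial y)"
    unfolding vlap_def scaleR_sum_right
    by (rule sum.cong[OF refl], rule homogD[OF hom]) (use y in auto)
  also have "vlap ext (radial y) = - K *\<^sub>R ext y"
    using eig[of "radial y"] y by (simp add: ext_def)
  finally show ?thesis by (simp add: mult.commute)
qed

text \<open>The mixed term of the product rule is a multiple of the radial derivative of
  \<open>ext\<close> and vanishes, so the Laplacian of r^a, a (a + DIM - 2) r^(a-2), has only to
  cancel the eigenvalue K.\<close>

lemma vlap_homogeneous_extension:
  assumes eig: "\<And>x. norm x = 1 \<Longrightarrow> vlap ext x = - K *\<^sub>R f x" and y: "y \<noteq> 0"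
    and K: "K = a * (a + real DIM('a) - 2)"
  shows "vlap (\<lambda>y. norm y powr a *\<^sub>R ext y) y = 0"
proof -
  have y0: "y \<in> - {0}" using y by simp
  have "(\<Sum>b\<in>Basis. dir_deriv (\<lambda>y. norm y powr a) b y *\<^sub>R dir_deriv ext b y)
      = (a * norm y powr (a - 2)) *\<^sub>R (\<Sum>b\<in>Basis. (y \<bullet> b) *\<^sub>R dir_deriv ext b y)"
    using y by (simp add: dir_deriv_norm_powr scaleR_sum_right)
  also have "\<dots> = 0" using y by (simp add: dir_deriv_basis_sum D_differentiable D_radial)
  finally have cross: "(\<Sum>b\<in>Basis. dir_deriv (\<lambda>y. norm y powr a) b y *\<^sub>R dir_deriv ext b y) = 0" .
  have "vlap (\<lambda>y. norm y powr a *\<^sub>R ext y) y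
      = norm y powr a *\<^sub>R (- (K * norm y powr (- 2)) *\<^sub>R ext y) + (K * norm y powr (a - 2)) *\<^sub>R ext y"
    unfolding vlap_scaleR[OF open_minus_origin y0 Cinf_on_norm_powr Cinf_ext] cross
    by (simp only: vlap_ext_off_sphere[OF eig y] vlap_norm_powr[OF y] K scaleR_zero_right add_0_right)
  also have "norm y powr a *\<^sub>R (- (K * norm y powr (- 2)) *\<^sub>R ext y) = - (K * norm y powr (a - 2)) *\<^sub>R ext y"
    using powr_add[of "norm y" a "- 2"] by (simp add: mult_ac)
  finally show ?thesis by simp
qed

end

text \<open>L commutes with differentiation and, preserving inner products, with the projections u -
  (u . q) q onto tangent spaces of the spheres. This is what rules out degree 1.\<close>

lemma linear_isometry_totally_geodesic:
  fixes L :: "'a::euclidean_space \<Rightarrow> 'b::euclidean_space"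
  assumes L: "linear L" "\<And>x. norm (L x) = norm x" and f: "\<And>x. norm x = 1 \<Longrightarrow> f x = L x"
  shows "totally_geodesic_map (sphere 0 1) (sphere 0 1) f"
  unfolding totally_geodesic_map_def
proof (intro allI impI)
  fix X :: "'a \<Rightarrow> 'a" and p v :: 'a
  assume "tangent_field (sphere 0 1) X \<and> p \<in> sphere 0 1 \<and> v \<in> tangent_space (sphere 0 1) p"
  then have X: "smooth_on (sphere 0 1) X" "\<And>q. norm q = 1 \<Longrightarrow> X q \<in> tangent_space (sphere 0 1) q"
    and p: "norm p = 1" "p \<in> sphere 0 1" and v: "v \<in> tangent_space (sphere 0 1) p"
    by (auto simp: tangent_field_def)
  have inner: "L a \<bullet> L b = a \<bullet> b" for a b
    by (simp add: dot_norm L(2) flip: linear_add[OF L(1)])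
  have bl: "bounded_linear L" using L(1) by (simp add: linear_conv_bounded_linear)
  have df: "differential (sphere 0 1) f q w = L w" if "norm q = 1" "w \<in> tangent_space (sphere 0 1) q" for q w
  proof (rule differential_eq[OF _ that(2)])
    show "(f has_derivative L) (at q within sphere 0 1)"
      by (rule has_derivative_transform_within[OF bounded_linear_imp_has_derivative[OF bl] zero_less_one])
        (use that f in auto)
  qed
  obtain D where D: "(X has_derivative D) (at p within sphere 0 1)"
    using smooth_on_has_derivative_within[OF X(1) p(2)] .
  have dX: "differential (sphere 0 1) X p v = D v" by (rule differential_eq[OF D v])
  have "((\<lambda>q. L (X q)) has_derivative (\<lambda>v. L (D v))) (at p within sphere 0 1)"
    by (rule bounded_linear.has_derivative[OF bl D])
  then have "((\<lambda>q. differential (sphere 0 1) f q (X q)) has_derivative (\<lambda>v. L (D v))) (at p within sphere 0 1)"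
    by (rule has_derivative_transform_within[OF _ zero_less_one p(2)]) (use df X(2) in auto)
  then have dLX: "differential (sphere 0 1) (\<lambda>q. differential (sphere 0 1) f q (X q)) p v = L (D v)"
    by (rule differential_eq[OF _ v])
  have proj: "orth_proj {w. w \<bullet> q = 0} u = u - (u \<bullet> q) *\<^sub>R q" if "norm q = 1" for u q :: "'z::euclidean_space"
  proof (rule orth_proj_eqI)
    show "subspace {w. w \<bullet> q = 0}" by (rule subspaceI) (auto simp: inner_add_left)
    show "u - (u \<bullet> q) *\<^sub>R q \<in> {w. w \<bullet> q = 0}" using that by (simp add: inner_diff_left dot_square_norm)
  qed (simp add: inner_commute)
  have nfp: "norm (f p) = 1" using f[OF p(1)] L(2) p(1) by simp
  have "cov_deriv (sphere 0 1) (sphere 0 1) f (\<lambda>q. differential (sphere 0 1) f q (X q)) p v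
      = L (D v) - (L (D v) \<bullet> L p) *\<^sub>R L p"
    by (simp only: cov_deriv_def dLX tangent_space_sphere[OF nfp] proj[OF nfp]) (simp only: f[OF p(1)])
  also have "\<dots> = L (D v - (D v \<bullet> p) *\<^sub>R p)"
    by (simp add: inner linear_diff[OF L(1)] linear_scale[OF L(1)])
  also have "\<dots> = differential (sphere 0 1) f p (D v - (D v \<bullet> p) *\<^sub>R p)"
    by (rule df[OF p(1), symmetric]) (use p(1) in \<open>simp add: tangent_space_sphere inner_diff_left dot_square_norm\<close>)
  also have "D v - (D v \<bullet> p) *\<^sub>R p = cov_deriv (sphere 0 1) (sphere 0 1) id X p v"
    unfolding cov_deriv_def id_apply dX tangent_space_sphere[OF p(1)] proj[OF p(1)] ..
  finally show "cov_deriv (sphere 0 1) (sphere 0 1) f (\<lambda>q. differential (sphere 0 1) f q (X q)) p v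
      = differential (sphere 0 1) f p (cov_deriv (sphere 0 1) (sphere 0 1) id X p v)" .
qed

text \<open>A function that is homogeneous of degree 1 and differentiable at the origin coincides
  with its derivative there.\<close>

lemma linear_if_homogeneous_polynomial:
  fixes P :: "'a::euclidean_space \<Rightarrow> 'b::euclidean_space"
  assumes "\<And>i. i \<in> Basis \<Longrightarrow> real_polynomial_function (\<lambda>x. P x \<bullet> i)" and hom: "\<And>c x. P (c *\<^sub>R x) = c *\<^sub>R P x"
  shows "linear P"
proof (rule linearI)
  have *: "P x \<bullet> i = dir_deriv (\<lambda>x. P x \<bullet> i) x 0" "(\<lambda>x. P x \<bullet> i) differentiable (at 0)" if "i \<in> Basis" for i x
  proof -
    have C: "Cinf_on (\<lambda>x. P x \<bullet> i) UNIV" using assms(1)[OF that] Cinf_on_real_polynomial_function by blast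
    show d: "(\<lambda>x. P x \<bullet> i) differentiable (at 0)" using Cinf_on_differentiable[OF C] by simp
    have "dir_deriv (\<lambda>t::real. P (t *\<^sub>R x) \<bullet> i) 1 0 = dir_deriv (\<lambda>x. P x \<bullet> i) (dir_deriv (\<lambda>t. t *\<^sub>R x) 1 0) (0 *\<^sub>R x)"
      by (rule dir_deriv_compose[where g = "\<lambda>x. P x \<bullet> i"]) (use d in \<open>auto intro!: derivative_intros\<close>)
    also have "dir_deriv (\<lambda>t::real. t *\<^sub>R x) 1 0 = 1 *\<^sub>R x"
      by (rule dir_deriv_eqI) (auto intro!: derivative_eq_intros)
    also have "dir_deriv (\<lambda>t::real. P (t *\<^sub>R x) \<bullet> i) 1 0 = 1 * (P x \<bullet> i)"
      unfolding hom inner_scaleR_left by (rule dir_deriv_eqI) (auto intro!: derivative_eq_intros)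
    finally show "P x \<bullet> i = dir_deriv (\<lambda>x. P x \<bullet> i) x 0" by simp
  qed
  show "P (x + y) = P x + P y" for x y
  proof (rule euclidean_eqI)
    fix i :: 'b assume i: "i \<in> Basis"
    show "P (x + y) \<bullet> i = (P x + P y) \<bullet> i"
      using linear_add[OF linear_dir_deriv[OF *(2)[OF i]], of x y] *(1)[OF i]
      unfolding inner_add_left by metis
  qed
qed (rule hom)

text \<open>Here q is the squared cosine of the angle and L the squared singular value. Clearing
  denominators leaves (n - p) L = q n (L - 1), linear in q. The quotient p / (L p) is kept unreduced
  because L p is to become k (k + n - 1).\<close>

lemma angle_equation:
  fixes q L n p :: real
  assumes "0 < q" "q < 1" "L > 1" "p > 0" "n \<ge> p"
  shows "1 / q * n + (1 / (q + (1 - q) * L) - 1 / q) * p = 1 / (q + (1 - q) * L) * (L * p)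
    \<longleftrightarrow> q = (1 - p / n) / (1 - p / (L * p))"
proof -
  define d where "d = q + (1 - q) * L"
  have d: "d > 0" unfolding d_def using assms by (intro add_pos_pos mult_pos_pos) auto
  have nz: "q \<noteq> 0" "d \<noteq> 0" "n > 0" "L - 1 > 0" using assms d by auto
  have "1 / q * n + (1 / d - 1 / q) * p - 1 / d * (L * p) = (n * d + (q - d) * p - q * (L * p)) / (q * d)"
    using nz by (simp add: divide_simps)
  then have "1 / q * n + (1 / d - 1 / q) * p = 1 / d * (L * p) \<longleftrightarrow> n * d + (q - d) * p = q * (L * p)"
    using nz by (metis divide_eq_0_iff eq_iff_diff_eq_0 mult_eq_0_iff)
  also have "\<dots> \<longleftrightarrow> (n - p) * L = q * (n * (L - 1))"
    unfolding d_def by (auto simp: algebra_simps)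
  also have "\<dots> \<longleftrightarrow> q = (n - p) * L / (n * (L - 1))"
    using nz nonzero_eq_divide_eq[of "n * (L - 1)" q "(n - p) * L"] by auto
  also have "(n - p) * L / (n * (L - 1)) = (1 - p / n) / (1 - p / (L * p))"
    using nz assms by (simp add: field_simps)
  finally show ?thesis by (simp only: d_def)
qed

section \<open>Degree, singular value and angle of an LOMSE\<close>

theorem theorem2p8:
  fixes f :: "'a::euclidean_space \<Rightarrow> 'b::euclidean_space"
    and n m p :: nat and lam :: real
  assumes "DIM('a) = n + 1" and "DIM('b) = m + 1"
    and "LOMSE f"
    and "lam \<noteq> 0"
    and "\<forall>x\<in>sphere 0 1. singular_value (sphere 0 1) f x lam"
    and "\<forall>x\<in>sphere 0 1. singular_multiplicity (sphere 0 1) f x lam = p"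
  shows "\<exists>k::nat. k \<ge> 2 \<and>
    (\<forall>i\<in>Basis. spherical_harmonic k (\<lambda>x. f x \<bullet> i)) \<and>
    lam = sqrt (real k * (real k + real n - 1) / real p) \<and>
    (\<forall>\<theta>. 0 < \<theta> \<and> \<theta> < pi / 2 \<longrightarrow>
      (is_LOS f \<theta> \<longleftrightarrow>
       \<theta> = arccos (sqrt ((1 - real p / real n) /
                        (1 - real p / (real k * (real k + real n - 1)))))))"
proof -
  obtain x0 :: 'a where x0: "norm x0 = 1" using vector_choose_size[of 1] zero_le_one by metis
  obtain \<theta>0 where sm: "smooth_on (sphere 0 1) f" "f ` sphere 0 1 \<subseteq> sphere 0 1"
    and \<theta>0: "0 < \<theta>0" "\<theta>0 < pi / 2" "is_LOS f \<theta>0"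
    and ntg: "\<not> totally_geodesic_map (sphere 0 1) (sphere 0 1) f"
    using assms(3) unfolding LOMSE_def LOM_def by blast
  have sv: "singular_value (sphere 0 1) f x lam" if "norm x = 1" for x using assms(5) that by simp
  have lam: "lam > 0" using sv[OF x0] assms(4) by (simp add: singular_value_def)
  have eq: "s = lam" if "norm x = 1" "singular_value (sphere 0 1) f x s" "s \<noteq> 0" for x s
    using assms(3,4) sv[OF that(1)] that unfolding LOMSE_def by (metis mem_sphere_0)
  interpret sphere_map f by unfold_locales (fact sm)+
  interpret constant_singular_map f lam p
  proof
    show "lam > 0" by fact
    show "dir_deriv ext (pullback_op x v) x = lam\<^sup>2 *\<^sub>R dir_deriv ext v x" if "norm x = 1" for x v
      by (rule D_pullback_op_eq[OF that lam eq[OF that]])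
    show "(\<Sum>b\<in>Basis. (norm (dir_deriv ext b x))\<^sup>2) = lam\<^sup>2 * real p" if "norm x = 1" for x
      using sum_norm_D[OF that lam eq[OF that]] that assms(6) by simp
  qed
  have N: "real DIM('a) - 1 = real n" using assms(1) by simp
  note LOS = is_LOS_iff[unfolded N]
  \<comment> \<open>Minimality at the single angle given by the hypothesis yields the eigenmap
    equation. Since it does not contain the angle, only the scalar equation remains to be examined
    for all other angles.\<close>
  have eig: "\<And>x. norm x = 1 \<Longrightarrow> vlap ext x = - (lam\<^sup>2 * real p) *\<^sub>R f x"
    using LOS[OF \<theta>0(1,2)] \<theta>0(3) by blast
  \<comment> \<open>The singular space lies in the tangent hyperplane at \<open>x0\<close>, which
    has dimension n.\<close>
  have p_le: "p \<le> n"
  proof -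
    have "singular_space (sphere 0 1) f x0 lam \<subseteq> {v. x0 \<bullet> v = 0}"
      using tangent_space_sphere[OF x0] by (auto simp: singular_space_def inner_commute)
    then have "dim (singular_space (sphere 0 1) f x0 lam) \<le> dim {v. x0 \<bullet> v = 0}" by (rule dim_subset)
    also have "\<dots> = DIM('a) - 1" by (rule dim_hyperplane) (use x0 in auto)
    finally show ?thesis using assms(1,6) x0 by (simp add: singular_multiplicity_def)
  qed
  have p_pos: "p > 0"
  proof (rule ccontr)
    assume "\<not> p > 0"
    then have "dim (singular_space (sphere 0 1) f x0 lam) = 0"
      using assms(6) x0 by (simp add: singular_multiplicity_def)
    then have "singular_space (sphere 0 1) f x0 lam \<subseteq> {0}" by (simp only: dim_eq_0)
    then show False using sv[OF x0] unfolding singular_value_def by blast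
  qed
  define K where "K = lam\<^sup>2 * real p"
  have K: "K > 0" using lam p_pos by (simp add: K_def)
  \<comment> \<open>The positive root of a (a + n - 1) = K, the exponent for which r^a
    \<open>ext\<close> is harmonic.\<close>
  define a where "a = (sqrt ((real n - 1)\<^sup>2 + 4 * K) - (real n - 1)) / 2"
  have n1: "n \<ge> 1" using p_le p_pos by simp
  have "sqrt ((real n - 1)\<^sup>2) < sqrt ((real n - 1)\<^sup>2 + 4 * K)" using K by (simp only: real_sqrt_less_iff)
  then have a_pos: "a > 0" using n1 by (simp add: a_def)
  have aK: "K = a * (a + real n - 1)"
  proof -
    have "2 * a + (real n - 1) = sqrt ((real n - 1)\<^sup>2 + 4 * K)" by (simp add: a_def field_simps)
    then have "(2 * a + (real n - 1))\<^sup>2 = (real n - 1)\<^sup>2 + 4 * K" using K by simp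
    then show ?thesis by (simp add: power2_eq_square algebra_simps)
  qed
  \<comment> \<open>On the circle p = n = 1, so the terms 1 / cos^2 cancel in the scalar equation at
    \<open>\<theta>0\<close>, and what is left forces \<open>lam\<close> squared to be 1.\<close>
  have a1: "a = 1" if "n = 1"
  proof -
    have "p = 1" using p_le p_pos that by simp
    let ?c = "(cos \<theta>0)\<^sup>2" and ?d = "(cos \<theta>0)\<^sup>2 + (sin \<theta>0)\<^sup>2 * lam\<^sup>2"
    have "cos \<theta>0 > 0" using \<theta>0 by (auto intro: cos_gt_zero)
    then have "?d > 0" by (auto intro: add_pos_nonneg)
    moreover have "1 / ?d = 1 / ?d * lam\<^sup>2"
      using LOS[OF \<theta>0(1,2)] \<theta>0(3) \<open>p = 1\<close> that by simp
    ultimately have "K = 1" by (simp add: K_def \<open>p = 1\<close>)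
    then have "a\<^sup>2 = 1" using aK that by (simp add: power2_eq_square)
    then show ?thesis using a_pos by (simp add: power2_eq_1_iff)
  qed
  define F where "F y = norm y powr a *\<^sub>R ext y" for y
  have harm: "vlap F y = 0" if "y \<noteq> 0" for y
    unfolding F_def[abs_def]
    by (rule vlap_homogeneous_extension[of K, OF _ that]) (use eig aK assms(1) in \<open>auto simp: K_def\<close>)
  have CF: "Cinf_on F (- {0})" unfolding F_def[abs_def] by (intro Cinf_intros open_minus_origin)
  have hF: "homog a F" by (simp add: homog_def F_def ext_scale powr_mult)
  have nF: "norm (F y) = norm y powr a" if "y \<noteq> 0" for y using that by (simp add: F_def)
  have "DIM('a) \<ge> 3 \<or> DIM('a) = 2 \<and> a = 1" using n1 a1 assms(1) by linarith
  from homog_harmonic_polynomial[OF CF hF harm nF a_pos this]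
  obtain k P where k: "a = real k"
    and P: "\<And>i. i \<in> Basis \<Longrightarrow> real_polynomial_function (\<lambda>x. P x \<bullet> i)"
      "\<And>c x. P (c *\<^sub>R x) = c ^ k *\<^sub>R P x" "\<And>x. x \<noteq> 0 \<Longrightarrow> F x = P x" by metis
  have fP: "f x = P x" if "norm x = 1" for x
  proof -
    have "x \<noteq> 0" using that by auto
    then show ?thesis using P(3)[of x] that by (simp add: F_def)
  qed
  \<comment> \<open>Degree 1 would make P a linear isometry, since |F| = r, and f would be totally
    geodesic.\<close>
  have "k \<noteq> 1"
  proof
    assume "k = 1"
    then have lin: "linear P" using linear_if_homogeneous_polynomial[of P] P(1,2) by simp
    have "norm (P x) = norm x" for x
    proof (cases "x = 0")
      case True
      then show ?thesis using linear_0[OF lin] by simp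
    next
      case False
      then show ?thesis using nF[OF False] P(3)[OF False] k \<open>k = 1\<close> by simp
    qed
    then show False using linear_isometry_totally_geodesic[OF lin] fP ntg by blast
  qed
  then have k2: "k \<ge> 2" using a_pos k by (cases k) auto
  have harmonic: "spherical_harmonic k (\<lambda>x. f x \<bullet> i)" if i: "i \<in> Basis" for i
    unfolding spherical_harmonic_def
  proof (intro exI conjI allI ballI)
    show pf: "real_polynomial_function (\<lambda>x. P x \<bullet> i)" by (rule P(1)[OF i])
    show "P (c *\<^sub>R x) \<bullet> i = c ^ k * (P x \<bullet> i)" for c x by (simp add: P(2))
    show "f x \<bullet> i = P x \<bullet> i" if "x \<in> sphere 0 1" for x using fP that by simp
    have "vlap (\<lambda>x. P x \<bullet> i) x = 0" if "x \<noteq> 0" for x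
    proof -
      have x: "x \<in> - {0}" using that by simp
      have "vlap (\<lambda>x. P x \<bullet> i) x = vlap (\<lambda>x. F x \<bullet> i) x"
        by (rule vlap_cong[OF open_minus_origin x]) (use P(3) in auto)
      also have "\<dots> = vlap F x \<bullet> i"
        by (rule vlap_linear_comp[OF bounded_linear_inner_left open_minus_origin x CF])
      finally show ?thesis using harm[OF that] by simp
    qed
    then show "laplacian (\<lambda>x. P x \<bullet> i) x = 0" for x
      unfolding laplacian_eq_vlap by (rule vlap_polynomial_eq_0[OF pf])
  qed
  have Kk: "lam\<^sup>2 * real p = real k * (real k + real n - 1)" using aK k by (simp add: K_def)
  have lam_eq: "lam = sqrt (real k * (real k + real n - 1) / real p)"
    using lam p_pos by (simp add: Kk[symmetric])
  \<comment> \<open>Uses k >= 2: lam^2 p = k (k + n - 1) >= 2 (n + 1) > n >= p.\<close>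
  have L1: "lam\<^sup>2 > 1"
  proof (rule ccontr)
    assume "\<not> lam\<^sup>2 > 1"
    then have "lam\<^sup>2 * real p \<le> real p" using p_pos by simp
    also have "\<dots> \<le> real n" using p_le by simp
    also have "\<dots> < 2 * (2 + real n - 1)" by simp
    also have "\<dots> \<le> real k * (real k + real n - 1)" using k2 by (intro mult_mono) auto
    finally show False using Kk by simp
  qed
  have angle: "is_LOS f \<theta> \<longleftrightarrow> \<theta> = arccos (sqrt ((1 - real p / real n) / (1 - real p / (lam\<^sup>2 * real p))))"
    if \<theta>: "0 < \<theta>" "\<theta> < pi / 2" for \<theta>
  proof -
    let ?Q = "(1 - real p / real n) / (1 - real p / (lam\<^sup>2 * real p))"
    have cos: "cos \<theta> > 0" using \<theta> by (auto intro: cos_gt_zero)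
    have "sin \<theta> > 0" using \<theta> by (auto intro: sin_gt_zero)
    then have "(sin \<theta>)\<^sup>2 > 0" by simp
    then have cos1: "(cos \<theta>)\<^sup>2 < 1" unfolding sin_squared_eq by simp
    have "is_LOS f \<theta> \<longleftrightarrow> 1 / (cos \<theta>)\<^sup>2 * real n + (1 / ((cos \<theta>)\<^sup>2 + (1 - (cos \<theta>)\<^sup>2) * lam\<^sup>2) - 1 / (cos \<theta>)\<^sup>2) * real p
      = 1 / ((cos \<theta>)\<^sup>2 + (1 - (cos \<theta>)\<^sup>2) * lam\<^sup>2) * (lam\<^sup>2 * real p)"
      using LOS[OF \<theta>] eig by (simp only: sin_squared_eq) blast
    also have "\<dots> \<longleftrightarrow> (cos \<theta>)\<^sup>2 = ?Q"
      by (rule angle_equation) (use cos cos1 L1 p_pos p_le in auto)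
    also have "\<dots> \<longleftrightarrow> \<theta> = arccos (sqrt ?Q)"
    proof
      assume "(cos \<theta>)\<^sup>2 = ?Q"
      then have "sqrt ?Q = cos \<theta>" using cos by (metis real_sqrt_unique less_imp_le)
      then show "\<theta> = arccos (sqrt ?Q)" using arccos_cos[of \<theta>] \<theta> by simp
    next
      \<comment> \<open>To undo \<open>arccos\<close>, the quotient must be shown to lie in [0, 1]:
        the lower bound rests on p <= n and \<open>lam\<close> > 1, the upper bound on lam^2 p >=
        n.\<close>
      assume eq: "\<theta> = arccos (sqrt ?Q)"
      have r: "real p / real n \<le> 1" using p_le n1 by simp
      have e: "real p / (lam\<^sup>2 * real p) = 1 / lam\<^sup>2" using p_pos by simp
      have "1 / lam\<^sup>2 < 1" using L1 less_trans[OF zero_less_one L1] by (simp only: divide_less_eq_1_pos)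
      then have d: "1 - 1 / lam\<^sup>2 > 0" by simp
      have Q0: "?Q \<ge> 0" unfolding e using r d by simp
      have "lam\<^sup>2 * real p \<ge> real n"
      proof -
        have "real n \<le> 2 * (2 + real n - 1)" by simp
        also have "\<dots> \<le> real k * (real k + real n - 1)" using k2 by (intro mult_mono) auto
        finally show ?thesis by (simp only: Kk)
      qed
      then have "1 / lam\<^sup>2 \<le> real p / real n" using L1 n1 lam by (simp add: field_simps)
      then have "?Q \<le> 1" unfolding e using d by simp
      with Q0 have "0 \<le> sqrt ?Q" "sqrt ?Q \<le> 1" by (simp_all only: real_sqrt_ge_0_iff real_sqrt_le_1_iff)
      then have "cos \<theta> = sqrt ?Q" unfolding eq by (intro cos_arccos) linarith+
      then show "(cos \<theta>)\<^sup>2 = ?Q" using Q0 by simp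
    qed
    finally show ?thesis .
  qed
  show ?thesis
    using k2 harmonic lam_eq angle unfolding Kk by blast
qed

end
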